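(* Let $\rho>0$ and $0<\mu\le2/\rho$, and consider the semigroup $e^{tL}$ generated by $L$ in the space $X_{-1,\mu}$. Then there is a number $K=K(\mu)\ge1$ such that $$\|e^{tL}h^0\|_{-1,\mu}\le K\,\|h^0\|_{-1,\mu}\,e^{-t}\quad\text{for any } h^0\in X_{-1,\mu}\text{ and all } t\ge 0.$$
   Context: All functions live on $(0,\infty)$; integrals without limits are over $(0,\infty)$; $L^2(e^{\mu y})=L^2((0,\infty);e^{\mu y}dy)$; convolution is $(u*v)(y)=\int_0^y u(x)v(y-x)\,dx$. Fix $\rho>0$ and $g_\rho(y)=\frac4\rho e^{-2y/\rho}$. For a function $h$ integrable on $(\epsilon,\infty)$ for all $\epsilon>0$, $H(y):=\int_y^\infty h(x)\,dx$. For $\mu>0$ define $X_{-1,\mu}:=\{H' \mid H\in L^2(e^{\mu y}),\ \int H=0\}$, and for integer $k\ge0$, $X_{k,\mu}:=\{h\mid y^{k+1}D^kh\in L^2(e^{\mu y}),\ \int y\,h=0\}$ (derivatives in the sense of distributions on $(0,\infty)$). Put $\|h\|_{k,\mu}^2:=\int_0^\infty y^{2(k+1)}(D^kh)^2e^{\mu y}\,dy$, where $D^{-1}h:=-H$ (for $h\in X_{-1,\mu}$, $H$ is the function of $L^2(e^{\mu y})$ with $-H'=h$, so $\|h\|_{-1,\mu}^2=\int H^2e^{\mu y}$). The linearized self-similar coagulation operator is $$Lh:=y\,\partial_yh-\frac4\rho H+\frac2\rho\,H*g_\rho ,$$ with $\partial_y h$ in the sense of distributions. For $0<\mu<4/\rho$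 and integer $k\ge-1$, $L$ maps $X_{k+1,\mu}$ into $X_{k,\mu}$ and, as an unbounded operator on $X_{k,\mu}$ with domain $X_{k+1,\mu}$, generates an evolution semigroup $e^{tL}$ on $X_{k,\mu}$. *)

theory Defs
  imports "HOL-Analysis.Analysis"
begin

definition test_functions :: "(real \<Rightarrow> real) set" where
  "test_functions = {\<phi>. (\<forall>n. (deriv ^^ n) \<phi> differentiable_on UNIV) \<and>
     compact (closure {x. \<phi> x \<noteq> 0}) \<and> closure {x. \<phi> x \<noteq> 0} \<subseteq> {0<..}}"

text \<open>Distributions on the half-line are functionals on test functions. They are extended by 0
  to arguments that are not test functions, so that equality of distributions is equality of HOL
  functions and the vector space operations are pointwise. Continuity is not imposed on the type:
  the spaces below consist of locally integrable functions and derivatives of such.\<close>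

type_synonym distribution = "(real \<Rightarrow> real) \<Rightarrow> real"

definition distr_of :: "(real \<Rightarrow> real) \<Rightarrow> distribution" where
  "distr_of u = (\<lambda>\<phi>. if \<phi> \<in> test_functions then LINT y:{0<..}|lborel. u y * \<phi> y else 0)"

definition distr_deriv :: "distribution \<Rightarrow> distribution" where
  "distr_deriv T = (\<lambda>\<phi>. if \<phi> \<in> test_functions then - T (deriv \<phi>) else 0)"

text \<open>Only meaningful for multipliers that are smooth on the half-line.\<close>

definition distr_mult :: "(real \<Rightarrow> real) \<Rightarrow> distribution \<Rightarrow> distribution" where
  "distr_mult a T = (\<lambda>\<phi>. if \<phi> \<in> test_functions then T (\<lambda>y. a y * \<phi> y) else 0)"

definition L2_exp :: "real \<Rightarrow> (real \<Rightarrow> real) set" where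
  "L2_exp \<mu> = {u. set_borel_measurable lborel {0<..} u \<and>
     set_integrable lborel {0<..} (\<lambda>y. (u y)\<^sup>2 * exp (\<mu> * y))}"

text \<open>The space with index -1 consists of distributions. The one with index 0 is given by
  functions; the corresponding set of distributions is its image under \<^const>\<open>distr_of\<close>.
  In both cases weighted square integrability makes the integrals required to vanish
  absolutely convergent.\<close>

definition X_minus1 :: "real \<Rightarrow> distribution set" where
  "X_minus1 \<mu> = {distr_deriv (distr_of H) | H. H \<in> L2_exp \<mu> \<and> (LINT y:{0<..}|lborel. H y) = 0}"

definition X_0 :: "real \<Rightarrow> (real \<Rightarrow> real) set" where
  "X_0 \<mu> = {h. (\<lambda>y. y * h y) \<in> L2_exp \<mu> \<and> (LINT y:{0<..}|lborel. y * h y) = 0}"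

text \<open>The function \<open>H\<close> in the weighted space with \<open>- H' = h\<close>. It is determined up to null sets,
  since nonzero constants are not in the weighted space; the norm does not depend on the choice.\<close>

definition primitive :: "real \<Rightarrow> distribution \<Rightarrow> real \<Rightarrow> real" where
  "primitive \<mu> h = (SOME H. H \<in> L2_exp \<mu> \<and> h = (\<lambda>\<phi>. - distr_deriv (distr_of H) \<phi>))"

definition norm_minus1 :: "real \<Rightarrow> distribution \<Rightarrow> real" where
  "norm_minus1 \<mu> h = sqrt (LINT y:{0<..}|lborel. (primitive \<mu> h y)\<^sup>2 * exp (\<mu> * y))"

definition tail_integral :: "(real \<Rightarrow> real) \<Rightarrow> real \<Rightarrow> real" where
  "tail_integral h y = (LINT x:{y<..}|lborel. h x)"

definition convolution :: "(real \<Rightarrow> real) \<Rightarrow> (real \<Rightarrow> real) \<Rightarrow> real \<Rightarrow> real" where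
  "convolution u v y = (LINT x:{0<..<y}|lborel. u x * v (y - x))"

definition g_profile :: "real \<Rightarrow> real \<Rightarrow> real" where
  "g_profile \<rho> y = 4 / \<rho> * exp (- 2 * y / \<rho>)"

definition coag_L :: "real \<Rightarrow> (real \<Rightarrow> real) \<Rightarrow> distribution" where
  "coag_L \<rho> h = (let H = tail_integral h in
     (\<lambda>\<phi>. distr_mult (\<lambda>y. y) (distr_deriv (distr_of h)) \<phi>
        - 4 / \<rho> * distr_of H \<phi>
        + 2 / \<rho> * distr_of (convolution H (g_profile \<rho>)) \<phi>))"

text \<open>Strongly continuous semigroups of bounded linear operators on a vector space \<open>X\<close> of
  real-valued functions with norm \<open>N\<close>; only \<open>S t u\<close> with \<open>t \<ge> 0\<close> and \<open>u \<in> X\<close> matters.\<close>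

definition C0_semigroup ::
  "('a \<Rightarrow> real) set \<Rightarrow> (('a \<Rightarrow> real) \<Rightarrow> real) \<Rightarrow> (real \<Rightarrow> ('a \<Rightarrow> real) \<Rightarrow> ('a \<Rightarrow> real)) \<Rightarrow> bool" where
  "C0_semigroup X N S \<longleftrightarrow>
     (\<forall>t\<ge>0. \<forall>u\<in>X. S t u \<in> X) \<and>
     (\<forall>t\<ge>0. \<forall>u\<in>X. \<forall>v\<in>X. \<forall>a b.
        S t (\<lambda>x. a * u x + b * v x) = (\<lambda>x. a * S t u x + b * S t v x)) \<and>
     (\<forall>t\<ge>0. \<exists>C. \<forall>u\<in>X. N (S t u) \<le> C * N u) \<and>
     (\<forall>u\<in>X. S 0 u = u) \<and>
     (\<forall>s\<ge>0. \<forall>t\<ge>0. \<forall>u\<in>X. S (s + t) u = S s (S t u)) \<and>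
     (\<forall>u\<in>X. ((\<lambda>t. N (\<lambda>x. S t u x - u x)) \<longlongrightarrow> 0) (at_right 0))"

text \<open>The graph of the infinitesimal generator.\<close>

definition generator_graph ::
  "('a \<Rightarrow> real) set \<Rightarrow> (('a \<Rightarrow> real) \<Rightarrow> real) \<Rightarrow> (real \<Rightarrow> ('a \<Rightarrow> real) \<Rightarrow> ('a \<Rightarrow> real))
     \<Rightarrow> (('a \<Rightarrow> real) \<times> ('a \<Rightarrow> real)) set" where
  "generator_graph X N S = {(u, v). u \<in> X \<and> v \<in> X \<and>
     ((\<lambda>t. N (\<lambda>x. (S t u x - u x) / t - v x)) \<longlongrightarrow> 0) (at_right 0)}"

text \<open>\<open>S\<close> is the semigroup \<open>e\<^sup>t\<^sup>L\<close> on the space with index -1: its generator is exactly \<open>L\<close> with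
  the space with index 0 as domain.\<close>

definition coag_semigroup :: "real \<Rightarrow> real \<Rightarrow> (real \<Rightarrow> distribution \<Rightarrow> distribution) \<Rightarrow> bool" where
  "coag_semigroup \<rho> \<mu> S \<longleftrightarrow>
     C0_semigroup (X_minus1 \<mu>) (norm_minus1 \<mu>) S \<and>
     generator_graph (X_minus1 \<mu>) (norm_minus1 \<mu>) S = {(distr_of h, coag_L \<rho> h) | h. h \<in> X_0 \<mu>}"

end

theory Submission
  imports Defs
begin

text \<open>On the level of primitives, \<open>h = - H'\<close>, the operator is \<open>A H = y H' - H + H * g\<close>, and the
  Laplace transform turns the evolution into a transport equation along \<open>\<sigma>(t) = \<sigma> exp t\<close> that is
  solved explicitly. Hence the primitive of \<open>S t h\<close> is a dilation of \<open>H\<close> convolved with an explicit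
  exponential kernel, and the mean-zero condition allows an integration by parts that produces the
  decay. This determines every semigroup with generator \<open>L\<close> on the domain; left-continuity of its
  orbits, needed to integrate the evolution in time, comes from local boundedness, that is, from the
  uniform boundedness principle on the complete space. Density of the domain finishes the proof.\<close>

section \<open>Smooth functions and test functions\<close>

text \<open>The bound is shown for every \<open>S\<close> with the given generator, and
  \<open>K\<close> is \<open>decay_const (2 / \<rho>) \<mu>\<close>, which does not depend on
  \<open>S\<close>. On the transform side an orbit solves l_t + s l_s = (4 / (\<rho> s + 2) - 2) l.
  The factor on the right is -2 \<rho> s / (\<rho> s + 2), and its integral along s' = s is minus
  the logarithm of (1 + \<rho> s / 2)^2; this is the origin of the squares. The obstacle to decay is
  mass. With E = exp t, the function E G(E y) keeps its integral while it concentrates at 0, so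
  convolution with a kernel tending to k^2 y exp(-k y), k = 2 / \<rho>, would leave a nonzero limit.
  With mass 0 one may pass to the primitive of E G(E y), which is bounded by a multiple of
  exp(-\<mu> E y / 2). The integral of that bound is of order 1 / E, and this is the rate exp(-t).
  The kernel carries exp(-k y), which beats the square root exp(\<mu> y / 2) of the weight with room
  to spare because \<mu> \<le> k; the spare decay absorbs the linear factor of the kernel.\<close>

text \<open>Smoothness is encoded by the existence of successive derivatives, without naming them,
  so that closure under sums, products and affine substitutions is a plain induction.
  \<open>cdiff_iff\<close> translates back to the iterates of \<open>deriv\<close>.\<close>

fun cdiff :: "nat \<Rightarrow> (real \<Rightarrow> real) \<Rightarrow> bool" where
  "cdiff 0 f = True"
| "cdiff (Suc n) f = (\<exists>f'. (\<forall>x. (f has_real_derivative f' x) (at x)) \<and> cdiff n f')"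

lemma cdiff_iff: "cdiff n f \<longleftrightarrow> (\<forall>k<n. (deriv ^^ k) f differentiable_on UNIV)"
proof (induction n arbitrary: f)
  case 0
  then show ?case by simp
next
  case (Suc n)
  have "cdiff (Suc n) f \<longleftrightarrow> f differentiable_on UNIV \<and> cdiff n (deriv f)"
  proof
    assume "cdiff (Suc n) f"
    then obtain f' where f': "\<And>x. (f has_real_derivative f' x) (at x)" "cdiff n f'" by auto
    then have "deriv f = f'" by (auto intro!: ext DERIV_imp_deriv)
    with f' show "f differentiable_on UNIV \<and> cdiff n (deriv f)"
      by (auto simp: differentiable_on_def real_differentiable_def)
  next
    assume a: "f differentiable_on UNIV \<and> cdiff n (deriv f)"
    then have "(f has_real_derivative deriv f x) (at x)" for x
      by (auto simp: differentiable_on_def DERIV_deriv_iff_real_differentiable)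
    with a show "cdiff (Suc n) f" by auto
  qed
  also have "\<dots> \<longleftrightarrow> (\<forall>k<Suc n. (deriv ^^ k) f differentiable_on UNIV)"
    by (auto simp: Suc.IH less_Suc_eq_0_disj funpow_Suc_right simp del: funpow.simps(2))
  finally show ?case .
qed

lemma cdiff_const: "cdiff n (\<lambda>x. c)"
  by (induction n arbitrary: c) (auto intro!: exI[of _ "\<lambda>x. 0"])

lemma cdiff_mono: "cdiff (Suc n) f \<Longrightarrow> cdiff n f"
  by (auto simp: cdiff_iff)

lemma cdiff_add: "cdiff n f \<Longrightarrow> cdiff n g \<Longrightarrow> cdiff n (\<lambda>x. f x + g x)"
proof (induction n arbitrary: f g)
  case (Suc n)
  then obtain f' g' where "\<forall>x. (f has_real_derivative f' x) (at x)" "cdiff n f'"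
    "\<forall>x. (g has_real_derivative g' x) (at x)" "cdiff n g'" by auto
  with Suc.IH[of f' g'] show ?case
    by (auto intro!: exI[of _ "\<lambda>x. f' x + g' x"] derivative_intros)
qed simp

lemma cdiff_mult: "cdiff n f \<Longrightarrow> cdiff n g \<Longrightarrow> cdiff n (\<lambda>x. f x * g x)"
proof (induction n arbitrary: f g)
  case (Suc n)
  then obtain f' g' where *: "\<forall>x. (f has_real_derivative f' x) (at x)" "cdiff n f'"
    "\<forall>x. (g has_real_derivative g' x) (at x)" "cdiff n g'" by auto
  have "cdiff n (\<lambda>x. f' x * g x + g' x * f x)"
    using Suc cdiff_mono * by (intro cdiff_add) auto
  with * show ?case
    by (auto intro!: exI[of _ "\<lambda>x. f' x * g x + g' x * f x"] DERIV_mult)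
qed simp

lemma cdiff_affine: "cdiff n f \<Longrightarrow> cdiff n (\<lambda>x. f (a * x + b))"
proof (induction n arbitrary: f)
  case (Suc n)
  then obtain f' where *: "\<forall>x. (f has_real_derivative f' x) (at x)" "cdiff n f'" by auto
  have "((\<lambda>x. f (a * x + b)) has_real_derivative f' (a * x + b) * a) (at x)" for x
    by (rule DERIV_chain2[where f=f]) (use * in \<open>auto intro!: derivative_eq_intros\<close>)
  moreover have "cdiff n (\<lambda>x. f' (a * x + b) * a)"
    using Suc.IH * by (intro cdiff_mult cdiff_const) auto
  ultimately show ?case by (auto intro!: exI[of _ "\<lambda>x. f' (a * x + b) * a"])
qed simp

lemma cdiff_ident: "cdiff n (\<lambda>x. x)"
  by (cases n) (auto intro!: exI[of _ "\<lambda>x. 1"] cdiff_const)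

lemma test_functionsI:
  assumes "\<And>n. cdiff n \<phi>" and "0 < a" and "\<And>y. y \<notin> {a..b} \<Longrightarrow> \<phi> y = 0"
  shows "\<phi> \<in> test_functions"
proof -
  have "(deriv ^^ n) \<phi> differentiable_on UNIV" for n
    using assms(1)[of "Suc n"] by (auto simp: cdiff_iff)
  moreover have "closure {x. \<phi> x \<noteq> 0} \<subseteq> {a..b}"
    using assms(3) by (intro closure_minimal subsetI closed_atLeastAtMost) (metis (mono_tags, lifting) mem_Collect_eq)
  moreover from this have "compact (closure {x. \<phi> x \<noteq> 0})"
    by (metis bounded_closed_interval bounded_subset closed_closure compact_eq_bounded_closed)
  ultimately show ?thesis
    using assms(2) by (force simp: test_functions_def)
qed

lemma test_functionsE:
  assumes "\<phi> \<in> test_functions"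
  obtains a b where "0 < a" "a < b" "\<And>y. y \<notin> {a..b} \<Longrightarrow> \<phi> y = 0"
    "\<And>y. y \<notin> {a..b} \<Longrightarrow> deriv \<phi> y = 0"
proof -
  let ?K = "closure {x. \<phi> x \<noteq> 0}"
  have K: "compact ?K" "?K \<subseteq> {0<..}" using assms by (auto simp: test_functions_def)
  obtain a b where ab: "0 < a" "a < b" "?K \<subseteq> {a..b}"
  proof (cases "?K = {}")
    case True
    then show ?thesis using that[of 1 2] by auto
  next
    case False
    obtain m where m: "m \<in> ?K" "\<And>y. y \<in> ?K \<Longrightarrow> m \<le> y"
      using continuous_attains_inf[OF K(1) False continuous_on_id] by auto
    obtain M where M: "M \<in> ?K" "\<And>y. y \<in> ?K \<Longrightarrow> y \<le> M"
      using continuous_attains_sup[OF K(1) False continuous_on_id] by auto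
    \<comment> \<open>A nonempty compact subset of the open half-line has a positive minimum. The +1
      only makes the interval nondegenerate.\<close>
    show ?thesis by (rule that[of m "M + 1"]) (use m M K in \<open>force+\<close>)
  qed
  have z: "\<phi> y = 0" if "y \<notin> {a..b}" for y
    using that ab closure_subset[of "{x. \<phi> x \<noteq> 0}"] by auto
  moreover have "deriv \<phi> y = 0" if "y \<notin> {a..b}" for y
  proof -
    have "open (- {a..b})" by auto
    then have "eventually (\<lambda>x. x \<in> - {a..b}) (nhds y)"
      using that by (intro eventually_nhds_in_open) auto
    then have "eventually (\<lambda>x. \<phi> x = 0) (nhds y)"
      by eventually_elim (use z in auto)
    then have "deriv \<phi> y = deriv (\<lambda>_. 0) y" by (rule deriv_cong_ev) simp
    then show ?thesis by simp
  qed
  ultimately show ?thesis using that ab by blast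
qed

lemma test_functions_cdiff: "\<phi> \<in> test_functions \<Longrightarrow> cdiff n \<phi>"
  by (auto simp: test_functions_def cdiff_iff)

lemma test_functions_DERIV:
  assumes "\<phi> \<in> test_functions" shows "(\<phi> has_real_derivative deriv \<phi> x) (at x)"
proof -
  have "cdiff 1 \<phi>" using assms by (rule test_functions_cdiff)
  then show ?thesis by (metis DERIV_imp_deriv One_nat_def cdiff.simps(2))
qed

lemma test_functions_deriv:
  assumes "\<phi> \<in> test_functions" shows "deriv \<phi> \<in> test_functions"
proof -
  obtain a b where ab: "0 < a" "a < b" "\<And>y. y \<notin> {a..b} \<Longrightarrow> deriv \<phi> y = 0"
    using test_functionsE[OF assms] by metis
  have "cdiff n (deriv \<phi>)" for n
  proof -
    have "cdiff (Suc n) \<phi>" using assms by (rule test_functions_cdiff)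
    then obtain f' where f': "\<And>x. (\<phi> has_real_derivative f' x) (at x)" "cdiff n f'" by auto
    then have "deriv \<phi> = f'" by (auto intro!: ext DERIV_imp_deriv)
    then show ?thesis using f' by simp
  qed
  then show ?thesis using ab by (intro test_functionsI)
qed

lemma test_functions_mult_ident:
  assumes "\<phi> \<in> test_functions" shows "(\<lambda>y. y * \<phi> y) \<in> test_functions"
proof -
  obtain a b where ab: "0 < a" "a < b" "\<And>y. y \<notin> {a..b} \<Longrightarrow> \<phi> y = 0"
    using test_functionsE[OF assms] by metis
  have "cdiff n (\<lambda>y. y * \<phi> y)" for n
    by (intro cdiff_mult cdiff_ident test_functions_cdiff assms)
  then show ?thesis using ab by (intro test_functionsI[of _ a b]) auto
qed

lemma test_functions_continuous:
  assumes "\<phi> \<in> test_functions" shows "continuous_on A \<phi>"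
  by (meson DERIV_continuous_on assms test_functions_DERIV has_field_derivative_at_within)

lemma test_functions_bounded:
  assumes "\<phi> \<in> test_functions" obtains B where "B > 0" "\<And>x. \<bar>\<phi> x\<bar> \<le> B"
proof -
  obtain a b where ab: "0 < a" "a < b" "\<And>y. y \<notin> {a..b} \<Longrightarrow> \<phi> y = 0"
    using test_functionsE[OF assms] by metis
  have "bounded (\<phi> ` {a..b})"
    by (intro compact_imp_bounded compact_continuous_image test_functions_continuous assms) auto
  then obtain B where "\<And>x. x \<in> {a..b} \<Longrightarrow> \<bar>\<phi> x\<bar> \<le> B" unfolding bounded_iff by (metis imageI real_norm_def)
  then have "\<bar>\<phi> x\<bar> \<le> \<bar>B\<bar> + 1" for x using ab(3)[of x] by (cases "x \<in> {a..b}") force+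
  then show ?thesis using that[of "\<bar>B\<bar> + 1"] by auto
qed

text \<open>Functions \<open>p (1/x) exp (-1/x)\<close>, extended by 0 to \<open>x \<le> 0\<close>, are closed under
  differentiation.\<close>

definition flat_fun :: "real poly \<Rightarrow> real \<Rightarrow> real" where
  "flat_fun p x = (if x > 0 then poly p (inverse x) * exp (- inverse x) else 0)"

lemma poly_times_exp_tendsto_0: "((\<lambda>x::real. poly p x * exp (- x)) \<longlongrightarrow> 0) at_top"
proof -
  have "((\<lambda>x. \<Sum>i\<le>degree p. coeff p i * (x ^ i / exp x)) \<longlongrightarrow> (\<Sum>i\<le>degree p. coeff p i * 0)) at_top"
    by (intro tendsto_sum tendsto_mult tendsto_const tendsto_power_div_exp_0)
  then show ?thesis
    by (simp add: poly_altdef exp_minus sum_distrib_right divide_inverse mult.assoc)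
qed

text \<open>For x > 0 the chain rule gives (1/x)^2 (p - p')(1/x) exp(-1/x), and
  \<open>[:0, 0, 1:]\<close> is the polynomial X^2. Only x = 0 needs a limit.\<close>

lemma flat_fun_DERIV:
  "(flat_fun p has_real_derivative flat_fun ([:0, 0, 1:] * (p - pderiv p)) x) (at x)"
proof -
  consider "x > 0" | "x < 0" | "x = 0" by linarith
  then show ?thesis
  proof cases
    case 1
    have "((\<lambda>x. poly p (inverse x) * exp (- inverse x)) has_real_derivative
        flat_fun ([:0, 0, 1:] * (p - pderiv p)) x) (at x)"
      using 1 by (auto intro!: derivative_eq_intros simp: flat_fun_def field_simps power2_eq_square)
    moreover have "eventually (\<lambda>y. flat_fun p y = poly p (inverse y) * exp (- inverse y)) (nhds x)"
      using eventually_nhds_in_open[of "{0<..}" x] 1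
      by (auto simp: flat_fun_def elim!: eventually_mono)
    ultimately show ?thesis by (subst DERIV_cong_ev[OF refl _ refl])
  next
    case 2
    have "eventually (\<lambda>y. flat_fun p y = 0) (nhds x)"
      using eventually_nhds_in_open[of "{..<0}" x] 2
      by (auto simp: flat_fun_def elim!: eventually_mono)
    then have "(flat_fun p has_real_derivative 0) (at x)"
      by (subst DERIV_cong_ev[OF refl _ refl]) auto
    then show ?thesis using 2 by (simp add: flat_fun_def)
  next
    case 3
    \<comment> \<open>At 0 the right difference quotient is (X p)(1/h) exp(-1/h), and the
      exponential beats every polynomial in 1/h.\<close>
    have "((\<lambda>h. poly ([:0, 1:] * p) (inverse h) * exp (- inverse h)) \<longlongrightarrow> 0) (at_right 0)"
      by (rule filterlim_compose[OF poly_times_exp_tendsto_0 filterlim_inverse_at_top_right])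
    then have "((\<lambda>h. (flat_fun p (0 + h) - flat_fun p 0) / h) \<longlongrightarrow> 0) (at_right 0)"
      by (rule filterlim_mono_eventually)
        (auto simp: eventually_at_filter flat_fun_def field_simps)
    moreover have "((\<lambda>h. (flat_fun p (0 + h) - flat_fun p 0) / h) \<longlongrightarrow> 0) (at_left 0)"
      by (rule tendsto_eventually) (auto simp: eventually_at_filter flat_fun_def)
    ultimately have "((\<lambda>h. (flat_fun p (0 + h) - flat_fun p 0) / h) \<longlongrightarrow> 0) (at 0)"
      by (simp add: filterlim_at_split)
    then show ?thesis using 3 by (simp add: DERIV_def flat_fun_def)
  qed
qed

lemma cdiff_flat_fun: "cdiff n (flat_fun p)"
  by (induction n arbitrary: p) (auto intro: flat_fun_DERIV)

section \<open>A smooth step and its primitive\<close>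

lemma antiderivative_on_line:
  fixes f :: "real \<Rightarrow> real"
  assumes "continuous_on UNIV f" and "\<And>x. x \<le> 0 \<Longrightarrow> f x = 0"
  obtains F where "\<And>x. (F has_real_derivative f x) (at x)" "\<And>x. x \<le> 0 \<Longrightarrow> F x = 0"
proof -
  \<comment> \<open>The lower limit -1 puts 0 in the interior of the range of integration, so the
    fundamental theorem gives a two-sided derivative there. Further left \<open>F\<close> vanishes
    identically.\<close>
  define F where "F x = integral {-1..x} f" for x
  have F0: "F x = 0" if "x \<le> 0" for x
    unfolding F_def using that assms(2) by (subst integral_cong[where g="\<lambda>_. 0"]) auto
  have "(F has_real_derivative f x) (at x)" for x
  proof (cases "x > -1")
    case True
    have "(F has_real_derivative f x) (at x within {-1..x+1})"
      unfolding F_def by (rule integral_has_real_derivative)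
        (use True assms(1) in \<open>auto intro: continuous_on_subset\<close>)
    moreover have "x \<in> interior {-1..x+1}" using True by auto
    ultimately show ?thesis by (metis at_within_interior)
  next
    case False
    then have "x < 0" by linarith
    have "eventually (\<lambda>y. F y = 0) (nhds x)"
      using eventually_nhds_in_open[of "{..<0}" x] \<open>x < 0\<close> F0
      by (auto elim!: eventually_mono)
    then have "(F has_real_derivative 0) (at x)"
      by (subst DERIV_cong_ev[OF refl _ refl]) auto
    then show ?thesis using assms(2) \<open>x < 0\<close> by simp
  qed
  then show ?thesis using that F0 by blast
qed

text \<open>\<open>\<theta>\<close> is a smooth step whose rescalings approximate indicators. Its
  primitive \<open>\<Theta>\<close> is needed as well, because the fundamental lemma below tests
  only against derivatives of test functions.\<close>

lemma smooth_ramp: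
  obtains \<Theta> \<theta> :: "real \<Rightarrow> real" where
    "\<And>n. cdiff n \<Theta>" "\<And>x. (\<Theta> has_real_derivative \<theta> x) (at x)"
    "\<And>x. x \<le> 0 \<Longrightarrow> \<Theta> x = 0" "\<And>x. x \<le> 0 \<Longrightarrow> \<theta> x = 0" "\<And>x. x \<ge> 1 \<Longrightarrow> \<theta> x = 1"
    "\<And>x. 0 \<le> \<theta> x \<and> \<theta> x \<le> 1" "continuous_on UNIV \<theta>"
proof -
  \<comment> \<open>The bump exp(-1/x - 1/(1-x)) on (0,1); its normalised integral is the step
    \<open>\<theta>\<close>.\<close>
  define b where "b x = flat_fun 1 x * flat_fun 1 (- 1 * x + 1)" for x
  have b0: "b x = 0" if "x \<le> 0 \<or> x \<ge> 1" for x using that by (auto simp: b_def flat_fun_def)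
  have bpos: "b x > 0" if "0 < x" "x < 1" for x using that by (auto simp: b_def flat_fun_def)
  have bnn: "b x \<ge> 0" for x by (auto simp: b_def flat_fun_def)
  have bsm: "cdiff n b" for n unfolding b_def
    by (intro cdiff_mult cdiff_flat_fun cdiff_affine)
  have cb: "continuous_on UNIV b"
    using bsm[of 1] by (auto intro: DERIV_continuous_on)
  obtain F where F: "\<And>x. (F has_real_derivative b x) (at x)" "\<And>x. x \<le> 0 \<Longrightarrow> F x = 0"
    by (rule antiderivative_on_line[OF cb]) (use b0 in auto)
  define c where "c = F 1"
  have cF: "continuous_on A F" for A
    by (meson DERIV_continuous_on F(1) has_field_derivative_at_within)
  have "F 0 < F 1"
    by (rule DERIV_pos_imp_increasing_open) (use F bpos cF in \<open>auto intro!: exI[of _ "b _"]\<close>)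
  then have c: "c > 0" using F(2)[of 0] by (simp add: c_def)
  have Fmono: "F x \<le> F y" if "x \<le> y" for x y
    by (rule DERIV_nonneg_imp_nondecreasing[OF that]) (use F bnn in blast)
  have F1: "F x = c" if "x \<ge> 1" for x
  proof (cases "x = 1")
    case False
    have "(F has_real_derivative 0) (at y)" if "1 < y" for y
      using F(1)[of y] b0[of y] that by simp
    then show ?thesis unfolding c_def
      using DERIV_isconst2[of 1 x F x] cF False that by auto
  qed (simp add: c_def)
  define \<theta> where "\<theta> x = F x / c" for x
  have d\<theta>: "(\<theta> has_real_derivative b x / c) (at x)" for x
    unfolding \<theta>_def using F(1) by (intro DERIV_cdivide)
  have c\<theta>: "continuous_on UNIV \<theta>" unfolding \<theta>_def using cF c by (intro continuous_intros) auto
  have \<theta>01: "0 \<le> \<theta> x \<and> \<theta> x \<le> 1" for x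
  proof -
    have "F x \<ge> 0" using F(2)[of x] F(2)[of 0] Fmono[of 0 x] by (cases "x \<le> 0") auto
    moreover have "F x \<le> c" using F1[of x] Fmono[of x 1] by (cases "x \<le> 1") (auto simp: c_def)
    ultimately show ?thesis using c by (auto simp: \<theta>_def field_simps)
  qed
  have \<theta>0: "\<theta> x = 0" if "x \<le> 0" for x using F(2) that by (simp add: \<theta>_def)
  have \<theta>1: "\<theta> x = 1" if "x \<ge> 1" for x using F1 that c by (simp add: \<theta>_def)
  obtain \<Theta> where \<Theta>: "\<And>x. (\<Theta> has_real_derivative \<theta> x) (at x)" "\<And>x. x \<le> 0 \<Longrightarrow> \<Theta> x = 0"
    by (rule antiderivative_on_line[OF c\<theta>]) (use \<theta>0 in auto)
  have "cdiff n (\<lambda>x. b x * inverse c)" for n by (intro cdiff_mult bsm cdiff_const)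
  then have "cdiff n \<theta>" for n using d\<theta> by (cases n) (auto simp: divide_inverse intro!: exI[of _ "\<lambda>x. b x * inverse c"])
  then have "cdiff n \<Theta>" for n using \<Theta>(1) by (cases n) auto
  then show ?thesis using that \<Theta> \<theta>0 \<theta>1 \<theta>01 c\<theta> by blast
qed

section \<open>The fundamental lemma of du Bois-Reymond\<close>

text \<open>One-sided Lebesgue differentiation, transferred from its version for gauge integrals
  over boxes. Passing to half-open intervals changes only a null set.\<close>

lemma right_average_tendsto:
  fixes f :: "real \<Rightarrow> real"
  assumes f: "integrable lborel f"
  shows "AE x in lborel. ((\<lambda>h. (LINT y|lborel. f y * indicator {x<..x+h} y) / h) \<longlongrightarrow> f x) (at_right 0)"
proof -
  have si: "set_integrable lborel A f" if "A \<in> sets borel" for A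
    unfolding set_integrable_def using f that by (intro integrable_mult_indicator) auto
  have "f integrable_on cbox a b" for a b :: real
    using si[of "cbox a b"] by (intro set_borel_integral_eq_integral) auto
  then obtain N where N: "negligible N" "\<And>x e. \<lbrakk>x \<notin> N; 0 < e\<rbrakk> \<Longrightarrow>
      \<exists>d>0. \<forall>h. 0 < h \<and> h < d \<longrightarrow>
        norm (integral (cbox x (x + h *\<^sub>R One)) f /\<^sub>R h ^ DIM(real) - f x) < e"
    using integrable_ccontinuous_explicit[of f] by metis
  have "AE x in lebesgue. x \<notin> N"
    using N(1) by (intro AE_not_in) (simp add: negligible_iff_null_sets)
  then have "AE x in lborel. x \<notin> N" by (simp add: AE_completion_iff)
  then show ?thesis
  proof (rule AE_mp, intro AE_I2 impI)
    fix x assume "x \<notin> N"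
    show "((\<lambda>h. (LINT y|lborel. f y * indicator {x<..x+h} y) / h) \<longlongrightarrow> f x) (at_right 0)"
    proof (rule tendstoI)
      fix e :: real assume "e > 0"
      obtain d where d: "d > 0" "\<And>h. 0 < h \<Longrightarrow> h < d \<Longrightarrow>
          norm (integral (cbox x (x + h *\<^sub>R One)) f /\<^sub>R h ^ DIM(real) - f x) < e"
        using N(2)[OF \<open>x \<notin> N\<close> \<open>e > 0\<close>] by blast
      have "integral {x..x+h} f = (LINT y|lborel. f y * indicator {x<..x+h} y)" for h
      proof -
        have "integral {x..x+h} f = (LINT y:{x..x+h}|lborel. f y)"
          using set_borel_integral_eq_integral(2)[OF si[of "{x..x+h}"]] by simp
        also have "\<dots> = (LINT y|lborel. f y * indicator {x<..x+h} y)"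
          unfolding set_lebesgue_integral_def
        proof (rule integral_cong_AE)
          show "AE y in lborel. indicator {x..x+h} y *\<^sub>R f y = f y * indicator {x<..x+h} y"
            using AE_lborel_singleton[of x] by eventually_elim (auto simp: indicator_def)
        qed (use borel_measurable_integrable[OF f] in measurable)
        finally show ?thesis .
      qed
      then have "dist ((LINT y|lborel. f y * indicator {x<..x+h} y) / h) (f x) < e" if "0 < h" "h < d" for h
        using d(2)[OF that] by (simp add: dist_real_def divide_inverse mult.commute)
      then show "\<forall>\<^sub>F h in at_right 0. dist ((LINT y|lborel. f y * indicator {x<..x+h} y) / h) (f x) < e"
        using d(1) by (auto simp: eventually_at_right)
    qed
  qed
qed

text \<open>All right averages at a point x > 0 vanish, and almost everywhere they converge to
  \<open>D x\<close>.\<close>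

lemma AE_zero_if_interval_integrals_zero:
  fixes D :: "real \<Rightarrow> real"
  assumes D: "integrable lborel D" and z: "\<And>y. y \<le> 0 \<Longrightarrow> D y = 0"
    and i: "\<And>a b. 0 < a \<Longrightarrow> a < b \<Longrightarrow> (LINT y|lborel. D y * indicator {a<..b} y) = 0"
  shows "AE y in lborel. D y = 0"
  using right_average_tendsto[OF D]
proof eventually_elim
  fix x assume *: "((\<lambda>h. (LINT y|lborel. D y * indicator {x<..x+h} y) / h) \<longlongrightarrow> D x) (at_right 0)"
  show "D x = 0"
  proof (cases "x \<le> 0")
    case False
    have "eventually (\<lambda>h. (LINT y|lborel. D y * indicator {x<..x+h} y) / h = 0) (at_right 0)"
      using i False by (auto simp: eventually_at_filter)
    then have "((\<lambda>h. (LINT y|lborel. D y * indicator {x<..x+h} y) / h) \<longlongrightarrow> 0) (at_right 0)"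
      by (rule tendsto_eventually)
    with * show ?thesis by (intro tendsto_unique[of "at_right (0::real)"]) auto
  qed (rule z)
qed

text \<open>The tests alone would only make \<open>D\<close> constant on the half-line;
  integrability excludes a nonzero constant. Concretely, a smoothed indicator and its translate have
  the same integral against \<open>D\<close>, and the translate is pushed to infinity.\<close>

lemma du_Bois_Reymond:
  fixes D :: "real \<Rightarrow> real"
  assumes D: "integrable lborel D" and z: "\<And>y. y \<le> 0 \<Longrightarrow> D y = 0"
    and t: "\<And>\<phi>. \<phi> \<in> test_functions \<Longrightarrow> (LINT y|lborel. D y * deriv \<phi> y) = 0"
  shows "AE y in lborel. D y = 0"
proof (rule AE_zero_if_interval_integrals_zero[OF D z])
  fix a b :: real assume ab: "0 < a" "a < b"
  obtain \<Theta> \<theta> :: "real \<Rightarrow> real" where \<Theta>: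
    "\<And>n. cdiff n \<Theta>" "\<And>x. (\<Theta> has_real_derivative \<theta> x) (at x)"
    "\<And>x. x \<le> 0 \<Longrightarrow> \<Theta> x = 0" "\<And>x. x \<le> 0 \<Longrightarrow> \<theta> x = 0" "\<And>x. x \<ge> 1 \<Longrightarrow> \<theta> x = 1"
    "\<And>x. 0 \<le> \<theta> x \<and> \<theta> x \<le> 1" "continuous_on UNIV \<theta>"
    by (rule smooth_ramp) blast
  have [measurable]: "\<theta> \<in> borel_measurable borel" "D \<in> borel_measurable lborel"
    using \<Theta>(7) D by (auto intro: borel_measurable_continuous_onI)
  have \<Theta>1: "\<Theta> x = \<Theta> 1 + (x - 1)" if "x \<ge> 1" for x
  proof (cases "x = 1")
    case False
    have "((\<lambda>x. \<Theta> x - x) has_real_derivative 0) (at y)" if "1 < y" for y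
      using \<Theta>(2)[of y] \<Theta>(5)[of y] that by (auto intro!: derivative_eq_intros)
    moreover have "continuous_on {1..x} (\<lambda>x. \<Theta> x - x)"
      by (intro continuous_intros) (meson DERIV_continuous_on \<Theta>(2) has_field_derivative_at_within)
    ultimately have "\<Theta> x - x = \<Theta> 1 - 1"
      using DERIV_isconst2[of 1 x "\<lambda>x. \<Theta> x - x" x] False that by auto
    then show ?thesis by simp
  qed simp
  \<comment> \<open>A smoothed indicator, tending pointwise to the indicator of (a, b].\<close>
  define w where "w n y = \<theta> (real n * (y - a)) - \<theta> (real n * (y - b))" for n y
  have [measurable]: "w n \<in> borel_measurable borel" for n unfolding w_def by measurable
  have w_le: "\<bar>w n y\<bar> \<le> 1" for n y
    using \<Theta>(6)[of "real n * (y - a)"] \<Theta>(6)[of "real n * (y - b)"] by (auto simp: w_def)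
  have bound: "norm (D y * w n y') \<le> norm (D y)" for n y y'
    using w_le[of n y'] by (simp add: abs_mult mult_left_le)
  \<comment> \<open>\<open>w n\<close> has nonzero integral, so its primitive is not compactly
    supported. The difference of \<open>w n\<close> and a translate has integral 0 and is the
    derivative of a test function.\<close>
  have step: "(LINT y|lborel. D y * w n y) = (LINT y|lborel. D y * w n (y - real m))"
    if n: "n > 0" for n m
  proof -
    define \<phi> where "\<phi> y = (\<Theta> (real n * y + (- real n * a)) + (-1) * \<Theta> (real n * y + (- real n * b))
      + (-1) * \<Theta> (real n * y + (- real n * (a + real m)))
      + \<Theta> (real n * y + (- real n * (b + real m)))) * (1 / real n)" for y
    have dc: "((\<lambda>y. \<Theta> (real n * y + c)) has_real_derivative \<theta> (real n * y + c) * real n) (at y)" for c y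
      by (rule DERIV_chain2[where f=\<Theta>]) (auto intro!: derivative_eq_intros \<Theta>(2))
    have "(\<phi> has_real_derivative (\<theta> (real n * y + (- real n * a)) * real n
        + (-1) * (\<theta> (real n * y + (- real n * b)) * real n)
        + (-1) * (\<theta> (real n * y + (- real n * (a + real m))) * real n)
        + \<theta> (real n * y + (- real n * (b + real m))) * real n) * (1 / real n)) (at y)" for y
      unfolding \<phi>_def by (intro DERIV_cmult_right DERIV_add DERIV_cmult dc)
    note this = DERIV_imp_deriv[OF this]
    moreover have "(A * real n + (-1) * (B * real n) + (-1) * (C * real n) + E * real n) * (1 / real n)
        = A - B - C + E" for A B C E
      using n by (simp add: field_simps)
    ultimately have d: "deriv \<phi> y = w n y - w n (y - real m)" for y
      using n by (simp add: w_def algebra_simps)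
    have "\<phi> \<in> test_functions"
    proof (rule test_functionsI)
      have "cdiff k (\<lambda>y. \<Theta> (real n * y + c))" for k c
        using cdiff_affine[OF \<Theta>(1)] .
      then show "cdiff k \<phi>" for k unfolding \<phi>_def
        by (intro cdiff_mult cdiff_add cdiff_const)
      show "0 < a" by fact
      fix y assume "y \<notin> {a..b + real m + 1}"
      then consider "y < a" | "y > b + real m + 1" by fastforce
      then show "\<phi> y = 0"
      proof cases
        case 1
        have "real n * y + (- real n * c) \<le> 0" if "c \<ge> a" for c
          using 1 n that mult_left_mono[of y c "real n"] by auto
        then show ?thesis using ab by (simp add: \<phi>_def \<Theta>(3))
      next
        case 2
        have ge: "real n * y + (- real n * c) \<ge> 1" if "c \<le> b + real m" for c
        proof -
          have "1 * 1 \<le> real n * (y - c)" using 2 n that by (intro mult_mono) auto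
          then show ?thesis by (simp add: algebra_simps)
        qed
        have eq: "\<Theta> (real n * y + (- real n * c)) = \<Theta> 1 + (real n * y + (- real n * c) - 1)"
          if "c \<le> b + real m" for c using \<Theta>1[OF ge[OF that]] .
        have "a \<le> b + real m" "b \<le> b + real m" "a + real m \<le> b + real m" using ab by auto
        \<comment> \<open>Right of the support all four ramps are in their linear range. The slopes
          cancel as 1 - 1 - 1 + 1, the offsets as -a + b + (a + m) - (b + m).\<close>
        note eqs = eq[OF this(1)] eq[OF this(2)] eq[OF this(3)] eq[OF order_refl]
        show ?thesis unfolding \<phi>_def eqs by (simp add: algebra_simps)
      qed
    qed
    from t[OF this] have "(LINT y|lborel. D y * w n y - D y * w n (y - real m)) = 0"
      by (simp add: d algebra_simps)
    moreover have "integrable lborel (\<lambda>y. D y * w n y)" "integrable lborel (\<lambda>y. D y * w n (y - real m))"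
      by (rule Bochner_Integration.integrable_bound[OF D, OF _ AE_I2[OF bound]]; measurable)+
    ultimately show ?thesis by simp
  qed
  \<comment> \<open>For fixed \<open>y\<close> the translated weight vanishes once m \<ge> y - a,
    and \<open>\<bar>D\<bar>\<close> dominates.\<close>
  have zero: "(LINT y|lborel. D y * w n y) = 0" if "n > 0" for n
  proof -
    have "(\<lambda>m. LINT y|lborel. D y * w n (y - real m)) \<longlonglongrightarrow> (LINT y::real|lborel. (0::real))"
    proof (rule integral_dominated_convergence[where w="\<lambda>y. norm (D y)"])
      show "AE y in lborel. (\<lambda>m. D y * w n (y - real m)) \<longlonglongrightarrow> 0"
      proof (intro AE_I2 tendsto_eventually)
        fix y :: real
        obtain m0 :: nat where "y - a \<le> real m0" using real_arch_simple by blast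
        then show "\<forall>\<^sub>F m in sequentially. D y * w n (y - real m) = 0"
          using ab by (intro eventually_sequentiallyI[of m0])
            (auto simp: w_def \<Theta>(4) mult_nonneg_nonpos)
      qed
    qed (measurable, rule integrable_norm[OF D], rule AE_I2[OF bound])
    then have "(\<lambda>m. LINT y|lborel. D y * w n y) \<longlonglongrightarrow> 0"
      using step[OF that] by simp
    then show ?thesis by (simp add: LIMSEQ_const_iff)
  qed
  have "(\<lambda>n. LINT y|lborel. D y * w n y) \<longlonglongrightarrow> (LINT y|lborel. D y * indicator {a<..b} y)"
  proof (rule integral_dominated_convergence[where w="\<lambda>y. norm (D y)"])
    have lim: "(\<lambda>n. \<theta> (real n * (y - c))) \<longlonglongrightarrow> (if y > c then 1 else 0)" for y c
    proof (rule tendsto_eventually)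
      obtain m0 :: nat where m0: "y > c \<Longrightarrow> 1 / (y - c) \<le> real m0" using real_arch_simple by blast
      show "\<forall>\<^sub>F n in sequentially. \<theta> (real n * (y - c)) = (if y > c then 1 else 0)"
      proof (rule eventually_sequentiallyI[of m0])
        fix n assume n: "m0 \<le> n"
        show "\<theta> (real n * (y - c)) = (if y > c then 1 else 0)"
        proof (cases "y > c")
          case True
          then have "1 / (y - c) \<le> real n" using m0 n by linarith
          then have "1 \<le> real n * (y - c)" using True by (simp add: field_simps)
          then show ?thesis using True by (simp add: \<Theta>(5))
        qed (simp add: \<Theta>(4) mult_nonneg_nonpos)
      qed
    qed
    have "(\<lambda>n. w n y) \<longlonglongrightarrow> indicator {a<..b} y" for y
      using tendsto_diff[OF lim[of y a] lim[of y b]] ab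
      by (auto simp: w_def indicator_def split: if_splits)
    then show "AE y in lborel. (\<lambda>n. D y * w n y) \<longlonglongrightarrow> D y * indicator {a<..b} y"
      by (intro AE_I2 tendsto_mult tendsto_const)
  qed (measurable, rule integrable_norm[OF D], rule AE_I2[OF bound])
  moreover have "(\<lambda>n. LINT y|lborel. D y * w n y) \<longlonglongrightarrow> 0"
    by (rule tendsto_eventually) (use zero in \<open>auto intro!: eventually_sequentiallyI[of 1]\<close>)
  ultimately show "(LINT y|lborel. D y * indicator {a<..b} y) = 0"
    by (rule LIMSEQ_unique)
qed

section \<open>Square-integrable functions\<close>

definition sqint :: "'a measure \<Rightarrow> ('a \<Rightarrow> real) \<Rightarrow> bool" where
  "sqint M f \<longleftrightarrow> f \<in> borel_measurable M \<and> integrable M (\<lambda>x. (f x)\<^sup>2)"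

definition l2norm :: "'a measure \<Rightarrow> ('a \<Rightarrow> real) \<Rightarrow> real" where
  "l2norm M f = sqrt (LINT x|M. (f x)\<^sup>2)"

lemma l2norm_nonneg [simp]: "l2norm M f \<ge> 0"
  by (simp add: l2norm_def)

lemma l2norm_power2: "(l2norm M f)\<^sup>2 = (LINT x|M. (f x)\<^sup>2)"
  by (simp add: l2norm_def)

lemma sqintD [dest]: "sqint M f \<Longrightarrow> f \<in> borel_measurable M" "sqint M f \<Longrightarrow> integrable M (\<lambda>x. (f x)\<^sup>2)"
  by (auto simp: sqint_def)

lemma sqint_cmult: "sqint M f \<Longrightarrow> sqint M (\<lambda>x. c * f x)"
  by (auto simp: sqint_def power_mult_distrib)

lemma l2norm_cmult: "l2norm M (\<lambda>x. c * f x) = \<bar>c\<bar> * l2norm M f"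
  by (simp add: l2norm_def power_mult_distrib real_sqrt_mult)

lemma integrable_sqint_mult:
  assumes "sqint M f" "sqint M g"
  shows "integrable M (\<lambda>x. f x * g x)"
proof (rule Bochner_Integration.integrable_bound)
  show "integrable M (\<lambda>x. (f x)\<^sup>2 + (g x)\<^sup>2)" using assms by (auto simp: sqint_def)
  show "(\<lambda>x. f x * g x) \<in> borel_measurable M" using assms by (auto simp: sqint_def)
  show "AE x in M. norm (f x * g x) \<le> norm ((f x)\<^sup>2 + (g x)\<^sup>2)"
  proof (rule AE_I2)
    fix x
    have "0 \<le> (\<bar>f x\<bar> - \<bar>g x\<bar>)\<^sup>2 + (f x)\<^sup>2 + (g x)\<^sup>2" by simp
    then show "norm (f x * g x) \<le> norm ((f x)\<^sup>2 + (g x)\<^sup>2)"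
      by (simp add: power2_diff abs_mult)
  qed
qed

lemma sqint_add:
  assumes "sqint M f" "sqint M g"
  shows "sqint M (\<lambda>x. f x + g x)"
  using assms integrable_sqint_mult[OF assms]
  by (auto simp: sqint_def power2_sum mult.assoc intro!: Bochner_Integration.integrable_add)

lemma sqint_diff:
  assumes "sqint M f" "sqint M g"
  shows "sqint M (\<lambda>x. f x - g x)"
  using sqint_add[OF assms(1) sqint_cmult[OF assms(2), of "-1"]] by simp

lemma sqint_cong_AE:
  assumes "sqint M f" "AE x in M. f x = g x" "g \<in> borel_measurable M"
  shows "sqint M g"
  using assms by (auto simp: sqint_def intro: integrable_cong_AE_imp)

lemma l2norm_cong_AE:
  assumes "AE x in M. f x = g x" "f \<in> borel_measurable M" "g \<in> borel_measurable M"
  shows "l2norm M f = l2norm M g"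
proof -
  have "(LINT x|M. (f x)\<^sup>2) = (LINT x|M. (g x)\<^sup>2)"
    using assms by (intro integral_cong_AE) auto
  then show ?thesis by (simp add: l2norm_def)
qed

text \<open>The integral of (s f + t g)^2 is a nonnegative quadratic form in (s, t); suitable
  choices of (s, t) yield B^2 \<le> A C.\<close>

lemma Cauchy_Schwarz_integral:
  assumes "sqint M f" "sqint M g"
  shows "\<bar>LINT x|M. f x * g x\<bar> \<le> l2norm M f * l2norm M g"
proof -
  define A B C where "A = (LINT x|M. (f x)\<^sup>2)" and "B = (LINT x|M. f x * g x)"
    and "C = (LINT x|M. (g x)\<^sup>2)"
  have AC: "A \<ge> 0" "C \<ge> 0" by (auto simp: A_def C_def)
  have q: "0 \<le> A * s\<^sup>2 + 2 * B * s * t + C * t\<^sup>2" for s t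
  proof -
    have "0 \<le> (LINT x|M. (s * f x + t * g x)\<^sup>2)" by simp
    also have "\<dots> = (LINT x|M. s\<^sup>2 * (f x)\<^sup>2 + 2 * s * t * (f x * g x) + t\<^sup>2 * (g x)\<^sup>2)"
      by (simp add: power2_sum power_mult_distrib algebra_simps)
    also have "\<dots> = s\<^sup>2 * A + 2 * s * t * B + t\<^sup>2 * C"
      using assms integrable_sqint_mult[OF assms] by (simp add: A_def B_def C_def sqint_def)
    finally show ?thesis by (simp add: mult_ac)
  qed
  have "B\<^sup>2 \<le> A * C"
  proof (cases "A = 0")
    case True
    have "B = 0"
    proof (rule ccontr)
      assume "B \<noteq> 0"
      \<comment> \<open>This choice of s makes the form equal to -2 (C + 1) + C, which is
        negative.\<close>
      have "0 \<le> 2 * B * (- (C + 1) / B) + C" using q[of "- (C + 1) / B" 1] True by simp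
      then show False using \<open>B \<noteq> 0\<close> AC by simp
    qed
    then show ?thesis using True by simp
  next
    case False
    then have "A > 0" using AC by simp
    have "0 \<le> A * B\<^sup>2 + 2 * B * (- B) * A + C * A\<^sup>2" using q[of "- B" A] by simp
    also have "\<dots> = A * (A * C - B\<^sup>2)" by (simp add: power2_eq_square algebra_simps)
    finally show ?thesis using \<open>A > 0\<close> by (simp add: zero_le_mult_iff)
  qed
  then have "\<bar>B\<bar> \<le> sqrt (A * C)" by (metis real_le_rsqrt power2_abs)
  then show ?thesis by (simp add: A_def B_def C_def l2norm_def real_sqrt_mult)
qed

lemma l2norm_triangle:
  assumes "sqint M f" "sqint M g"
  shows "l2norm M (\<lambda>x. f x + g x) \<le> l2norm M f + l2norm M g"
proof (rule power2_le_imp_le)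
  have "(l2norm M (\<lambda>x. f x + g x))\<^sup>2 = (LINT x|M. (f x)\<^sup>2 + 2 * (f x * g x) + (g x)\<^sup>2)"
    by (simp add: l2norm_power2 power2_sum algebra_simps)
  also have "\<dots> = (l2norm M f)\<^sup>2 + 2 * (LINT x|M. f x * g x) + (l2norm M g)\<^sup>2"
    using assms integrable_sqint_mult[OF assms] by (simp add: l2norm_power2 sqint_def)
  also have "\<dots> \<le> (l2norm M f)\<^sup>2 + 2 * (l2norm M f * l2norm M g) + (l2norm M g)\<^sup>2"
    using Cauchy_Schwarz_integral[OF assms] by simp
  finally show "(l2norm M (\<lambda>x. f x + g x))\<^sup>2 \<le> (l2norm M f + l2norm M g)\<^sup>2"
    by (simp add: power2_sum)
qed simp

lemma l2norm_triangle_diff: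
  assumes "sqint M f" "sqint M g"
  shows "l2norm M (\<lambda>x. f x - g x) \<le> l2norm M f + l2norm M g"
  using l2norm_triangle[OF assms(1) sqint_cmult[OF assms(2), of "-1"]] l2norm_cmult[of M "-1" g] by simp

lemma l2norm_mono:
  assumes "sqint M g" "f \<in> borel_measurable M" "AE x in M. \<bar>f x\<bar> \<le> \<bar>g x\<bar>"
  shows "sqint M f" "l2norm M f \<le> l2norm M g"
proof -
  have *: "AE x in M. (f x)\<^sup>2 \<le> (g x)\<^sup>2" using assms(3) by eventually_elim (simp add: abs_le_square_iff)
  show f: "sqint M f" unfolding sqint_def
  proof (rule conjI[OF assms(2)], rule Bochner_Integration.integrable_bound[of M "\<lambda>x. (g x)\<^sup>2"])
    show "AE x in M. norm ((f x)\<^sup>2) \<le> norm ((g x)\<^sup>2)" using * by simp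
  qed (use assms in \<open>auto simp: sqint_def\<close>)
  show "l2norm M f \<le> l2norm M g" unfolding l2norm_def
    using assms(1) f * by (intro real_sqrt_le_mono integral_mono_AE) (auto simp: sqint_def)
qed

lemma nn_integral_sqint:
  "sqint M f \<Longrightarrow> (\<integral>\<^sup>+x. ennreal ((f x)\<^sup>2) \<partial>M) = ennreal ((l2norm M f)\<^sup>2)"
  by (simp add: l2norm_power2 sqint_def nn_integral_eq_integral)

lemma sqint_if_nn_integral_le:
  assumes "f \<in> borel_measurable M" "(\<integral>\<^sup>+x. ennreal ((f x)\<^sup>2) \<partial>M) \<le> ennreal (B\<^sup>2)" "B \<ge> 0"
  shows "sqint M f" "l2norm M f \<le> B"
proof -
  show f: "sqint M f" unfolding sqint_def
    unfolding integrable_iff_bounded using assms le_less_trans[OF assms(2), of \<infinity>] by simp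
  have "ennreal ((l2norm M f)\<^sup>2) \<le> ennreal (B\<^sup>2)"
    using assms(2) nn_integral_sqint[OF f] by simp
  then have "(l2norm M f)\<^sup>2 \<le> B\<^sup>2" by (simp add: ennreal_le_iff)
  then show "l2norm M f \<le> B" using assms(3) by (rule power2_le_imp_le)
qed

section \<open>Convergence in L2\<close>

text \<open>Riesz-Fischer for sequences with geometrically small increments: the increments are
  almost everywhere bounded by a geometric sequence, so the pointwise limit exists, and Fatou
  carries the norm bound over to it.\<close>

lemma l2_complete:
  fixes f :: "nat \<Rightarrow> 'a \<Rightarrow> real"
  assumes f: "\<And>n. sqint M (f n)" and r: "0 < r" "r < 1" and c: "c \<ge> 0"
    and d: "\<And>n. l2norm M (\<lambda>x. f (Suc n) x - f n x) \<le> c * r ^ n"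
  obtains g where "sqint M g" "\<And>n. l2norm M (\<lambda>x. f n x - g x) \<le> c * r ^ n / (1 - r)"
proof -
  have [measurable]: "f n \<in> borel_measurable M" for n using f by auto
  define h where "h n x = f (Suc n) x - f n x" for n x
  have [measurable]: "h n \<in> borel_measurable M" for n unfolding h_def by measurable
  have hs: "sqint M (h n)" for n unfolding h_def using f by (intro sqint_diff)
  \<comment> \<open>Dividing by r^n is affordable since (c r^n)^2 / r^n = c^2 r^n is still summable.
    Finiteness of the sum at x then bounds the n-th increment there by a multiple of (sqrt
    r)^n.\<close>
  have "(\<integral>\<^sup>+x. (\<Sum>n. ennreal ((h n x)\<^sup>2 / r ^ n)) \<partial>M) = (\<Sum>n. \<integral>\<^sup>+x. ennreal ((h n x)\<^sup>2 / r ^ n) \<partial>M)"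
    by (rule nn_integral_suminf) measurable
  also have "\<dots> \<le> (\<Sum>n. ennreal (c\<^sup>2 * r ^ n))"
  proof (rule suminf_le)
    fix n
    have "(\<integral>\<^sup>+x. ennreal ((h n x)\<^sup>2 / r ^ n) \<partial>M) = (\<integral>\<^sup>+x. ennreal (1 / r ^ n) * ennreal ((h n x)\<^sup>2) \<partial>M)"
      using r by (intro nn_integral_cong) (auto simp flip: ennreal_mult)
    also have "\<dots> = ennreal (1 / r ^ n) * ennreal ((l2norm M (h n))\<^sup>2)"
      by (subst nn_integral_cmult) (auto simp: nn_integral_sqint[OF hs])
    also have "\<dots> = ennreal ((l2norm M (h n))\<^sup>2 / r ^ n)"
      using r by (simp flip: ennreal_mult)
    also have "\<dots> \<le> ennreal (c\<^sup>2 * r ^ n)"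
    proof (rule ennreal_leI)
      have "(l2norm M (h n))\<^sup>2 \<le> (c * r ^ n)\<^sup>2"
        using d[of n] by (intro power_mono) (auto simp: h_def[abs_def])
      then show "(l2norm M (h n))\<^sup>2 / r ^ n \<le> c\<^sup>2 * r ^ n"
        using r by (simp add: field_simps power2_eq_square)
    qed
    finally show "(\<integral>\<^sup>+x. ennreal ((h n x)\<^sup>2 / r ^ n) \<partial>M) \<le> ennreal (c\<^sup>2 * r ^ n)" .
  qed auto
  also have "\<dots> < \<infinity>"
    using r by (subst suminf_ennreal2) (auto intro!: summable_mult summable_geometric)
  finally have "(\<integral>\<^sup>+x. (\<Sum>n. ennreal ((h n x)\<^sup>2 / r ^ n)) \<partial>M) \<noteq> \<infinity>" by simp
  then have "AE x in M. (\<Sum>n. ennreal ((h n x)\<^sup>2 / r ^ n)) \<noteq> \<infinity>"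
    by (intro nn_integral_PInf_AE) auto
  then have conv: "AE x in M. convergent (\<lambda>n. f n x)"
  proof eventually_elim
    fix x assume "(\<Sum>n. ennreal ((h n x)\<^sup>2 / r ^ n)) \<noteq> \<infinity>"
    then obtain K where K: "(\<Sum>n. ennreal ((h n x)\<^sup>2 / r ^ n)) = ennreal K" "K \<ge> 0"
      by (cases "(\<Sum>n. ennreal ((h n x)\<^sup>2 / r ^ n))") auto
    have le: "\<bar>h n x\<bar> \<le> sqrt K * (sqrt r) ^ n" for n
    proof -
      have "ennreal ((h n x)\<^sup>2 / r ^ n) \<le> ennreal K"
        using ennreal_suminf_lessD[of "\<lambda>n. ennreal ((h n x)\<^sup>2 / r ^ n)"] 
          sum_le_suminf[of "\<lambda>n. ennreal ((h n x)\<^sup>2 / r ^ n)" "{n}"] K by auto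
      then have "(h n x)\<^sup>2 \<le> K * r ^ n" using r K by (simp add: field_simps)
      then have "\<bar>h n x\<bar> \<le> sqrt (K * r ^ n)" by (metis real_le_rsqrt power2_abs)
      then show ?thesis by (simp add: real_sqrt_mult real_sqrt_power)
    qed
    have "summable (\<lambda>n. h n x)"
      by (rule summable_comparison_test'[where g="\<lambda>n. sqrt K * (sqrt r) ^ n"])
        (use le r in \<open>auto intro!: summable_mult summable_geometric\<close>)
    then have "convergent (\<lambda>n. \<Sum>k<n. h k x)" by (simp add: summable_iff_convergent)
    moreover have "(\<Sum>k<n. h k x) = f n x - f 0 x" for n
      by (induction n) (auto simp: h_def)
    ultimately have "convergent (\<lambda>n. f n x - f 0 x)" by simp
    then show "convergent (\<lambda>n. f n x)"
      using convergent_add[OF _ convergent_const[of "f 0 x"]] by force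
  qed
  define g where "g x = lim (\<lambda>n. f n x)" for x
  have [measurable]: "g \<in> borel_measurable M" unfolding g_def by measurable
  have tele: "l2norm M (\<lambda>x. f (n + k) x - f n x) \<le> c * r ^ n / (1 - r)" for n k
  proof -
    have "l2norm M (\<lambda>x. f (n + k) x - f n x) \<le> (\<Sum>i<k. c * r ^ (n + i))"
    proof (induction k)
      case 0
      then show ?case by (simp add: l2norm_def)
    next
      case (Suc k)
      have "l2norm M (\<lambda>x. f (n + Suc k) x - f n x) = l2norm M (\<lambda>x. (f (n + k) x - f n x) + h (n + k) x)"
        by (simp add: h_def)
      also have "\<dots> \<le> l2norm M (\<lambda>x. f (n + k) x - f n x) + l2norm M (h (n + k))"
        using f hs by (intro l2norm_triangle sqint_diff)
      also have "\<dots> \<le> (\<Sum>i<k. c * r ^ (n + i)) + c * r ^ (n + k)"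
        using Suc d[of "n + k"] by (intro add_mono) (auto simp: h_def[abs_def])
      finally show ?case by simp
    qed
    also have "\<dots> = c * r ^ n * (\<Sum>i<k. r ^ i)" by (simp add: sum_distrib_left power_add mult_ac)
    also have "(\<Sum>i<k. r ^ i) \<le> 1 / (1 - r)"
      using r by (subst sum_gp_strict) (auto simp: field_simps)
    then have "c * r ^ n * (\<Sum>i<k. r ^ i) \<le> c * r ^ n * (1 / (1 - r))"
      using c r by (intro mult_left_mono) auto
    finally show ?thesis by simp
  qed
  \<comment> \<open>Fatou along k, applied to f (n + k) - f n, whose norms obey the telescoped bound
    uniformly in k.\<close>
  have main: "sqint M (\<lambda>x. f n x - g x) \<and> l2norm M (\<lambda>x. f n x - g x) \<le> c * r ^ n / (1 - r)" for n
  proof -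
    have "(\<integral>\<^sup>+x. ennreal ((f n x - g x)\<^sup>2) \<partial>M) = (\<integral>\<^sup>+x. liminf (\<lambda>k. ennreal ((f (n + k) x - f n x)\<^sup>2)) \<partial>M)"
    proof (rule nn_integral_cong_AE, use conv in eventually_elim)
      fix x assume "convergent (\<lambda>n. f n x)"
      then have "(\<lambda>k. f k x) \<longlonglongrightarrow> g x" by (simp add: convergent_LIMSEQ_iff g_def)
      then have "(\<lambda>k. f (n + k) x) \<longlonglongrightarrow> g x"
        using LIMSEQ_ignore_initial_segment[of "\<lambda>k. f k x" "g x" n] by (simp add: add.commute)
      then have "(\<lambda>k. ennreal ((f (n + k) x - f n x)\<^sup>2)) \<longlonglongrightarrow> ennreal ((g x - f n x)\<^sup>2)"
        by (intro tendsto_intros)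
      then show "ennreal ((f n x - g x)\<^sup>2) = liminf (\<lambda>k. ennreal ((f (n + k) x - f n x)\<^sup>2))"
        using lim_imp_Liminf by (metis power2_commute sequentially_bot)
    qed
    also have "\<dots> \<le> liminf (\<lambda>k. \<integral>\<^sup>+x. ennreal ((f (n + k) x - f n x)\<^sup>2) \<partial>M)"
      by (rule nn_integral_liminf) measurable
    also have "\<dots> \<le> liminf (\<lambda>k::nat. ennreal ((c * r ^ n / (1 - r))\<^sup>2))"
    proof (intro Liminf_mono always_eventually allI)
      fix k
      have "(\<integral>\<^sup>+x. ennreal ((f (n + k) x - f n x)\<^sup>2) \<partial>M) = ennreal ((l2norm M (\<lambda>x. f (n + k) x - f n x))\<^sup>2)"
        using f by (intro nn_integral_sqint sqint_diff)
      also have "\<dots> \<le> ennreal ((c * r ^ n / (1 - r))\<^sup>2)"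
        using tele by (intro ennreal_leI power_mono) auto
      finally show "(\<integral>\<^sup>+x. ennreal ((f (n + k) x - f n x)\<^sup>2) \<partial>M) \<le> ennreal ((c * r ^ n / (1 - r))\<^sup>2)" .
    qed
    also have "\<dots> = ennreal ((c * r ^ n / (1 - r))\<^sup>2)" by (simp add: Liminf_const)
    finally have "(\<integral>\<^sup>+x. ennreal ((f n x - g x)\<^sup>2) \<partial>M) \<le> ennreal ((c * r ^ n / (1 - r))\<^sup>2)" .
    moreover have "(\<lambda>x. f n x - g x) \<in> borel_measurable M" by measurable
    moreover have "0 \<le> c * r ^ n / (1 - r)" using c r by simp
    ultimately show ?thesis using sqint_if_nn_integral_le by blast
  qed
  have "sqint M g" using sqint_diff[OF f[of 0] conjunct1[OF main[of 0]]] by simp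
  with main show ?thesis using that by blast
qed

text \<open>Pointwise convergence without loss of norm is convergence in norm. Fatou is applied to
  (f n + g)^2 = 2 (f n)^2 + 2 g^2 - (f n - g)^2: distances bounded below by e would make the lower
  limit of the integrals too small. A single good index suffices for density.\<close>

lemma l2_convergence:
  assumes f: "\<And>n. sqint M (f n)" and g: "sqint M g" and le: "\<And>n::nat. l2norm M (f n) \<le> l2norm M g"
    and conv: "AE x in M. (\<lambda>n. f n x) \<longlonglongrightarrow> g x" and that: "e > 0"
  shows "\<exists>n. l2norm M (\<lambda>x. f n x - g x) < e"
proof (rule ccontr)
  assume "\<not> ?thesis"
  then have ge: "e \<le> l2norm M (\<lambda>x. f n x - g x)" for n by (simp add: not_less)
  have [measurable]: "f n \<in> borel_measurable M" "g \<in> borel_measurable M" for n using f g by auto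
  define h where "h n x = (f n x + g x)\<^sup>2" for n x
  have h_eq: "h n x = 2 * (f n x)\<^sup>2 + 2 * (g x)\<^sup>2 - (f n x - g x)\<^sup>2" for n x
    by (simp add: h_def power2_eq_square algebra_simps)
  have "ennreal (4 * (l2norm M g)\<^sup>2) = (\<integral>\<^sup>+x. ennreal ((2 * g x)\<^sup>2) \<partial>M)"
    using nn_integral_sqint[OF sqint_cmult[OF g, of 2]] by (simp add: l2norm_cmult power_mult_distrib)
  also have "\<dots> = (\<integral>\<^sup>+x. liminf (\<lambda>n. ennreal (h n x)) \<partial>M)"
  proof (rule nn_integral_cong_AE, use conv in eventually_elim)
    fix x assume "(\<lambda>n. f n x) \<longlonglongrightarrow> g x"
    then have "(\<lambda>n. ennreal (h n x)) \<longlonglongrightarrow> ennreal ((g x + g x)\<^sup>2)"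
      unfolding h_def by (intro tendsto_intros)
    then show "ennreal ((2 * g x)\<^sup>2) = liminf (\<lambda>n. ennreal (h n x))"
      using lim_imp_Liminf by (metis mult_2 sequentially_bot)
  qed
  also have "\<dots> \<le> liminf (\<lambda>n. \<integral>\<^sup>+x. ennreal (h n x) \<partial>M)"
    by (rule nn_integral_liminf) (simp add: h_def)
  also have "\<dots> \<le> liminf (\<lambda>n::nat. ennreal (4 * (l2norm M g)\<^sup>2 - e\<^sup>2))"
  proof (intro Liminf_mono always_eventually allI)
    fix n
    have s: "sqint M (\<lambda>x. f n x - g x)" using f g by (rule sqint_diff)
    have "(\<integral>\<^sup>+x. ennreal (h n x) \<partial>M) = ennreal (LINT x|M. h n x)"
      using sqint_add[OF f g] by (intro nn_integral_eq_integral) (auto simp: sqint_def h_def)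
    also have "(LINT x|M. h n x) = 2 * (l2norm M (f n))\<^sup>2 + 2 * (l2norm M g)\<^sup>2 - (l2norm M (\<lambda>x. f n x - g x))\<^sup>2"
      using f[of n] g s by (simp add: h_eq l2norm_power2 sqint_def)
    also have "ennreal \<dots> \<le> ennreal (4 * (l2norm M g)\<^sup>2 - e\<^sup>2)"
      using power_mono[OF le[of n] l2norm_nonneg, of 2] power_mono[OF ge[of n] less_imp_le[OF that], of 2]
      by (intro ennreal_leI) linarith
    finally show "(\<integral>\<^sup>+x. ennreal (h n x) \<partial>M) \<le> ennreal (4 * (l2norm M g)\<^sup>2 - e\<^sup>2)" .
  qed
  also have "\<dots> = ennreal (4 * (l2norm M g)\<^sup>2 - e\<^sup>2)" by (simp add: Liminf_const)
  \<comment> \<open>The maximum reflects truncation at 0 in the extended nonnegative reals. The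
    truncated case would force g to have norm 0, but e \<le> 2 ||g|| forbids this.\<close>
  finally have "4 * (l2norm M g)\<^sup>2 \<le> max 0 (4 * (l2norm M g)\<^sup>2 - e\<^sup>2)"
    by (auto simp: ennreal_le_iff2 max_def)
  moreover have "e \<le> 2 * l2norm M g"
    using ge[of 0] l2norm_triangle_diff[OF f g, of 0] le[of 0] by simp
  then have "l2norm M g > 0" using that by linarith
  ultimately show False using that by (auto simp: max_def split: if_splits)
qed

section \<open>Weighted spaces and primitives of distributions\<close>

lemma exp_integral_halfline:
  fixes c :: real
  assumes "c > 0"
  shows "integrable lborel (\<lambda>y. indicator {0<..} y * exp (- c * y))"
    "(LINT y|lborel. indicator {0<..} y * exp (- c * y)) = 1 / c"
proof -
  have "filterlim (\<lambda>y. c * y) at_top at_top"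
    using assms by (intro filterlim_tendsto_pos_mult_at_top[OF tendsto_const _ filterlim_ident])
  then have "((\<lambda>y. exp (- (c * y))) \<longlongrightarrow> 0) at_top"
    by (intro filterlim_compose[OF exp_at_bot] filterlim_compose[OF filterlim_uminus_at_bot_at_top])
  then have lim: "((\<lambda>y. - (1 / c) * exp (- (c * y))) \<longlongrightarrow> 0) at_top"
    by (rule tendsto_mult_right_zero)
  have "(\<integral>\<^sup>+y. ennreal (exp (- (c * y))) * indicator {0..} y \<partial>lborel) =
      ennreal (0 - (- (1 / c) * exp (- (c * 0))))"
    by (rule nn_integral_FTC_atLeast[OF _ _ _ lim])
      (use assms in \<open>auto intro!: derivative_eq_intros\<close>)
  also have "(\<integral>\<^sup>+y. ennreal (exp (- (c * y))) * indicator {0..} y \<partial>lborel) =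
      (\<integral>\<^sup>+y. ennreal (exp (- c * y) * indicator {0..} y) \<partial>lborel)"
    by (intro nn_integral_cong) (auto simp: indicator_def)
  finally have "has_bochner_integral lborel (\<lambda>y. exp (- c * y) * indicator {0..} y) (1 / c)"
    using assms by (intro has_bochner_integral_nn_integral) auto
  moreover have "AE y in lborel. exp (- c * y) * indicator {0..} y = indicator {0<..} y * exp (- c * y)"
    using AE_lborel_singleton[of 0] by eventually_elim (auto simp: indicator_def)
  ultimately have "has_bochner_integral lborel (\<lambda>y. indicator {0<..} y * exp (- c * y)) (1 / c)"
    using has_bochner_integral_cong_AE[of "\<lambda>y. exp (- c * y) * indicator {0..} y" lborel
        "\<lambda>y. indicator {0<..} y * exp (- c * y)"] by simp
  then show "integrable lborel (\<lambda>y. indicator {0<..} y * exp (- c * y))"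
    "(LINT y|lborel. indicator {0<..} y * exp (- c * y)) = 1 / c"
    by (auto simp: has_bochner_integral_iff)
qed

text \<open>Weight and half-line are both put into the measure, so the weighted norm is a plain L2
  norm and values at y \<le> 0 do not count.\<close>

definition wmeas :: "real \<Rightarrow> real measure" where
  "wmeas \<mu> = density lborel (\<lambda>y. ennreal (indicator {0<..} y * exp (\<mu> * y)))"

lemma sets_wmeas [simp, measurable_cong]: "sets (wmeas \<mu>) = sets borel"
  by (simp add: wmeas_def)

lemma space_wmeas [simp]: "space (wmeas \<mu>) = UNIV"
  by (simp add: wmeas_def)

lemma borel_measurable_wmeas [simp]: "borel_measurable (wmeas \<mu>) = borel_measurable borel"
  by (rule measurable_cong_sets) auto

lemma integrable_wmeas_iff:
  assumes "f \<in> borel_measurable borel"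
  shows "integrable (wmeas \<mu>) f \<longleftrightarrow> integrable lborel (\<lambda>y. indicator {0<..} y * exp (\<mu> * y) * f y :: real)"
  unfolding wmeas_def using assms by (subst integrable_density) auto

lemma integral_wmeas:
  assumes "f \<in> borel_measurable borel"
  shows "(LINT y|wmeas \<mu>. f y) = (LINT y|lborel. indicator {0<..} y * exp (\<mu> * y) * f y :: real)"
  unfolding wmeas_def using assms by (subst integral_density) auto

lemma AE_wmeas_iff: "(AE y in wmeas \<mu>. P y) \<longleftrightarrow> (AE y in lborel. 0 < y \<longrightarrow> P y)"
  unfolding wmeas_def by (subst AE_density) (auto simp: indicator_def)

lemma sqint_wmeas_iff:
  assumes "f \<in> borel_measurable borel" 
  shows "sqint (wmeas \<mu>) f \<longleftrightarrow> integrable lborel (\<lambda>y. indicator {0<..} y * exp (\<mu> * y) * (f y)\<^sup>2)"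
  using assms by (simp add: sqint_def integrable_wmeas_iff)

lemma l2norm_wmeas:
  assumes "f \<in> borel_measurable borel" 
  shows "l2norm (wmeas \<mu>) f = sqrt (LINT y|lborel. indicator {0<..} y * exp (\<mu> * y) * (f y)\<^sup>2)"
  using assms by (simp add: l2norm_def integral_wmeas)

lemma sqint_exp:
  assumes "\<mu> < 2 * b"
  shows "sqint (wmeas \<mu>) (\<lambda>y. exp (- b * y))" "l2norm (wmeas \<mu>) (\<lambda>y. exp (- b * y)) = 1 / sqrt (2 * b - \<mu>)"
proof -
  have *: "indicator {0<..} y * exp (\<mu> * y) * (exp (- b * y))\<^sup>2 = indicator {0<..} y * exp (- (2 * b - \<mu>) * y)"
    for y :: real
    by (simp add: power2_eq_square algebra_simps flip: exp_add)
  show "sqint (wmeas \<mu>) (\<lambda>y. exp (- b * y))"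
    using exp_integral_halfline[of "2 * b - \<mu>"] assms by (subst sqint_wmeas_iff) (auto simp only: *, auto)
  show "l2norm (wmeas \<mu>) (\<lambda>y. exp (- b * y)) = 1 / sqrt (2 * b - \<mu>)"
    using exp_integral_halfline[of "2 * b - \<mu>"] assms
    by (subst l2norm_wmeas) (auto simp only: *, auto simp: real_sqrt_divide)
qed

text \<open>Cauchy-Schwarz after writing f v = f (v exp(-\<mu> y)) exp(\<mu> y): unweighted pairings
  are continuous functionals on the weighted space.\<close>

lemma wmeas_pairing:
  fixes f v :: "real \<Rightarrow> real"
  assumes f: "sqint (wmeas \<mu>) f" "\<And>y. y \<le> 0 \<Longrightarrow> f y = 0"
    and v: "v \<in> borel_measurable borel" "sqint (wmeas \<mu>) (\<lambda>y. v y * exp (- \<mu> * y))"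
  shows "integrable lborel (\<lambda>y. f y * v y)"
    "\<bar>LINT y|lborel. f y * v y\<bar> \<le> l2norm (wmeas \<mu>) f * l2norm (wmeas \<mu>) (\<lambda>y. v y * exp (- \<mu> * y))"
proof -
  have [measurable]: "f \<in> borel_measurable borel" "v \<in> borel_measurable borel"
    using f(1) v(1) by (auto dest: sqintD)
  have *: "indicator {0<..} y * exp (\<mu> * y) * (f y * (v y * exp (- \<mu> * y))) = f y * v y" for y
    using f(2)[of y] by (cases "y > 0") (auto simp: exp_minus field_simps)
  show "integrable lborel (\<lambda>y. f y * v y)"
    using integrable_sqint_mult[OF f(1) v(2)] by (subst (asm) integrable_wmeas_iff) (auto simp only: *, measurable)
  have "(LINT y|lborel. f y * v y) = (LINT y|wmeas \<mu>. f y * (v y * exp (- \<mu> * y)))"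
    by (subst integral_wmeas) (auto simp only: *, measurable)
  then show "\<bar>LINT y|lborel. f y * v y\<bar> \<le> l2norm (wmeas \<mu>) f * l2norm (wmeas \<mu>) (\<lambda>y. v y * exp (- \<mu> * y))"
    using Cauchy_Schwarz_integral[OF f(1) v(2)] by simp
qed

text \<open>One estimate with three uses: s > 0 gives Laplace transforms, s = 0 the integral itself,
  and negative s above -\<mu>/2 exponential moments.\<close>

lemma exp_pairing:
  fixes f :: "real \<Rightarrow> real"
  assumes f: "sqint (wmeas \<mu>) f" "\<And>y. y \<le> 0 \<Longrightarrow> f y = 0" and \<mu>: "- 2 * s < \<mu>"
  shows "integrable lborel (\<lambda>y. f y * exp (- s * y))"
    "\<bar>LINT y|lborel. f y * exp (- s * y)\<bar> \<le> l2norm (wmeas \<mu>) f / sqrt (2 * s + \<mu>)"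
proof -
  have *: "exp (- s * y) * exp (- \<mu> * y) = exp (- (s + \<mu>) * y)" for y
    by (simp add: algebra_simps flip: exp_add)
  have "sqint (wmeas \<mu>) (\<lambda>y. exp (- s * y) * exp (- \<mu> * y))"
    "l2norm (wmeas \<mu>) (\<lambda>y. exp (- s * y) * exp (- \<mu> * y)) = 1 / sqrt (2 * s + \<mu>)"
    unfolding * using sqint_exp[of \<mu> "s + \<mu>"] \<mu> by auto
  with wmeas_pairing[OF f, of "\<lambda>y. exp (- s * y)"]
  show "integrable lborel (\<lambda>y. f y * exp (- s * y))"
    "\<bar>LINT y|lborel. f y * exp (- s * y)\<bar> \<le> l2norm (wmeas \<mu>) f / sqrt (2 * s + \<mu>)" by auto
qed

text \<open>The exponential moment with exponent \<mu>/4 is finite and dominates y and y^2. The 8 is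
  chosen so that squaring y \<le> 8/\<mu> exp(\<mu> y / 8) costs exactly exp(\<mu> y / 4).\<close>

lemma moment_integrable:
  fixes f :: "real \<Rightarrow> real"
  assumes f: "sqint (wmeas \<mu>) f" "\<And>y. y \<le> 0 \<Longrightarrow> f y = 0" and \<mu>: "0 < \<mu>"
  shows "integrable lborel f" "integrable lborel (\<lambda>y. f y * y)" "integrable lborel (\<lambda>y. f y * y\<^sup>2)"
proof -
  have [measurable]: "f \<in> borel_measurable borel" using f(1) by (auto dest: sqintD)
  have e: "integrable lborel (\<lambda>y. f y * exp (- (- \<mu> / 4) * y))"
    using exp_pairing(1)[OF f, of "- \<mu> / 4"] \<mu> by simp
  show "integrable lborel f" using exp_pairing(1)[OF f, of 0] \<mu> by simp
  have y: "y \<le> 8 / \<mu> * exp (\<mu> / 8 * y)" for y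
    using exp_ge_add_one_self[of "\<mu> / 8 * y"] \<mu> by (simp add: field_simps)
  have b1: "\<bar>f y * y\<bar> \<le> \<bar>8 / \<mu> * (f y * exp (- (- \<mu> / 4) * y))\<bar>" for y
  proof (cases "y \<le> 0")
    case False
    have "y \<le> 8 / \<mu> * exp (\<mu> / 8 * y)" by (rule y)
    also have "\<dots> \<le> 8 / \<mu> * exp (\<mu> / 4 * y)" using False \<mu> by (intro mult_left_mono) auto
    finally have "\<bar>f y\<bar> * y \<le> \<bar>f y\<bar> * (8 / \<mu> * exp (\<mu> / 4 * y))" by (intro mult_left_mono) auto
    then show ?thesis using False \<mu> by (simp add: abs_mult mult_ac)
  qed (use f(2) in auto)
  have b2: "\<bar>f y * y\<^sup>2\<bar> \<le> \<bar>(8 / \<mu>)\<^sup>2 * (f y * exp (- (- \<mu> / 4) * y))\<bar>" for y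
  proof (cases "y \<le> 0")
    case False
    have "y\<^sup>2 \<le> (8 / \<mu> * exp (\<mu> / 8 * y))\<^sup>2" using y[of y] False by (intro power_mono) auto
    also have "\<dots> = (8 / \<mu>)\<^sup>2 * exp (\<mu> / 4 * y)"
      by (simp add: power2_eq_square mult_ac flip: exp_add)
    finally have "\<bar>f y\<bar> * y\<^sup>2 \<le> \<bar>f y\<bar> * ((8 / \<mu>)\<^sup>2 * exp (\<mu> / 4 * y))" by (intro mult_left_mono) auto
    then show ?thesis using False \<mu> by (simp add: abs_mult mult_ac)
  qed (use f(2) in auto)
  show "integrable lborel (\<lambda>y. f y * y)"
    by (rule Bochner_Integration.integrable_bound[OF integrable_mult_right[OF e, of "8 / \<mu>"]])
      (use b1 in auto)
  show "integrable lborel (\<lambda>y. f y * y\<^sup>2)"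
    by (rule Bochner_Integration.integrable_bound[OF integrable_mult_right[OF e, of "(8 / \<mu>)\<^sup>2"]])
      (use b2 in auto)
qed

section \<open>Primitives of distributions\<close>

text \<open>Encodes u = - H' by pairing \<open>H\<close> with the derivative of the test function.
  Extending \<open>H\<close> by 0 lets every pairing, convolution and transform be an integral over
  the whole line.\<close>

definition is_primitive :: "(real \<Rightarrow> real) \<Rightarrow> distribution \<Rightarrow> bool" where
  "is_primitive H u \<longleftrightarrow> integrable lborel H \<and> (\<forall>y\<le>0. H y = 0) \<and>
     u = (\<lambda>\<phi>. if \<phi> \<in> test_functions then LINT y|lborel. H y * deriv \<phi> y else 0)"

lemma integrable_mult_bounded:
  fixes f g :: "real \<Rightarrow> real"
  assumes "integrable lborel f" "g \<in> borel_measurable borel" "\<And>x. \<bar>g x\<bar> \<le> B"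
  shows "integrable lborel (\<lambda>x. f x * g x)"
proof (rule Bochner_Integration.integrable_bound[OF integrable_mult_right[OF assms(1), of B]])
  show "(\<lambda>x. f x * g x) \<in> borel_measurable lborel"
    using assms by (auto dest: borel_measurable_integrable)
  have "\<bar>f x\<bar> * \<bar>g x\<bar> \<le> \<bar>B\<bar> * \<bar>f x\<bar>" for x
    using assms(3)[of x] mult_left_mono[of "\<bar>g x\<bar>" "\<bar>B\<bar>" "\<bar>f x\<bar>"] by (simp add: mult.commute)
  then show "AE x in lborel. norm (f x * g x) \<le> norm (B * f x)" by (simp add: abs_mult)
qed

lemma test_functions_measurable: "\<phi> \<in> test_functions \<Longrightarrow> \<phi> \<in> borel_measurable borel"
  using test_functions_continuous by (intro borel_measurable_continuous_onI)

lemma integrable_mult_test: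
  assumes "integrable lborel f" "\<phi> \<in> test_functions"
  shows "integrable lborel (\<lambda>x. f x * \<phi> x)"
  using test_functions_bounded[OF assms(2)] integrable_mult_bounded[OF assms(1)]
    test_functions_measurable[OF assms(2)] by metis

text \<open>Two primitives differ by a function annihilated by all derivatives of test functions;
  the fundamental lemma applies to the difference.\<close>

lemma is_primitive_unique:
  assumes "is_primitive G u" "is_primitive H u"
  shows "AE y in lborel. G y = H y"
proof -
  have i: "integrable lborel G" "integrable lborel H" using assms by (auto simp: is_primitive_def)
  have "AE y in lborel. G y - H y = 0"
  proof (rule du_Bois_Reymond)
    fix \<phi> assume \<phi>: "\<phi> \<in> test_functions"
    have "(LINT y|lborel. G y * deriv \<phi> y) = (LINT y|lborel. H y * deriv \<phi> y)"
      using assms \<phi> unfolding is_primitive_def by metis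
    then show "(LINT y|lborel. (G y - H y) * deriv \<phi> y) = 0"
      using i[THEN integrable_mult_test, OF test_functions_deriv[OF \<phi>]] by (simp add: left_diff_distrib)
  qed (use assms in \<open>auto simp: is_primitive_def\<close>)
  then show ?thesis by simp
qed

lemma is_primitive_lincomb:
  assumes "is_primitive G u" "is_primitive H v"
  shows "is_primitive (\<lambda>y. a * G y + b * H y) (\<lambda>\<phi>. a * u \<phi> + b * v \<phi>)"
proof -
  have i: "integrable lborel G" "integrable lborel H" using assms by (auto simp: is_primitive_def)
  have "(LINT y|lborel. (a * G y + b * H y) * deriv \<phi> y) =
      a * (LINT y|lborel. G y * deriv \<phi> y) + b * (LINT y|lborel. H y * deriv \<phi> y)"
    if \<phi>: "\<phi> \<in> test_functions" for \<phi>
    using i[THEN integrable_mult_test, OF test_functions_deriv[OF \<phi>]] by (simp add: distrib_right mult.assoc)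
  then show ?thesis using assms by (auto simp: is_primitive_def)
qed

lemma set_LINT_halfline: "(LINT y:{0<..}|lborel. f y) = (LINT y|lborel. indicator {0<..} y * f y :: real)"
  by (simp add: set_lebesgue_integral_def)

lemma L2_exp_sqint:
  assumes "H \<in> L2_exp \<mu>" "\<mu> > 0"
  shows "sqint (wmeas \<mu>) (\<lambda>y. indicator {0<..} y * H y)"
    "integrable lborel (\<lambda>y. indicator {0<..} y * H y)"
proof -
  have m: "(\<lambda>y. indicator {0<..} y * H y) \<in> borel_measurable borel"
    using assms by (simp add: L2_exp_def set_borel_measurable_def)
  have *: "indicator {0<..} y * exp (\<mu> * y) * (indicator {0<..} y * H y)\<^sup>2 =
      indicator {0<..} y *\<^sub>R ((H y)\<^sup>2 * exp (\<mu> * y))" for y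
    by (auto simp: indicator_def)
  show s: "sqint (wmeas \<mu>) (\<lambda>y. indicator {0<..} y * H y)"
    using assms m unfolding sqint_wmeas_iff[OF m] * by (simp add: L2_exp_def set_integrable_def)
  show "integrable lborel (\<lambda>y. indicator {0<..} y * H y)"
    by (rule moment_integrable(1)[OF s _ assms(2)]) auto
qed

lemma sqint_L2_exp:
  assumes "sqint (wmeas \<mu>) H"
  shows "H \<in> L2_exp \<mu>"
proof -
  have m[measurable]: "H \<in> borel_measurable borel" using assms by (auto dest: sqintD)
  have *: "indicator {0<..} y * exp (\<mu> * y) * (H y)\<^sup>2 =
      indicator {0<..} y *\<^sub>R ((H y)\<^sup>2 * exp (\<mu> * y))" for y
    by (auto simp: indicator_def)
  then show ?thesis using assms unfolding sqint_wmeas_iff[OF m] *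
    by (simp add: L2_exp_def set_integrable_def set_borel_measurable_def)
qed

lemma is_primitive_distr:
  assumes "H \<in> L2_exp \<mu>" "\<mu> > 0"
  shows "is_primitive (\<lambda>y. indicator {0<..} y * H y) (\<lambda>\<phi>. - distr_deriv (distr_of H) \<phi>)"
  using L2_exp_sqint[OF assms] test_functions_deriv
  by (auto simp: is_primitive_def distr_deriv_def distr_of_def set_LINT_halfline mult.assoc)

lemma X_minus1_primitive:
  assumes "u \<in> X_minus1 \<mu>" "\<mu> > 0"
  obtains H where "is_primitive H u" "sqint (wmeas \<mu>) H" "(LINT y|lborel. H y) = 0"
proof -
  obtain G where G: "u = distr_deriv (distr_of G)" "G \<in> L2_exp \<mu>" "(LINT y:{0<..}|lborel. G y) = 0"
    using assms by (auto simp: X_minus1_def)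
  \<comment> \<open>The sign changes because the space is defined by u = G', whereas a primitive
    satisfies u = - H'.\<close>
  define H where "H y = - (indicator {0<..} y * G y)" for y
  have "is_primitive H u"
    using is_primitive_lincomb[OF is_primitive_distr[OF G(2) assms(2)] is_primitive_distr[OF G(2) assms(2)], of "-1" 0]
    unfolding H_def[abs_def] G(1) by simp
  moreover have "sqint (wmeas \<mu>) H"
    using sqint_cmult[OF L2_exp_sqint(1)[OF G(2) assms(2)], of "-1"] by (simp add: H_def[abs_def])
  moreover have "(LINT y|lborel. H y) = 0"
    using G(3) by (simp add: H_def set_LINT_halfline)
  ultimately show ?thesis by (rule that)
qed

text \<open>Removes the arbitrary choice in the norm: the chosen function, cut off to the half-line,
  and \<open>H\<close> are both primitives of \<open>u\<close>, hence equal almost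
  everywhere.\<close>

lemma norm_minus1_primitive:
  assumes "is_primitive H u" "sqint (wmeas \<mu>) H" "\<mu> > 0"
  shows "norm_minus1 \<mu> u = l2norm (wmeas \<mu>) H"
proof -
  have H0: "indicator {0<..} y * H y = H y" for y
    using assms(1) by (cases "0 < y") (auto simp: is_primitive_def)
  have "u = (\<lambda>\<phi>. - distr_deriv (distr_of H) \<phi>)"
    using is_primitive_distr[OF sqint_L2_exp[OF assms(2)] assms(3)] assms(1)
    unfolding H0 is_primitive_def by simp
  then have "primitive \<mu> u \<in> L2_exp \<mu> \<and> u = (\<lambda>\<phi>. - distr_deriv (distr_of (primitive \<mu> u)) \<phi>)"
    unfolding primitive_def
    by (intro someI[where P="\<lambda>H. H \<in> L2_exp \<mu> \<and> u = (\<lambda>\<phi>. - distr_deriv (distr_of H) \<phi>)"])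
      (use sqint_L2_exp[OF assms(2)] in auto)
  then have p: "primitive \<mu> u \<in> L2_exp \<mu>" and e: "u = (\<lambda>\<phi>. - distr_deriv (distr_of (primitive \<mu> u)) \<phi>)"
    by auto
  let ?P = "\<lambda>y. indicator {0<..} y * primitive \<mu> u y"
  have s: "sqint (wmeas \<mu>) ?P" using L2_exp_sqint(1)[OF p assms(3)] .
  have "is_primitive ?P u" using is_primitive_distr[OF p assms(3)] e by simp
  then have "AE y in lborel. ?P y = H y" using assms(1) by (rule is_primitive_unique)
  then have "AE y in wmeas \<mu>. ?P y = H y" unfolding AE_wmeas_iff by eventually_elim auto
  then have "l2norm (wmeas \<mu>) ?P = l2norm (wmeas \<mu>) H"
    using s assms(2) by (intro l2norm_cong_AE) (auto dest: sqintD)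
  moreover have "l2norm (wmeas \<mu>) ?P = norm_minus1 \<mu> u"
  proof -
    have m: "?P \<in> borel_measurable borel" using s by (auto dest: sqintD)
    have *: "indicator {0<..} y * exp (\<mu> * y) * (?P y)\<^sup>2 =
        indicator {0<..} y * ((primitive \<mu> u y)\<^sup>2 * exp (\<mu> * y))" for y
      by (auto simp: indicator_def)
    show ?thesis unfolding l2norm_wmeas[OF m] *
      by (simp add: norm_minus1_def set_LINT_halfline)
  qed
  ultimately show ?thesis by simp
qed

lemma X_minus1I:
  assumes "is_primitive H u" "sqint (wmeas \<mu>) H" "(LINT y|lborel. H y) = 0" "\<mu> > 0"
  shows "u \<in> X_minus1 \<mu>"
proof -
  have H0: "indicator {0<..} y * H y = H y" for y
    using assms(1) by (cases "0 < y") (auto simp: is_primitive_def)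
  let ?G = "\<lambda>y. - H y"
  have G: "sqint (wmeas \<mu>) ?G" using sqint_cmult[OF assms(2), of "-1"] by simp
  have "u = distr_deriv (distr_of ?G)"
    using is_primitive_distr[OF sqint_L2_exp[OF G] assms(4)] assms(1)
    unfolding is_primitive_def
    by (auto simp: fun_eq_iff H0 distr_deriv_def distr_of_def set_LINT_halfline mult.assoc[symmetric]
        test_functions_deriv)
  moreover have "(LINT y:{0<..}|lborel. ?G y) = 0"
    unfolding set_LINT_halfline using assms(3) by (simp add: H0)
  ultimately show ?thesis using sqint_L2_exp[OF G] by (auto simp: X_minus1_def)
qed

section \<open>Strongly continuous semigroups on complete function spaces\<close>

text \<open>Completeness is asked along increments (1/3)^n, the step sizes of the gliding hump
  below; 3/2 (1/3)^n is the corresponding geometric tail.\<close>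

locale complete_function_space =
  fixes X :: "('a \<Rightarrow> real) set" and N :: "('a \<Rightarrow> real) \<Rightarrow> real"
  assumes zero_mem: "(\<lambda>x. 0) \<in> X"
    and lincomb_mem: "\<And>u v a b. u \<in> X \<Longrightarrow> v \<in> X \<Longrightarrow> (\<lambda>x. a * u x + b * v x) \<in> X"
    and N_nonneg: "\<And>u. u \<in> X \<Longrightarrow> 0 \<le> N u"
    and N_lincomb: "\<And>u v a b. u \<in> X \<Longrightarrow> v \<in> X \<Longrightarrow>
      N (\<lambda>x. a * u x + b * v x) \<le> \<bar>a\<bar> * N u + \<bar>b\<bar> * N v"
    and complete: "\<And>f. (\<And>n. f n \<in> X) \<Longrightarrow>
      (\<And>n. N (\<lambda>x. f (Suc n) x - f n x) \<le> (1 / 3) ^ n) \<Longrightarrow>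
      \<exists>g\<in>X. \<forall>n. N (\<lambda>x. f n x - g x) \<le> 3 / 2 * (1 / 3) ^ n"
begin

lemma cmult_mem: "u \<in> X \<Longrightarrow> (\<lambda>x. a * u x) \<in> X"
  using lincomb_mem[of u u a 0] by simp

lemma add_mem: "u \<in> X \<Longrightarrow> v \<in> X \<Longrightarrow> (\<lambda>x. u x + v x) \<in> X"
  using lincomb_mem[of u v 1 1] by simp

lemma diff_mem: "u \<in> X \<Longrightarrow> v \<in> X \<Longrightarrow> (\<lambda>x. u x - v x) \<in> X"
  using lincomb_mem[of u v 1 "-1"] by simp

lemma N_cmult: "u \<in> X \<Longrightarrow> N (\<lambda>x. a * u x) \<le> \<bar>a\<bar> * N u"
  using N_lincomb[of u u a 0] by simp

lemma N_add: "u \<in> X \<Longrightarrow> v \<in> X \<Longrightarrow> N (\<lambda>x. u x + v x) \<le> N u + N v"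
  using N_lincomb[of u v 1 1] by simp

lemma N_diff: "u \<in> X \<Longrightarrow> v \<in> X \<Longrightarrow> N (\<lambda>x. u x - v x) \<le> N u + N v"
  using N_lincomb[of u v 1 "-1"] by simp

lemma N_zero: "N (\<lambda>x. 0) = 0"
  using N_cmult[OF zero_mem, of 0] N_nonneg[OF zero_mem] by simp

definition bounded_op :: "(('a \<Rightarrow> real) \<Rightarrow> ('a \<Rightarrow> real)) \<Rightarrow> bool" where
  "bounded_op B \<longleftrightarrow> (\<forall>u\<in>X. B u \<in> X) \<and>
     (\<forall>u\<in>X. \<forall>v\<in>X. \<forall>a b. B (\<lambda>x. a * u x + b * v x) = (\<lambda>x. a * B u x + b * B v x)) \<and>
     (\<exists>C. \<forall>u\<in>X. N (B u) \<le> C * N u)"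

lemma bounded_op_mem: "bounded_op B \<Longrightarrow> u \<in> X \<Longrightarrow> B u \<in> X"
  by (auto simp: bounded_op_def)

lemma bounded_op_lincomb:
  "bounded_op B \<Longrightarrow> u \<in> X \<Longrightarrow> v \<in> X \<Longrightarrow> B (\<lambda>x. a * u x + b * v x) = (\<lambda>x. a * B u x + b * B v x)"
  by (auto simp: bounded_op_def)

lemma bounded_op_cmult: "bounded_op B \<Longrightarrow> u \<in> X \<Longrightarrow> B (\<lambda>x. a * u x) = (\<lambda>x. a * B u x)"
  using bounded_op_lincomb[of B u u a 0] by simp

lemma bounded_op_add: "bounded_op B \<Longrightarrow> u \<in> X \<Longrightarrow> v \<in> X \<Longrightarrow> B (\<lambda>x. u x + v x) = (\<lambda>x. B u x + B v x)"
  using bounded_op_lincomb[of B u v 1 1] by simp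

lemma bounded_op_diff: "bounded_op B \<Longrightarrow> u \<in> X \<Longrightarrow> v \<in> X \<Longrightarrow> B (\<lambda>x. u x - v x) = (\<lambda>x. B u x - B v x)"
  using bounded_op_lincomb[of B u v 1 "-1"] by simp

text \<open>\<open>L\<close> is the supremum over the unit ball, which need not be attained. The
  factor 3/4 only has to lie strictly between 1/2 and 1: the humps that follow cost up to one half
  of \<open>L\<close>.\<close>

lemma operator_norm:
  assumes B: "bounded_op B"
  obtains L where "L \<ge> 0" "\<And>w. w \<in> X \<Longrightarrow> N (B w) \<le> L * N w"
    "\<exists>u\<in>X. N u \<le> 1 \<and> 3 / 4 * L \<le> N (B u)"
proof -
  obtain C where C: "\<And>u. u \<in> X \<Longrightarrow> N (B u) \<le> C * N u"
    using B unfolding bounded_op_def by blast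
  let ?A = "(\<lambda>u. N (B u)) ` {u \<in> X. N u \<le> 1}"
  define L where "L = Sup ?A"
  have z: "B (\<lambda>x. 0) = (\<lambda>x. 0)" using bounded_op_cmult[OF B zero_mem, of 0] by simp
  have ne: "0 \<in> ?A" using z zero_mem N_zero by (auto simp: image_iff intro!: bexI[of _ "\<lambda>x. 0"])
  have bdd: "bdd_above ?A"
  proof (rule bdd_aboveI2)
    fix u assume "u \<in> {u \<in> X. N u \<le> 1}"
    then have u: "u \<in> X" "N u \<le> 1" by auto
    have "C * N u \<le> \<bar>C\<bar> * 1" using u N_nonneg[OF u(1)] by (intro mult_mono) auto
    then show "N (B u) \<le> \<bar>C\<bar>" using C[OF u(1)] by linarith
  qed
  have L0: "L \<ge> 0" unfolding L_def by (rule cSup_upper[OF ne bdd])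
  have up: "N (B w) \<le> L * N w" if w: "w \<in> X" for w
  proof (cases "N w = 0")
    case True
    then show ?thesis using C[OF w] by simp
  next
    case False
    then have pos: "N w > 0" using N_nonneg[OF w] by simp
    let ?w = "\<lambda>x. (1 / N w) * w x"
    have mem: "?w \<in> X" using w by (rule cmult_mem)
    have "N ?w \<le> 1" using N_cmult[OF w, of "1 / N w"] pos by simp
    then have le: "N (B ?w) \<le> L" unfolding L_def using mem by (intro cSup_upper bdd) auto
    have "N (B w) = N (\<lambda>x. N w * B ?w x)"
      using bounded_op_cmult[OF B mem, of "N w"] pos by simp
    also have "\<dots> \<le> N w * N (B ?w)" using N_cmult[OF bounded_op_mem[OF B mem], of "N w"] pos by simp
    also have "\<dots> \<le> N w * L" using le pos by simp
    finally show ?thesis by (simp add: mult.commute)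
  qed
  have "\<exists>u\<in>X. N u \<le> 1 \<and> 3 / 4 * L \<le> N (B u)"
  proof (cases "L = 0")
    case True
    then show ?thesis using zero_mem z N_zero by (intro bexI[of _ "\<lambda>x. 0"]) auto
  next
    case False
    then have "3 / 4 * L < Sup ?A" using L0 by (simp add: L_def)
    then obtain y where "y \<in> ?A" "3 / 4 * L < y" using less_cSup_iff[OF _ bdd] ne by blast
    then show ?thesis by (auto intro: less_imp_le)
  qed
  with L0 up show ?thesis by (rule that)
qed

text \<open>Sokal's gliding hump: from \<open>x\<close> and a nearly maximising \<open>v\<close>, one of \<open>x + v\<close>, \<open>x - v\<close> has
  image at least as large as that of \<open>v\<close>.\<close>

lemma gliding_hump:
  assumes B: "\<And>n. bounded_op (B n)" and big: "\<And>n. \<not> (\<forall>u\<in>X. N (B n u) \<le> 4 ^ n * N u)"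
  obtains x where "x \<in> X" "\<And>n. (4 / 3) ^ n / 4 \<le> N (B n x)"
proof -
  have "\<exists>L u. L \<ge> 4 ^ n \<and> (\<forall>w\<in>X. N (B n w) \<le> L * N w) \<and> u \<in> X \<and> N u \<le> 1 \<and> 3 / 4 * L \<le> N (B n u)" for n
  proof -
    obtain L where L: "L \<ge> 0" "\<And>w. w \<in> X \<Longrightarrow> N (B n w) \<le> L * N w"
      "\<exists>u\<in>X. N u \<le> 1 \<and> 3 / 4 * L \<le> N (B n u)" using operator_norm[OF B] by blast
    have "L \<ge> 4 ^ n"
    proof (rule ccontr)
      assume "\<not> L \<ge> 4 ^ n"
      then have "N (B n w) \<le> 4 ^ n * N w" if "w \<in> X" for w
        using L(2)[OF that] mult_right_mono[of L "4 ^ n" "N w"] N_nonneg[OF that] by linarith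
      with big show False by blast
    qed
    with L show ?thesis by blast
  qed
  then obtain L u where L: "\<And>n. L n \<ge> 4 ^ n" "\<And>n w. w \<in> X \<Longrightarrow> N (B n w) \<le> L n * N w"
    and u: "\<And>n. u n \<in> X" "\<And>n. N (u n) \<le> 1" "\<And>n. 3 / 4 * L n \<le> N (B n (u n))" by metis
  define v where "v n = (\<lambda>x. (1 / 3) ^ n * u n x)" for n
  have v: "v n \<in> X" for n unfolding v_def using u by (intro cmult_mem)
  have Nv: "N (v n) \<le> (1 / 3) ^ n" for n
  proof -
    have "N (v n) \<le> (1 / 3) ^ n * N (u n)" using N_cmult[OF u(1), of "(1 / 3) ^ n" n] by (simp add: v_def)
    also have "\<dots> \<le> (1 / 3) ^ n * 1" using u(2) by (intro mult_left_mono) auto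
    finally show ?thesis by simp
  qed
  have NBv: "3 / 4 * L n * (1 / 3) ^ n \<le> N (B n (v n))" for n
  proof -
    have "B n (u n) = (\<lambda>x. 3 ^ n * B n (v n) x)"
      using bounded_op_cmult[OF B[of n] v[of n], of "3 ^ n"] by (simp add: v_def power_divide)
    then have "N (B n (u n)) \<le> 3 ^ n * N (B n (v n))"
      using N_cmult[OF bounded_op_mem[OF B v], of "3 ^ n" n n] by simp
    with u(3)[of n] have "3 / 4 * L n \<le> 3 ^ n * N (B n (v n))" by linarith
    then show ?thesis by (simp add: field_simps)
  qed
  have choice: "\<exists>s\<in>{1, -1}. N (B n (v n)) \<le> N (B n (\<lambda>z. x z + s * v n z))" if x: "x \<in> X" for n x
  proof (rule ccontr)
    assume "\<not> ?thesis"
    then have a: "N (B n (\<lambda>z. x z + v n z)) < N (B n (v n))" "N (B n (\<lambda>z. x z - v n z)) < N (B n (v n))"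
      by auto
    let ?p = "B n (\<lambda>z. x z + v n z)" and ?m = "B n (\<lambda>z. x z - v n z)"
    have mem: "?p \<in> X" "?m \<in> X" using B v x by (auto intro: bounded_op_mem add_mem diff_mem)
    have "B n (v n) = (\<lambda>z. 1 / 2 * ?p z + (- 1 / 2) * ?m z)"
      using bounded_op_add[OF B x v] bounded_op_diff[OF B x v] by (simp add: field_simps)
    then have "N (B n (v n)) \<le> 1 / 2 * N ?p + 1 / 2 * N ?m"
      using N_lincomb[OF mem, of "1 / 2" "- 1 / 2"] by simp
    with a show False by simp
  qed
  define sgn_at where "sgn_at n x = (SOME s. s \<in> {1, -1} \<and> N (B n (v n)) \<le> N (B n (\<lambda>z. x z + s * v n z)))"
    for n and x :: "'a \<Rightarrow> real"
  have sgn_at: "sgn_at n x \<in> {1, -1} \<and> N (B n (v n)) \<le> N (B n (\<lambda>z. x z + sgn_at n x * v n z))"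
    if "x \<in> X" for n x
    unfolding sgn_at_def by (rule someI_ex) (use choice[OF that] in blast)
  define f where "f = rec_nat (\<lambda>z. 0) (\<lambda>n x. (\<lambda>z. x z + sgn_at n x * v n z))"
  have f0: "f 0 = (\<lambda>z. 0)" and fS: "f (Suc n) = (\<lambda>z. f n z + sgn_at n (f n) * v n z)" for n
    by (simp_all add: f_def)
  have fX: "f n \<in> X" for n
  proof (induction n)
    case (Suc n)
    then show ?case unfolding fS using v by (intro add_mem cmult_mem)
  qed (simp add: f0 zero_mem)
  have "N (\<lambda>x. f (Suc n) x - f n x) \<le> (1 / 3) ^ n" for n
  proof -
    have "N (\<lambda>x. f (Suc n) x - f n x) \<le> \<bar>sgn_at n (f n)\<bar> * N (v n)"
      using N_cmult[OF v, of "sgn_at n (f n)" n] by (simp add: fS)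
    also have "\<bar>sgn_at n (f n)\<bar> = 1" using sgn_at[OF fX, of n n] by auto
    finally show ?thesis using Nv[of n] by simp
  qed
  then obtain g where g: "g \<in> X" "\<And>n. N (\<lambda>x. f n x - g x) \<le> 3 / 2 * (1 / 3) ^ n"
    using complete[of f] fX by blast
  have "(4 / 3) ^ n / 4 \<le> N (B n g)" for n
  proof -
    have Bf: "N (B n (v n)) \<le> N (B n (f (Suc n)))" using sgn_at[OF fX, of n n] by (simp add: fS)
    have dX: "(\<lambda>x. f (Suc n) x - g x) \<in> X" using fX g by (intro diff_mem)
    have "B n (f (Suc n)) = (\<lambda>x. B n g x + B n (\<lambda>x. f (Suc n) x - g x) x)"
      using bounded_op_add[OF B g(1) dX] by simp
    then have "N (B n (f (Suc n))) \<le> N (B n g) + N (B n (\<lambda>x. f (Suc n) x - g x))"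
      using N_add[OF bounded_op_mem[OF B g(1)] bounded_op_mem[OF B dX], of n n] by simp
    also have "N (B n (\<lambda>x. f (Suc n) x - g x)) \<le> L n * N (\<lambda>x. f (Suc n) x - g x)" using L(2)[OF dX] .
    also have "\<dots> \<le> L n * (3 / 2 * (1 / 3) ^ Suc n)"
      using L(1)[of n] order_trans[of 0 "4 ^ n" "L n"] by (intro mult_left_mono g(2)) auto
    \<comment> \<open>All later humps together have size at most 3/2 (1/3)^(n+1) = 1/2 (1/3)^n, so
      3/4 - 1/2 = 1/4 of \<open>L n\<close> survives at scale (1/3)^n. As L n \<ge> 4^n this grows
      like (4/3)^n.\<close>
    finally have "3 / 4 * L n * (1 / 3) ^ n \<le> N (B n g) + L n * (3 / 2 * (1 / 3) ^ Suc n)"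
      using Bf NBv[of n] by linarith
    then have "L n * (1 / 3) ^ n / 4 \<le> N (B n g)" by (simp add: field_simps)
    moreover have "4 ^ n * (1 / 3) ^ n / 4 \<le> L n * (1 / 3) ^ n / 4"
      using L(1)[of n] by (intro divide_right_mono mult_right_mono) auto
    ultimately show ?thesis by (simp add: power_divide)
  qed
  with g(1) show ?thesis by (rule that)
qed

section \<open>Local boundedness and differentiability of orbits\<close>

context
  fixes S :: "real \<Rightarrow> ('a \<Rightarrow> real) \<Rightarrow> ('a \<Rightarrow> real)"
  assumes S: "C0_semigroup X N S"
begin

lemma semigroup_bounded_op: "t \<ge> 0 \<Longrightarrow> bounded_op (S t)"
  using S unfolding C0_semigroup_def bounded_op_def by blast

lemma semigroup_0: "u \<in> X \<Longrightarrow> S 0 u = u"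
  using S by (auto simp: C0_semigroup_def)

lemma semigroup_add: "s \<ge> 0 \<Longrightarrow> t \<ge> 0 \<Longrightarrow> u \<in> X \<Longrightarrow> S (s + t) u = S s (S t u)"
  using S by (auto simp: C0_semigroup_def)

lemma semigroup_continuous_0: "u \<in> X \<Longrightarrow> ((\<lambda>t. N (\<lambda>x. S t u x - u x)) \<longlongrightarrow> 0) (at_right 0)"
  using S by (auto simp: C0_semigroup_def)

lemma semigroup_mem: "t \<ge> 0 \<Longrightarrow> u \<in> X \<Longrightarrow> S t u \<in> X"
  using semigroup_bounded_op bounded_op_mem by blast

text \<open>Otherwise there are times tending to 0 with operator norms beyond 4^n. The gliding hump
  then yields one vector whose orbit is unbounded along them, against strong continuity at
  0.\<close>

lemma semigroup_bounded_near_0: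
  "\<exists>d>0. \<exists>M. \<forall>t\<in>{0..d}. \<forall>u\<in>X. N (S t u) \<le> M * N u"
proof (rule ccontr)
  assume no: "\<not> ?thesis"
  have "\<exists>t. 0 \<le> t \<and> t \<le> 1 / real (Suc n) \<and> \<not> (\<forall>u\<in>X. N (S t u) \<le> 4 ^ n * N u)" for n
  proof (rule ccontr)
    assume "\<not> ?thesis"
    then have "\<forall>t\<in>{0..1 / real (Suc n)}. \<forall>u\<in>X. N (S t u) \<le> 4 ^ n * N u" by auto
    moreover have "0 < 1 / real (Suc n)" by simp
    ultimately show False using no by blast
  qed
  then obtain t where t: "\<And>n. 0 \<le> t n" "\<And>n. t n \<le> 1 / real (Suc n)"
    "\<And>n. \<not> (\<forall>u\<in>X. N (S (t n) u) \<le> 4 ^ n * N u)" by metis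
  obtain x where x: "x \<in> X" "\<And>n. (4 / 3) ^ n / 4 \<le> N (S (t n) x)"
    by (rule gliding_hump[of "\<lambda>n. S (t n)"]) (use t semigroup_bounded_op in auto)
  have "eventually (\<lambda>s. N (\<lambda>y. S s x y - x y) < 1) (at_right 0)"
    using semigroup_continuous_0[OF x(1)] by (rule order_tendstoD) simp
  then obtain d where d: "d > 0" "\<And>s. 0 < s \<Longrightarrow> s < d \<Longrightarrow> N (\<lambda>y. S s x y - x y) < 1"
    by (auto simp: eventually_at_right_field)
  have bd: "N (S s x) \<le> N x + 1" if "0 \<le> s" "s < d" for s
  proof (cases "s = 0")
    case False
    have m: "S s x \<in> X" using that x by (simp add: semigroup_mem)
    have "N (S s x) \<le> N x + N (\<lambda>y. S s x y - x y)"
      using N_add[OF x(1) diff_mem[OF m x(1)]] by simp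
    then show ?thesis using d(2)[of s] that False by simp
  qed (simp add: semigroup_0 x)
  obtain n1 :: nat where n1: "1 / d < real n1" using reals_Archimedean2 by blast
  obtain n2 :: nat where n2: "4 * (N x + 1) < (4 / 3) ^ n2"
    using real_arch_pow[of "4 / 3" "4 * (N x + 1)"] by auto
  let ?n = "max n1 n2"
  have "1 / real (Suc ?n) < d"
  proof -
    have "1 / d < real (Suc ?n)" using n1 by linarith
    then show ?thesis using d(1) by (simp add: field_simps)
  qed
  then have "N (S (t ?n) x) \<le> N x + 1" using t(1,2)[of ?n] by (intro bd) auto
  moreover have "(4 / 3 :: real) ^ n2 \<le> (4 / 3) ^ ?n" by (rule power_increasing) auto
  moreover have False if "4 * E < A" "A \<le> C" "C / 4 \<le> D" "D \<le> E" for A C D E :: real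
    using that by linarith
  ultimately show False using n2 x(2)[of ?n] by blast
qed

text \<open>S t is the \<open>k0\<close>-th power of S (t / k0), where \<open>k0\<close> is large
  enough to bring t / k0 into the interval on which a bound is known.\<close>

lemma semigroup_locally_bounded:
  obtains M where "M \<ge> 1" "\<And>t u. 0 \<le> t \<Longrightarrow> t \<le> T \<Longrightarrow> u \<in> X \<Longrightarrow> N (S t u) \<le> M * N u"
proof -
  obtain d M0 where d: "d > 0" "\<And>t u. t \<in> {0..d} \<Longrightarrow> u \<in> X \<Longrightarrow> N (S t u) \<le> M0 * N u"
    using semigroup_bounded_near_0 by blast
  define M where "M = max 1 M0"
  have M: "M \<ge> 1" "\<And>t u. t \<in> {0..d} \<Longrightarrow> u \<in> X \<Longrightarrow> N (S t u) \<le> M * N u"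
    using d(2) mult_right_mono[OF max.cobounded2[of M0 1] N_nonneg] by (force simp: M_def)+
  have pw: "N (S (real k * s) u) \<le> M ^ k * N u" if "s \<in> {0..d}" "u \<in> X" for k s u
  proof (induction k)
    case (Suc k)
    have "S (real (Suc k) * s) u = S s (S (real k * s) u)"
      using semigroup_add[of s "real k * s" u] that by (simp add: algebra_simps)
    then have "N (S (real (Suc k) * s) u) \<le> M * N (S (real k * s) u)"
      using M(2)[OF that(1) semigroup_mem[of "real k * s" u]] that by simp
    also have "\<dots> \<le> M * (M ^ k * N u)" using Suc M(1) by (intro mult_left_mono) auto
    finally show ?case by simp
  qed (use that semigroup_0 in simp)
  obtain k0 :: nat where k0: "\<bar>T\<bar> / d < real k0" using reals_Archimedean2 by blast
  then have k: "k0 > 0" "\<bar>T\<bar> < real k0 * d"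
    using d(1) by (auto simp: field_simps intro: gr0I)
  have "N (S t u) \<le> M ^ k0 * N u" if "0 \<le> t" "t \<le> T" "u \<in> X" for t u
    using pw[of "t / real k0" u k0] that k by (simp add: field_simps)
  moreover have "M ^ k0 \<ge> 1" using M(1) by simp
  ultimately show ?thesis using that by blast
qed

text \<open>The generator gives right derivatives only. For s < t and h = t - s the left quotient
  minus S t v equals S s ((S h u - u)/h - v) - S s (S h v - v); both arguments tend to 0, and S s is
  bounded uniformly for s \<le> t, which is why local boundedness is needed.\<close>

lemma generator_invariant:
  assumes uv: "(u, v) \<in> generator_graph X N S" and t: "t \<ge> 0"
  shows "(S t u, S t v) \<in> generator_graph X N S"
    "((\<lambda>s. N (\<lambda>x. (S s u x - S t u x) / (s - t) - S t v x)) \<longlongrightarrow> 0) (at t within {0..})"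
proof -
  have u: "u \<in> X" and v: "v \<in> X"
    and w: "((\<lambda>h. N (\<lambda>x. (S h u x - u x) / h - v x)) \<longlongrightarrow> 0) (at_right 0)"
    using uv by (auto simp: generator_graph_def)
  obtain M where M: "M \<ge> 1" "\<And>s u. 0 \<le> s \<Longrightarrow> s \<le> t + 1 \<Longrightarrow> u \<in> X \<Longrightarrow> N (S s u) \<le> M * N u"
    by (rule semigroup_locally_bounded[of "t + 1"]) blast
  define e1 where "e1 h = N (\<lambda>x. (S h u x - u x) / h - v x)" for h
  define e2 where "e2 h = N (\<lambda>x. S h v x - v x)" for h
  have e: "(e1 \<longlongrightarrow> 0) (at_right 0)" "(e2 \<longlongrightarrow> 0) (at_right 0)"
    unfolding e1_def[abs_def] e2_def[abs_def] using w semigroup_continuous_0[OF v] .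
  have mem1: "(\<lambda>x. (S h u x - u x) / h - v x) \<in> X" if "h > 0" for h
  proof -
    have "(\<lambda>x. (1 / h) * (S h u x - u x) - v x) \<in> X"
      using that u v by (intro diff_mem cmult_mem semigroup_mem) auto
    then show ?thesis by simp
  qed
  have q: "S s (\<lambda>x. (S h u x - u x) / h - v x) = (\<lambda>x. (S (s + h) u x - S s u x) / h - S s v x)"
    if "s \<ge> 0" "h > 0" for s h
  proof -
    have b: "bounded_op (S s)" using that by (intro semigroup_bounded_op)
    have "S s (\<lambda>x. (1 / h) * (S h u x - u x) - v x) = (\<lambda>x. (1 / h) * (S s (S h u) x - S s u x) - S s v x)"
      using that u v
      by (simp only: bounded_op_diff[OF b cmult_mem[OF diff_mem[OF semigroup_mem u]] v]
          bounded_op_cmult[OF b diff_mem[OF semigroup_mem u]] bounded_op_diff[OF b semigroup_mem u] less_imp_le)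
    then show ?thesis using semigroup_add[of s h u] that u by simp
  qed
  have right: "N (\<lambda>x. (S (t + h) u x - S t u x) / h - S t v x) \<le> M * e1 h" if "h > 0" for h
    using M(2)[of t, OF t _ mem1[OF that]] unfolding q[OF t that] e1_def by simp
  have left: "N (\<lambda>x. (S s u x - S t u x) / (s - t) - S t v x) \<le> M * e1 (t - s) + M * e2 (t - s)"
    if "0 \<le> s" "s < t" for s
  proof -
    define h where "h = t - s"
    have h: "h > 0" "s + h = t" using that by (auto simp: h_def)
    have mem2: "(\<lambda>x. S h v x - v x) \<in> X" using h v by (intro diff_mem semigroup_mem) auto
    have "S s (\<lambda>x. S h v x - v x) = (\<lambda>x. S t v x - S s v x)"
      using bounded_op_diff[OF semigroup_bounded_op[OF that(1)] semigroup_mem[of h v] v]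
        semigroup_add[of s h v] h that v by simp
    moreover have "(S s u x - S t u x) / (s - t) = (S t u x - S s u x) / h" for x
      using that by (simp add: h_def field_simps)
    ultimately have eq: "(\<lambda>x. (S s u x - S t u x) / (s - t) - S t v x) =
        (\<lambda>x. S s (\<lambda>x. (S h u x - u x) / h - v x) x - S s (\<lambda>x. S h v x - v x) x)"
      using q[OF that(1) h(1)] h by simp
    show ?thesis unfolding eq
      using N_diff[OF semigroup_mem[OF that(1) mem1[OF h(1)]] semigroup_mem[OF that(1) mem2]]
        M(2)[OF that(1) _ mem1[OF h(1)]] M(2)[OF that(1) _ mem2] that
      by (simp add: e1_def e2_def flip: h_def)
  qed
  have e1n: "0 \<le> e1 h" "0 \<le> e2 h" if "h > 0" for h
    using that u v by (auto simp: e1_def e2_def intro!: N_nonneg mem1 diff_mem semigroup_mem)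
  have tv: "S t u \<in> X" "S t v \<in> X" using t u v by (auto intro: semigroup_mem)
  show "(S t u, S t v) \<in> generator_graph X N S"
  proof -
    have "((\<lambda>h. N (\<lambda>x. (S h (S t u) x - S t u x) / h - S t v x)) \<longlongrightarrow> 0) (at_right 0)"
    proof (rule tendsto_sandwich[of "\<lambda>_. 0" _ _ "\<lambda>h. M * e1 h"])
      have ev: "eventually (\<lambda>h. h > 0) (at_right (0::real))" by (simp add: eventually_at_filter)
      show "\<forall>\<^sub>F h in at_right 0. 0 \<le> N (\<lambda>x. (S h (S t u) x - S t u x) / h - S t v x)"
      proof (rule eventually_mono[OF ev])
        fix h :: real assume h: "h > 0"
        have "(\<lambda>x. (1 / h) * (S h (S t u) x - S t u x) - S t v x) \<in> X"
          using h tv semigroup_mem[of h, OF _ tv(1)] by (intro diff_mem cmult_mem) auto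
        then show "0 \<le> N (\<lambda>x. (S h (S t u) x - S t u x) / h - S t v x)" using N_nonneg by simp
      qed
      show "\<forall>\<^sub>F h in at_right 0. N (\<lambda>x. (S h (S t u) x - S t u x) / h - S t v x) \<le> M * e1 h"
      proof (rule eventually_mono[OF ev])
        fix h :: real assume h: "h > 0"
        have "S h (S t u) = S (t + h) u" using semigroup_add[of h t u] h t u by (simp add: add.commute)
        then show "N (\<lambda>x. (S h (S t u) x - S t u x) / h - S t v x) \<le> M * e1 h" using right[OF h] by simp
      qed
    qed (use tendsto_mult_right_zero[OF e(1)] in auto)
    then show ?thesis using tv by (simp add: generator_graph_def)
  qed
  have fl: "filterlim (\<lambda>s. \<bar>s - t\<bar>) (at_right 0) (at t within {0..})"
  proof (rule filterlim_at_withinI)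
    show "((\<lambda>s. \<bar>s - t\<bar>) \<longlongrightarrow> 0) (at t within {0..})"
      by (auto intro!: tendsto_eq_intros)
  qed (auto simp: eventually_at_filter)
  show "((\<lambda>s. N (\<lambda>x. (S s u x - S t u x) / (s - t) - S t v x)) \<longlongrightarrow> 0) (at t within {0..})"
  proof (rule tendsto_sandwich[of "\<lambda>_. 0" _ _ "\<lambda>s. M * e1 \<bar>s - t\<bar> + M * e2 \<bar>s - t\<bar>"])
    have ev: "eventually (\<lambda>s. s \<noteq> t \<and> 0 \<le> s) (at t within {0..})" by (auto simp: eventually_at_filter)
    show "\<forall>\<^sub>F s in at t within {0..}. 0 \<le> N (\<lambda>x. (S s u x - S t u x) / (s - t) - S t v x)"
    proof (rule eventually_mono[OF ev])
      fix s assume s: "s \<noteq> t \<and> 0 \<le> s"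
      have "(\<lambda>x. (1 / (s - t)) * (S s u x - S t u x) - S t v x) \<in> X"
        using tv semigroup_mem[of s u] s u by (intro diff_mem cmult_mem) auto
      then show "0 \<le> N (\<lambda>x. (S s u x - S t u x) / (s - t) - S t v x)" using N_nonneg by simp
    qed
    show "\<forall>\<^sub>F s in at t within {0..}. N (\<lambda>x. (S s u x - S t u x) / (s - t) - S t v x)
        \<le> M * e1 \<bar>s - t\<bar> + M * e2 \<bar>s - t\<bar>"
    proof (rule eventually_mono[OF ev])
      fix s assume s: "s \<noteq> t \<and> 0 \<le> s"
      show "N (\<lambda>x. (S s u x - S t u x) / (s - t) - S t v x) \<le> M * e1 \<bar>s - t\<bar> + M * e2 \<bar>s - t\<bar>"
      proof (cases "s < t")
        case True
        then show ?thesis using left[of s] s by simp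
      next
        case False
        then have h: "s - t > 0" using s by simp
        have "0 \<le> M * e2 (s - t)" using e1n[OF h] M(1) by simp
        then show ?thesis using right[OF h] h by simp
      qed
    qed
    show "((\<lambda>s. M * e1 \<bar>s - t\<bar> + M * e2 \<bar>s - t\<bar>) \<longlongrightarrow> 0) (at t within {0..})"
      using tendsto_add[OF tendsto_mult_right_zero[OF filterlim_compose[OF e(1) fl]]
          tendsto_mult_right_zero[OF filterlim_compose[OF e(2) fl]]] by simp
  qed simp
qed

end

end

section \<open>Completeness, Fubini and the Laplace transform\<close>

lemma norm_minus1_lincomb:
  assumes \<mu>: "\<mu> > 0" and u: "u \<in> X_minus1 \<mu>" and v: "v \<in> X_minus1 \<mu>"
  shows "(\<lambda>x. a * u x + b * v x) \<in> X_minus1 \<mu>"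
    "norm_minus1 \<mu> (\<lambda>x. a * u x + b * v x) \<le> \<bar>a\<bar> * norm_minus1 \<mu> u + \<bar>b\<bar> * norm_minus1 \<mu> v"
proof -
  obtain G where G: "is_primitive G u" "sqint (wmeas \<mu>) G" "(LINT y|lborel. G y) = 0"
    using X_minus1_primitive[OF u \<mu>] .
  obtain H where H: "is_primitive H v" "sqint (wmeas \<mu>) H" "(LINT y|lborel. H y) = 0"
    using X_minus1_primitive[OF v \<mu>] .
  let ?K = "\<lambda>y. a * G y + b * H y"
  have K: "is_primitive ?K (\<lambda>x. a * u x + b * v x)" using G H by (intro is_primitive_lincomb)
  have sG: "sqint (wmeas \<mu>) (\<lambda>y. a * G y)" and sH: "sqint (wmeas \<mu>) (\<lambda>y. b * H y)"
    using G H by (auto intro: sqint_cmult)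
  have sK: "sqint (wmeas \<mu>) ?K" using sG sH by (rule sqint_add)
  have "(LINT y|lborel. ?K y) = 0" using G H by (simp add: is_primitive_def)
  with K sK show "(\<lambda>x. a * u x + b * v x) \<in> X_minus1 \<mu>" using \<mu> by (rule X_minus1I)
  have "norm_minus1 \<mu> (\<lambda>x. a * u x + b * v x) = l2norm (wmeas \<mu>) ?K"
    using K sK \<mu> by (rule norm_minus1_primitive)
  also have "\<dots> \<le> l2norm (wmeas \<mu>) (\<lambda>y. a * G y) + l2norm (wmeas \<mu>) (\<lambda>y. b * H y)"
    using sG sH by (rule l2norm_triangle)
  also have "\<dots> = \<bar>a\<bar> * norm_minus1 \<mu> u + \<bar>b\<bar> * norm_minus1 \<mu> v"
    using norm_minus1_primitive[OF G(1,2) \<mu>] norm_minus1_primitive[OF H(1,2) \<mu>]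
    by (simp add: l2norm_cmult)
  finally show "norm_minus1 \<mu> (\<lambda>x. a * u x + b * v x) \<le> \<bar>a\<bar> * norm_minus1 \<mu> u + \<bar>b\<bar> * norm_minus1 \<mu> v" .
qed

lemma norm_minus1_nonneg: "norm_minus1 \<mu> u \<ge> 0"
  by (simp add: norm_minus1_def set_lebesgue_integral_def)

lemma is_primitive_zero: "is_primitive (\<lambda>y. 0) (\<lambda>\<phi>. 0)"
  by (auto simp: is_primitive_def)

definition deriv_distr :: "(real \<Rightarrow> real) \<Rightarrow> distribution" where
  "deriv_distr H = (\<lambda>\<phi>. if \<phi> \<in> test_functions then LINT y|lborel. H y * deriv \<phi> y else 0)"

lemma is_primitive_deriv_distr:
  "integrable lborel H \<Longrightarrow> (\<And>y. y \<le> 0 \<Longrightarrow> H y = 0) \<Longrightarrow> is_primitive H (deriv_distr H)"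
  by (simp add: is_primitive_def deriv_distr_def)

lemma is_primitive_diff:
  "is_primitive G u \<Longrightarrow> is_primitive H v \<Longrightarrow> is_primitive (\<lambda>y. G y - H y) (\<lambda>\<phi>. u \<phi> - v \<phi>)"
  using is_primitive_lincomb[of G u H v 1 "-1"] by simp

text \<open>Weighted L2 is complete, and the mean-zero condition survives limits because the
  integral is continuous there: it is \<open>exp_pairing\<close> at exponent 0.\<close>

lemma complete_X_minus1:
  assumes \<mu>: "\<mu> > 0"
  shows "complete_function_space (X_minus1 \<mu>) (norm_minus1 \<mu>)"
proof
  show "(\<lambda>x. 0) \<in> X_minus1 \<mu>"
    by (rule X_minus1I[OF is_primitive_zero _ _ \<mu>]) (auto simp: sqint_def)
  fix f :: "nat \<Rightarrow> distribution"
  assume f: "\<And>n. f n \<in> X_minus1 \<mu>"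
    and d: "\<And>n. norm_minus1 \<mu> (\<lambda>x. f (Suc n) x - f n x) \<le> (1 / 3) ^ n"
  have "\<exists>H. is_primitive H (f n) \<and> sqint (wmeas \<mu>) H \<and> (LINT y|lborel. H y) = 0" for n
    using X_minus1_primitive[OF f \<mu>] by blast
  then obtain H where H: "\<And>n. is_primitive (H n) (f n)" "\<And>n. sqint (wmeas \<mu>) (H n)"
    "\<And>n. (LINT y|lborel. H n y) = 0" by metis
  have "l2norm (wmeas \<mu>) (\<lambda>x. H (Suc n) x - H n x) \<le> 1 * (1 / 3) ^ n" for n
    using d[of n] norm_minus1_primitive[OF is_primitive_diff[OF H(1) H(1)] sqint_diff[OF H(2) H(2)] \<mu>]
    by simp
  then obtain G where G: "sqint (wmeas \<mu>) G"
    "\<And>n. l2norm (wmeas \<mu>) (\<lambda>x. H n x - G x) \<le> 1 * (1 / 3) ^ n / (1 - 1 / 3)"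
    using l2_complete[of "wmeas \<mu>" H "1 / 3" 1] H(2) by auto
  have Gm[measurable]: "G \<in> borel_measurable borel" using G(1) by (auto dest: sqintD)
  \<comment> \<open>The L2 limit is meaningful only on y > 0; it is reset to 0 elsewhere to be a
    primitive.\<close>
  define K where "K y = indicator {0<..} y * G y" for y
  have Km[measurable]: "K \<in> borel_measurable borel" unfolding K_def by measurable
  have KG: "AE y in wmeas \<mu>. K y = G y" unfolding AE_wmeas_iff by (auto simp: K_def)
  have K: "sqint (wmeas \<mu>) K"
    by (rule sqint_cong_AE[OF G(1)]) (use KG in \<open>auto elim: AE_mp\<close>)
  have K0: "K y = 0" if "y \<le> 0" for y using that by (simp add: K_def)
  have dK: "l2norm (wmeas \<mu>) (\<lambda>x. H n x - K x) \<le> 3 / 2 * (1 / 3) ^ n" for n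
  proof -
    have "l2norm (wmeas \<mu>) (\<lambda>x. H n x - K x) = l2norm (wmeas \<mu>) (\<lambda>x. H n x - G x)"
      using sqintD(1)[OF H(2)[of n]] KG by (intro l2norm_cong_AE) auto
    then show ?thesis using G(2)[of n] by simp
  qed
  have Ki: "integrable lborel K" using moment_integrable(1)[OF K K0 \<mu>] .
  have "\<bar>LINT y|lborel. K y\<bar> \<le> 3 / 2 * (1 / 3) ^ n / sqrt \<mu>" for n
  proof -
    have Hi: "integrable lborel (H n)" using H(1) by (simp add: is_primitive_def)
    have "\<bar>LINT y|lborel. (H n y - K y) * exp (- 0 * y)\<bar> \<le> l2norm (wmeas \<mu>) (\<lambda>y. H n y - K y) / sqrt (2 * 0 + \<mu>)"
      using H(1) K0 \<mu> by (intro exp_pairing(2) sqint_diff H(2) K) (auto simp: is_primitive_def)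
    also have "\<dots> \<le> 3 / 2 * (1 / 3) ^ n / sqrt \<mu>"
      using divide_right_mono[OF dK[of n], of "sqrt \<mu>"] \<mu> by simp
    finally show ?thesis using Hi Ki H(3)[of n] by simp
  qed
  moreover have "(\<lambda>n. 3 / 2 * (1 / 3) ^ n / sqrt \<mu>) \<longlonglongrightarrow> 3 / 2 * 0 / sqrt \<mu>"
    using \<mu> by (intro tendsto_intros) auto
  ultimately have "\<bar>LINT y|lborel. K y\<bar> \<le> 3 / 2 * 0 / sqrt \<mu>" by (intro LIMSEQ_le_const) auto
  then have KI: "(LINT y|lborel. K y) = 0" by simp
  have Kp: "is_primitive K (deriv_distr K)" using Ki K0 by (rule is_primitive_deriv_distr)
  show "\<exists>g\<in>X_minus1 \<mu>. \<forall>n. norm_minus1 \<mu> (\<lambda>x. f n x - g x) \<le> 3 / 2 * (1 / 3) ^ n"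
  proof (intro bexI allI)
    show "norm_minus1 \<mu> (\<lambda>x. f n x - deriv_distr K x) \<le> 3 / 2 * (1 / 3) ^ n" for n
      using norm_minus1_primitive[OF is_primitive_diff[OF H(1) Kp] sqint_diff[OF H(2) K] \<mu>] dK by simp
  qed (use X_minus1I[OF Kp K KI \<mu>] in auto)
qed (use norm_minus1_lincomb[OF \<mu>] norm_minus1_nonneg in auto)

text \<open>Fubini for the tail integral, with the weight \<open>x\<close> coming from the length of \<open>(0,x)\<close>.\<close>

lemma tail_fubini:
  fixes \<eta> \<psi> :: "real \<Rightarrow> real"
  assumes m[measurable]: "\<eta> \<in> borel_measurable borel" "\<psi> \<in> borel_measurable borel"
    and i: "integrable lborel (\<lambda>x. x * \<eta> x)" and z: "\<And>x. x \<le> 0 \<Longrightarrow> \<eta> x = 0"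
    and b: "\<And>y. \<bar>\<psi> y\<bar> \<le> B"
  defines "T \<equiv> \<lambda>y. indicator {0<..} y * (LINT x|lborel. indicator {y<..} x * \<eta> x)"
  shows "integrable lborel T"
    "(LINT y|lborel. T y * \<psi> y) = (LINT x|lborel. \<eta> x * (LINT y|lborel. indicator {0<..<x} y * \<psi> y))"
proof -
  have main: "integrable lborel (\<lambda>y. LINT x|lborel. \<eta> x * (indicator {0<..<x} y * \<psi> y)) \<and>
    (LINT y|lborel. LINT x|lborel. \<eta> x * (indicator {0<..<x} y * \<psi> y)) =
    (LINT x|lborel. LINT y|lborel. \<eta> x * (indicator {0<..<x} y * \<psi> y))"
    if m'[measurable]: "\<psi> \<in> borel_measurable borel" and b: "\<And>y. \<bar>\<psi> y\<bar> \<le> B" for \<psi> :: "real \<Rightarrow> real" and B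
  proof -
    have ind: "integrable lborel (indicator {0<..<x} :: real \<Rightarrow> real)" for x :: real
      by (rule integrable_real_indicator) (use emeasure_bounded_finite[of "{0<..<x}"] in auto)
    have in1: "integrable lborel (\<lambda>y. indicator {0<..<x} y * \<psi> y)" for x
      by (rule integrable_mult_bounded[OF ind m' b])
    have ms: "(\<lambda>(x, y). \<eta> x * (indicator {0<..<x} y * \<psi> y)) \<in> borel_measurable (lborel \<Otimes>\<^sub>M lborel)"
    proof -
      have eq: "(\<lambda>(x, y). \<eta> x * (indicator {0<..<x} y * \<psi> y)) =
          (\<lambda>p. \<eta> (fst p) * ((if 0 < snd p \<and> snd p < fst p then 1 else 0) * \<psi> (snd p)))"
        by (auto simp: fun_eq_iff indicator_def)
      show ?thesis unfolding eq by measurable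
    qed
    have "integrable (lborel \<Otimes>\<^sub>M lborel) (\<lambda>(x, y). \<eta> x * (indicator {0<..<x} y * \<psi> y))"
    proof (rule lborel_pair.Fubini_integrable[OF ms])
      show "AE x in lborel. integrable lborel (\<lambda>y. case (x, y) of (x, y) \<Rightarrow> \<eta> x * (indicator {0<..<x} y * \<psi> y))"
        using in1 by (intro AE_I2) (simp add: integrable_mult_right)
      show "integrable lborel (\<lambda>x. LINT y|lborel. norm (case (x, y) of (x, y) \<Rightarrow> \<eta> x * (indicator {0<..<x} y * \<psi> y)))"
      proof (rule Bochner_Integration.integrable_bound[OF integrable_mult_right[OF i, of "\<bar>B\<bar>"]])
        show "(\<lambda>x. LINT y|lborel. norm (case (x, y) of (x, y) \<Rightarrow> \<eta> x * (indicator {0<..<x} y * \<psi> y)))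
            \<in> borel_measurable lborel"
          using ms by (intro lborel.borel_measurable_lebesgue_integral) (simp add: split_beta')
        show "AE x in lborel. norm (LINT y|lborel. norm (case (x, y) of (x, y) \<Rightarrow> \<eta> x * (indicator {0<..<x} y * \<psi> y)))
            \<le> norm (\<bar>B\<bar> * (x * \<eta> x))"
        proof (rule AE_I2)
          fix x
          have "(LINT y|lborel. norm (\<eta> x * (indicator {0<..<x} y * \<psi> y))) \<le>
              (LINT y|lborel. \<bar>\<eta> x\<bar> * \<bar>B\<bar> * indicator {0<..<x} y)"
          proof (rule integral_mono)
            show "integrable lborel (\<lambda>y. norm (\<eta> x * (indicator {0<..<x} y * \<psi> y)))"
              using in1 by (intro integrable_norm integrable_mult_right)
            show "integrable lborel (\<lambda>y. \<bar>\<eta> x\<bar> * \<bar>B\<bar> * indicator {0<..<x} y)"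
              using ind by (rule integrable_mult_right)
            show "norm (\<eta> x * (indicator {0<..<x} y * \<psi> y)) \<le> \<bar>\<eta> x\<bar> * \<bar>B\<bar> * indicator {0<..<x} y" for y
              using order_trans[OF b[of y], of "\<bar>B\<bar>"] by (auto simp: indicator_def abs_mult intro!: mult_left_mono)
          qed
          also have "\<dots> \<le> norm (\<bar>B\<bar> * (x * \<eta> x))" by (cases "x \<le> 0") (auto simp: z abs_mult)
          finally show "norm (LINT y|lborel. norm (case (x, y) of (x, y) \<Rightarrow> \<eta> x * (indicator {0<..<x} y * \<psi> y)))
            \<le> norm (\<bar>B\<bar> * (x * \<eta> x))" by simp
        qed
      qed
    qed
    then show ?thesis
      using lborel_pair.integrable_snd[of "\<lambda>x y. \<eta> x * (indicator {0<..<x} y * \<psi> y)"]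
        lborel_pair.Fubini_integral[of "\<lambda>x y. \<eta> x * (indicator {0<..<x} y * \<psi> y)"] by simp
  qed
  have T: "(LINT x|lborel. \<eta> x * (indicator {0<..<x} y * \<psi> y)) = T y * \<psi> y" for \<psi> :: "real \<Rightarrow> real" and y
  proof -
    have "(\<lambda>x. \<eta> x * (indicator {0<..<x} y * \<psi> y)) =
        (\<lambda>x. (indicator {0<..} y * \<psi> y) * (indicator {y<..} x * \<eta> x))"
      by (auto simp: fun_eq_iff indicator_def)
    then show ?thesis unfolding T_def by simp
  qed
  show "integrable lborel T" using conjunct1[OF main[of "\<lambda>_. 1" 1]] T[where \<psi>="\<lambda>_. 1"] by simp
  show "(LINT y|lborel. T y * \<psi> y) = (LINT x|lborel. \<eta> x * (LINT y|lborel. indicator {0<..<x} y * \<psi> y))"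
    using main[OF m(2) b] unfolding T by simp
qed

text \<open>Substituting y = x + z in the inner integral moves the convolution onto the bounded
  function \<open>\<psi>\<close>. Taking \<open>\<psi>\<close> to be a test function or a cut-off
  exponential covers both distributional pairings and Laplace transforms.\<close>

lemma convolution_fubini:
  fixes f k \<psi> :: "real \<Rightarrow> real"
  assumes f: "integrable lborel f" and k: "integrable lborel k"
    and m[measurable]: "\<psi> \<in> borel_measurable borel" and b: "\<And>y. \<bar>\<psi> y\<bar> \<le> B"
  shows "integrable lborel (\<lambda>y. LINT x|lborel. f x * k (y - x))"
    "(LINT y|lborel. (LINT x|lborel. f x * k (y - x)) * \<psi> y) =
     (LINT x|lborel. f x * (LINT z|lborel. k z * \<psi> (x + z)))"
proof -
  have [measurable]: "f \<in> borel_measurable borel" "k \<in> borel_measurable borel"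
    using f k by (auto dest: borel_measurable_integrable)
  have shift: "integrable lborel (\<lambda>y. k (y - x))" for x
    using lborel_integrable_real_affine[OF k, of 1 "- x"] by simp
  have main: "integrable lborel (\<lambda>y. LINT x|lborel. f x * (k (y - x) * \<psi> y)) \<and>
    (LINT y|lborel. LINT x|lborel. f x * (k (y - x) * \<psi> y)) =
    (LINT x|lborel. LINT y|lborel. f x * (k (y - x) * \<psi> y))"
    if m'[measurable]: "\<psi> \<in> borel_measurable borel" and b: "\<And>y. \<bar>\<psi> y\<bar> \<le> B" for \<psi> :: "real \<Rightarrow> real" and B
  proof -
    have in1: "integrable lborel (\<lambda>y. k (y - x) * \<psi> y)" for x
      by (rule integrable_mult_bounded[OF shift m' b])
    have ms: "(\<lambda>(x, y). f x * (k (y - x) * \<psi> y)) \<in> borel_measurable (lborel \<Otimes>\<^sub>M lborel)"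
      by (simp add: split_beta')
    have "integrable (lborel \<Otimes>\<^sub>M lborel) (\<lambda>(x, y). f x * (k (y - x) * \<psi> y))"
    proof (rule lborel_pair.Fubini_integrable[OF ms])
      show "AE x in lborel. integrable lborel (\<lambda>y. case (x, y) of (x, y) \<Rightarrow> f x * (k (y - x) * \<psi> y))"
        using in1 by (intro AE_I2) (simp add: integrable_mult_right)
      show "integrable lborel (\<lambda>x. LINT y|lborel. norm (case (x, y) of (x, y) \<Rightarrow> f x * (k (y - x) * \<psi> y)))"
      proof (rule Bochner_Integration.integrable_bound[OF
            integrable_mult_right[OF f, of "\<bar>B\<bar> * (LINT z|lborel. \<bar>k z\<bar>)"]])
        show "(\<lambda>x. LINT y|lborel. norm (case (x, y) of (x, y) \<Rightarrow> f x * (k (y - x) * \<psi> y)))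
            \<in> borel_measurable lborel"
          using ms by (intro lborel.borel_measurable_lebesgue_integral) (simp add: split_beta')
        show "AE x in lborel. norm (LINT y|lborel. norm (case (x, y) of (x, y) \<Rightarrow> f x * (k (y - x) * \<psi> y)))
            \<le> norm (\<bar>B\<bar> * (LINT z|lborel. \<bar>k z\<bar>) * f x)"
        proof (rule AE_I2)
          fix x
          have "(LINT y|lborel. norm (f x * (k (y - x) * \<psi> y))) \<le>
              (LINT y|lborel. \<bar>f x\<bar> * \<bar>B\<bar> * \<bar>k (y - x)\<bar>)"
          proof (rule integral_mono)
            show "integrable lborel (\<lambda>y. norm (f x * (k (y - x) * \<psi> y)))"
              using in1 by (intro integrable_norm integrable_mult_right)
            show "integrable lborel (\<lambda>y. \<bar>f x\<bar> * \<bar>B\<bar> * \<bar>k (y - x)\<bar>)"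
              using shift by (intro integrable_mult_right integrable_abs)
            fix y
            have "\<bar>\<psi> y\<bar> \<le> \<bar>B\<bar>" using b[of y] by linarith
            then have "\<bar>f x\<bar> * \<bar>k (y - x)\<bar> * \<bar>\<psi> y\<bar> \<le> \<bar>f x\<bar> * \<bar>k (y - x)\<bar> * \<bar>B\<bar>"
              by (intro mult_left_mono) auto
            then show "norm (f x * (k (y - x) * \<psi> y)) \<le> \<bar>f x\<bar> * \<bar>B\<bar> * \<bar>k (y - x)\<bar>"
              by (simp add: abs_mult mult_ac)
          qed
          also have "\<dots> = \<bar>f x\<bar> * \<bar>B\<bar> * (LINT z|lborel. \<bar>k z\<bar>)"
            using lborel_integral_real_affine[of 1 "\<lambda>z. \<bar>k z\<bar>" "- x"] by simp
          finally show "norm (LINT y|lborel. norm (case (x, y) of (x, y) \<Rightarrow> f x * (k (y - x) * \<psi> y)))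
            \<le> norm (\<bar>B\<bar> * (LINT z|lborel. \<bar>k z\<bar>) * f x)" by (simp add: abs_mult mult_ac)
        qed
      qed
    qed
    then show ?thesis
      using lborel_pair.integrable_snd[of "\<lambda>x y. f x * (k (y - x) * \<psi> y)"]
        lborel_pair.Fubini_integral[of "\<lambda>x y. f x * (k (y - x) * \<psi> y)"] by simp
  qed
  show "integrable lborel (\<lambda>y. LINT x|lborel. f x * k (y - x))"
    using main[of "\<lambda>_. 1" 1] by simp
  have "(LINT y|lborel. k (y - x) * \<psi> y) = (LINT z|lborel. k z * \<psi> (x + z))" for x
    using lborel_integral_real_affine[of 1 "\<lambda>y. k (y - x) * \<psi> y" x] by simp
  moreover have e: "(LINT x|lborel. f x * (k (y - x) * \<psi> y)) = (LINT x|lborel. f x * k (y - x)) * \<psi> y" for y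
    by (simp flip: mult.assoc)
  ultimately show "(LINT y|lborel. (LINT x|lborel. f x * k (y - x)) * \<psi> y) =
     (LINT x|lborel. f x * (LINT z|lborel. k z * \<psi> (x + z)))"
    using main[OF m b] by (simp add: e)
qed

section \<open>The Laplace transform\<close>

definition laplace :: "real \<Rightarrow> (real \<Rightarrow> real) \<Rightarrow> real" where
  "laplace \<sigma> f = (LINT y|lborel. f y * exp (- \<sigma> * y))"

lemma integrable_laplace:
  fixes f :: "real \<Rightarrow> real"
  assumes "integrable lborel f" "\<And>y. y \<le> 0 \<Longrightarrow> f y = 0" "\<sigma> \<ge> 0"
  shows "integrable lborel (\<lambda>y. f y * exp (- \<sigma> * y))"
proof (rule Bochner_Integration.integrable_bound[OF assms(1)])
  show "AE y in lborel. norm (f y * exp (- \<sigma> * y)) \<le> norm (f y)"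
  proof (rule AE_I2)
    fix y :: real show "norm (f y * exp (- \<sigma> * y)) \<le> norm (f y)"
      using assms(2)[of y] assms(3) mult_left_le[of "exp (- \<sigma> * y)" "\<bar>f y\<bar>"]
      by (cases "y \<le> 0") (auto simp: abs_mult)
  qed
qed (use borel_measurable_integrable[OF assms(1)] in measurable)

lemma laplace_halfline:
  assumes "\<And>y. y \<le> 0 \<Longrightarrow> f y = 0"
  shows "laplace \<sigma> f = (LINT y|lborel. f y * (indicator {0<..} y * exp (- \<sigma> * y)))"
  unfolding laplace_def by (rule Bochner_Integration.integral_cong) (use assms in \<open>auto simp: indicator_def\<close>)

lemma laplace_cong_AE:
  assumes "AE y in lborel. f y = g y" "f \<in> borel_measurable borel" "g \<in> borel_measurable borel"
  shows "laplace \<sigma> f = laplace \<sigma> g"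
  unfolding laplace_def using assms by (intro integral_cong_AE) auto

lemma laplace_lincomb:
  assumes "integrable lborel f" "\<And>y. y \<le> 0 \<Longrightarrow> f y = 0"
    "integrable lborel g" "\<And>y. y \<le> 0 \<Longrightarrow> g y = 0" "\<sigma> \<ge> 0"
  shows "laplace \<sigma> (\<lambda>y. a * f y + b * g y) = a * laplace \<sigma> f + b * laplace \<sigma> g"
  using integrable_laplace[OF assms(1,2,5)] integrable_laplace[OF assms(3,4,5)]
  by (simp add: laplace_def distrib_right mult.assoc)

lemma laplace_convolution:
  fixes f k :: "real \<Rightarrow> real"
  assumes f: "integrable lborel f" "\<And>y. y \<le> 0 \<Longrightarrow> f y = 0"
    and k: "integrable lborel k" "\<And>y. y \<le> 0 \<Longrightarrow> k y = 0" and \<sigma>: "\<sigma> \<ge> 0"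
  shows "laplace \<sigma> (\<lambda>y. LINT x|lborel. f x * k (y - x)) = laplace \<sigma> f * laplace \<sigma> k"
proof -
  \<comment> \<open>The exponential is cut off at 0 because Fubini is available for bounded
    \<open>\<psi>\<close> only. Nothing is lost, as all functions vanish on the left.\<close>
  let ?\<psi> = "\<lambda>y. indicator {0<..} y * exp (- \<sigma> * y)"
  have c0: "(LINT x|lborel. f x * k (y - x)) = 0" if "y \<le> 0" for y
  proof -
    have "(\<lambda>x. f x * k (y - x)) = (\<lambda>x. 0)"
      using f(2) k(2) that by (auto simp: fun_eq_iff not_le) (metis diff_le_0_iff_le le_cases order_trans)
    then show ?thesis by simp
  qed
  have b: "\<bar>?\<psi> y\<bar> \<le> 1" for y using \<sigma> by (auto simp: indicator_def)
  have "laplace \<sigma> (\<lambda>y. LINT x|lborel. f x * k (y - x)) =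
      (LINT x|lborel. f x * (LINT z|lborel. k z * ?\<psi> (x + z)))"
    using convolution_fubini(2)[OF f(1) k(1) _ b] laplace_halfline[OF c0] by simp
  also have "\<dots> = (LINT x|lborel. f x * (exp (- \<sigma> * x) * laplace \<sigma> k))"
  proof (rule Bochner_Integration.integral_cong[OF refl])
    fix x :: real
    show "f x * (LINT z|lborel. k z * ?\<psi> (x + z)) = f x * (exp (- \<sigma> * x) * laplace \<sigma> k)"
    proof (cases "x \<le> 0")
      case False
      have "(\<lambda>z. k z * ?\<psi> (x + z)) = (\<lambda>z. exp (- \<sigma> * x) * (k z * exp (- \<sigma> * z)))"
      proof
        fix z show "k z * ?\<psi> (x + z) = exp (- \<sigma> * x) * (k z * exp (- \<sigma> * z))"
          using k(2)[of z] False by (cases "z \<le> 0") (auto simp: exp_add[symmetric] algebra_simps)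
      qed
      then show ?thesis by (simp only: laplace_def integral_mult_right_zero)
    qed (simp add: f)
  qed
  also have "\<dots> = laplace \<sigma> f * laplace \<sigma> k"
    by (simp add: laplace_def flip: mult.assoc)
  finally show ?thesis .
qed

section \<open>The generator on primitives\<close>

lemma test_FTC_from_0:
  assumes \<phi>: "\<phi> \<in> test_functions" and x: "x > 0"
  shows "(LINT y|lborel. indicator {0<..<x} y * deriv \<phi> y) = \<phi> x"
proof -
  obtain a b where ab: "0 < a" "\<And>y. y \<notin> {a..b} \<Longrightarrow> \<phi> y = 0"
    using test_functionsE[OF \<phi>] by metis
  have d: "continuous_on {0..x} (deriv \<phi>)"
    using test_functions_continuous[OF test_functions_deriv[OF \<phi>]] .
  have "(LINT y|lborel. indicator {0..x} y *\<^sub>R deriv \<phi> y) = \<phi> x - \<phi> 0"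
    using x d test_functions_DERIV[OF \<phi>]
    by (intro integral_FTC_Icc)
      (auto simp: has_real_derivative_iff_has_vector_derivative[symmetric] intro: has_field_derivative_at_within)
  also have "(LINT y|lborel. indicator {0..x} y *\<^sub>R deriv \<phi> y) = (LINT y|lborel. indicator {0<..<x} y * deriv \<phi> y)"
  proof (rule integral_cong_AE)
    show "AE y in lborel. indicator {0..x} y *\<^sub>R deriv \<phi> y = indicator {0<..<x} y * deriv \<phi> y"
      using AE_lborel_singleton[of 0] AE_lborel_singleton[of x]
      by eventually_elim (auto simp: indicator_def)
  qed (use test_functions_measurable[OF test_functions_deriv[OF \<phi>]] in measurable)
  finally show ?thesis using ab(2)[of 0] ab(1) by simp
qed

text \<open>\<open>h\<close> may fail to be integrable near 0, but its tail integral is integrable: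
  by Fubini the mass of the tail is controlled by that of x h(x), which the space provides. Choosing
  for \<open>\<psi>\<close> the derivative of a test function shows that the tail is a
  primitive.\<close>

lemma is_primitive_tail:
  assumes h: "h \<in> X_0 \<mu>" and \<mu>: "\<mu> > 0"
  defines "\<eta> \<equiv> \<lambda>y. indicator {0<..} y * h y"
    and "T \<equiv> \<lambda>y. indicator {0<..} y * tail_integral h y"
  shows "\<eta> \<in> borel_measurable borel" "integrable lborel (\<lambda>y. y * \<eta> y)"
    "sqint (wmeas \<mu>) (\<lambda>y. y * \<eta> y)"
    "is_primitive T (distr_of h)"
    "\<And>\<psi> B. \<psi> \<in> borel_measurable borel \<Longrightarrow> (\<And>y. \<bar>\<psi> y\<bar> \<le> B) \<Longrightarrow>
      (LINT y|lborel. T y * \<psi> y) = (LINT x|lborel. \<eta> x * (LINT y|lborel. indicator {0<..<x} y * \<psi> y))"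
proof -
  have L: "(\<lambda>y. y * h y) \<in> L2_exp \<mu>" using h by (simp add: X_0_def)
  have eq: "(\<lambda>y. indicator {0<..} y * (y * h y)) = (\<lambda>y. y * \<eta> y)" by (auto simp: \<eta>_def fun_eq_iff)
  show i: "integrable lborel (\<lambda>y. y * \<eta> y)" and "sqint (wmeas \<mu>) (\<lambda>y. y * \<eta> y)"
    using L2_exp_sqint[OF L \<mu>] unfolding eq by auto
  have "(\<lambda>y. inverse y * (y * \<eta> y)) \<in> borel_measurable borel"
    using borel_measurable_integrable[OF i] by measurable
  also have "(\<lambda>y. inverse y * (y * \<eta> y)) = \<eta>" by (auto simp: fun_eq_iff \<eta>_def indicator_def)
  finally show m[measurable]: "\<eta> \<in> borel_measurable borel" .
  have z: "\<eta> x = 0" if "x \<le> 0" for x using that by (simp add: \<eta>_def)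
  have T_eq: "T = (\<lambda>y. indicator {0<..} y * (LINT x|lborel. indicator {y<..} x * \<eta> x))"
  proof
    fix y
    have "(\<lambda>x. indicator {y<..} x * h x) = (\<lambda>x. indicator {y<..} x * \<eta> x)" if "y > 0"
      using that by (auto simp: fun_eq_iff \<eta>_def indicator_def)
    then show "T y = indicator {0<..} y * (LINT x|lborel. indicator {y<..} x * \<eta> x)"
      by (cases "y > 0") (simp_all add: T_def tail_integral_def set_lebesgue_integral_def)
  qed
  show F: "(LINT y|lborel. T y * \<psi> y) = (LINT x|lborel. \<eta> x * (LINT y|lborel. indicator {0<..<x} y * \<psi> y))"
    if "\<psi> \<in> borel_measurable borel" "\<And>y. \<bar>\<psi> y\<bar> \<le> B" for \<psi> B
    unfolding T_eq by (rule tail_fubini(2)[OF m _ i]) (use that z in auto)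
  have Ti: "integrable lborel T" unfolding T_eq by (rule tail_fubini(1)[OF m _ i, of "\<lambda>_. 0" 0]) (use z in auto)
  have "(LINT y|lborel. T y * deriv \<phi> y) = distr_of h \<phi>" if \<phi>: "\<phi> \<in> test_functions" for \<phi>
  proof -
    have d: "deriv \<phi> \<in> test_functions" using \<phi> by (rule test_functions_deriv)
    obtain B where B: "\<And>x. \<bar>deriv \<phi> x\<bar> \<le> B" using test_functions_bounded[OF d] by metis
    have "(LINT y|lborel. T y * deriv \<phi> y) = (LINT x|lborel. \<eta> x * (LINT y|lborel. indicator {0<..<x} y * deriv \<phi> y))"
      by (rule F[OF test_functions_measurable[OF d] B])
    also have "\<dots> = (LINT x|lborel. \<eta> x * \<phi> x)"
    proof (rule Bochner_Integration.integral_cong[OF refl])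
      fix x show "\<eta> x * (LINT y|lborel. indicator {0<..<x} y * deriv \<phi> y) = \<eta> x * \<phi> x"
        using test_FTC_from_0[OF \<phi>, of x] z[of x] by (cases "x \<le> 0") auto
    qed
    also have "\<dots> = distr_of h \<phi>"
      using \<phi> by (simp add: distr_of_def set_LINT_halfline \<eta>_def mult.assoc)
    finally show ?thesis .
  qed
  then show "is_primitive T (distr_of h)" unfolding is_primitive_def
    using Ti by (auto simp: T_def distr_of_def fun_eq_iff)
qed

lemma g_profile_integrable:
  assumes "\<rho> > 0"
  shows "integrable lborel (\<lambda>z. indicator {0<..} z * g_profile \<rho> z)"
    "\<And>\<sigma>. \<sigma> \<ge> 0 \<Longrightarrow> laplace \<sigma> (\<lambda>z. indicator {0<..} z * g_profile \<rho> z) = 4 / (\<rho> * \<sigma> + 2)"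
proof -
  have eq: "indicator {0<..} z * g_profile \<rho> z = 4 / \<rho> * (indicator {0<..} z * exp (- (2 / \<rho>) * z))" for z
    by (simp add: g_profile_def mult_ac)
  show "integrable lborel (\<lambda>z. indicator {0<..} z * g_profile \<rho> z)"
    unfolding eq using assms by (intro integrable_mult_right exp_integral_halfline) auto
  fix \<sigma> :: real assume \<sigma>: "\<sigma> \<ge> 0"
  have e: "indicator {0<..} z * g_profile \<rho> z * exp (- \<sigma> * z) =
      4 / \<rho> * (indicator {0<..} z * exp (- (\<sigma> + 2 / \<rho>) * z))" for z
    unfolding eq by (simp add: algebra_simps flip: exp_add)
  have pos: "\<sigma> + 2 / \<rho> > 0" using assms \<sigma> by (simp add: add_nonneg_pos)
  have "laplace \<sigma> (\<lambda>z. indicator {0<..} z * g_profile \<rho> z) = 4 / \<rho> * (1 / (\<sigma> + 2 / \<rho>))"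
    unfolding laplace_def e integral_mult_right_zero exp_integral_halfline(2)[OF pos] ..
  also have "\<dots> = 4 / (\<rho> * \<sigma> + 2)" using assms by (simp add: field_simps)
  finally show "laplace \<sigma> (\<lambda>z. indicator {0<..} z * g_profile \<rho> z) = 4 / (\<rho> * \<sigma> + 2)" .
qed

text \<open>The profile solves g' = -(2/\<rho>) g with g(0) = 4/\<rho>. In other words - (H * g)' =
  - 4/\<rho> H + 2/\<rho> H * g, which explains the two nonlocal terms of the operator: together
  they are minus the derivative of H * g.\<close>

lemma g_profile_by_parts:
  assumes \<phi>: "\<phi> \<in> test_functions" and \<rho>: "\<rho> > 0"
  shows "(LINT z|lborel. indicator {0<..} z * g_profile \<rho> z * deriv \<phi> (x + z)) =
    - 4 / \<rho> * \<phi> x + 2 / \<rho> * (LINT z|lborel. indicator {0<..} z * g_profile \<rho> z * \<phi> (x + z))"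
proof -
  let ?g = "g_profile \<rho>"
  obtain a b where ab: "\<And>y. y \<notin> {a..b} \<Longrightarrow> \<phi> y = 0" "\<And>y. y \<notin> {a..b} \<Longrightarrow> deriv \<phi> y = 0"
    using test_functionsE[OF \<phi>] by metis
  note [measurable] = test_functions_measurable[OF \<phi>] test_functions_measurable[OF test_functions_deriv[OF \<phi>]]
  define c where "c = \<bar>b\<bar> + \<bar>x\<bar> + 1"
  have c: "c > 0" "x + c > b" by (auto simp: c_def)
  let ?F = "\<lambda>z. ?g z * \<phi> (x + z)" and ?f = "\<lambda>z. ?g z * deriv \<phi> (x + z) - 2 / \<rho> * (?g z * \<phi> (x + z))"
  have g': "(?g has_real_derivative - 2 / \<rho> * ?g z) (at z)" for z
    unfolding g_profile_def using \<rho> by (auto intro!: derivative_eq_intros)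
  have \<phi>': "((\<lambda>z. \<phi> (x + z)) has_real_derivative deriv \<phi> (x + z)) (at z)" for z
    by (rule DERIV_chain2[where f=\<phi>, THEN DERIV_cong]) 
      (use test_functions_DERIV[OF \<phi>] in \<open>auto intro!: derivative_eq_intros\<close>)
  have F': "(?F has_real_derivative ?f z) (at z)" for z
    by (rule DERIV_cong[OF DERIV_mult[OF g' \<phi>']]) (simp add: algebra_simps)
  have cg: "continuous_on A ?g" for A
    unfolding g_profile_def using \<rho> by (intro continuous_intros) auto
  have c\<phi>: "continuous_on A (\<lambda>z. \<phi> (x + z))" "continuous_on A (\<lambda>z. deriv \<phi> (x + z))" for A
    by (auto intro!: continuous_on_compose2[OF test_functions_continuous[OF \<phi>, of UNIV]]
        continuous_on_compose2[OF test_functions_continuous[OF test_functions_deriv[OF \<phi>], of UNIV]] continuous_intros)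
  have "(LINT z|lborel. indicator {0..c} z *\<^sub>R ?f z) = ?F c - ?F 0"
  proof (rule integral_FTC_Icc)
    show "continuous_on {0..c} ?f" using cg c\<phi> by (intro continuous_intros)
  qed (use c F' in \<open>auto simp: has_real_derivative_iff_has_vector_derivative[symmetric] intro: has_field_derivative_at_within\<close>)
  also have "?F c - ?F 0 = - 4 / \<rho> * \<phi> x" using ab(1)[of "x + c"] c by (simp add: g_profile_def)
  also have "(LINT z|lborel. indicator {0..c} z *\<^sub>R ?f z) = (LINT z|lborel. indicator {0<..} z * ?f z)"
  proof (rule integral_cong_AE)
    show "AE z in lborel. indicator {0..c} z *\<^sub>R ?f z = indicator {0<..} z * ?f z"
      using AE_lborel_singleton[of 0]
    proof eventually_elim
      fix z :: real assume "z \<noteq> 0"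
      then show "indicator {0..c} z *\<^sub>R ?f z = indicator {0<..} z * ?f z"
        using ab[of "x + z"] c by (cases "z \<le> c") (auto simp: indicator_def)
    qed
  qed (auto simp: g_profile_def)
  also have "\<dots> = (LINT z|lborel. indicator {0<..} z * ?g z * deriv \<phi> (x + z)
      - 2 / \<rho> * (indicator {0<..} z * ?g z * \<phi> (x + z)))"
    by (simp add: algebra_simps)
  also have "\<dots> = (LINT z|lborel. indicator {0<..} z * ?g z * deriv \<phi> (x + z))
      - 2 / \<rho> * (LINT z|lborel. indicator {0<..} z * ?g z * \<phi> (x + z))"
  proof -
    have "integrable lborel (\<lambda>z. indicator {0<..} z * ?g z * \<psi> (x + z))" if \<psi>: "\<psi> \<in> test_functions" for \<psi>
    proof -
      obtain B where B: "\<And>x. \<bar>\<psi> x\<bar> \<le> B" using test_functions_bounded[OF \<psi>] by metis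
      note [measurable] = test_functions_measurable[OF \<psi>]
      show ?thesis by (rule integrable_mult_bounded[OF g_profile_integrable(1)[OF \<rho>] _ B]) measurable
    qed
    from this[OF \<phi>] this[OF test_functions_deriv[OF \<phi>]] show ?thesis by simp
  qed
  finally show ?thesis by simp
qed

text \<open>With h = - T' one has y h' = (y h)' - h = - (- y h - T)', and the nonlocal terms are -
  (T * g)'. Hence the primitive is - y h - T + T * g.\<close>

lemma coag_L_primitive:
  assumes h: "h \<in> X_0 \<mu>" and \<mu>: "\<mu> > 0" and \<rho>: "\<rho> > 0"
  defines "\<eta> \<equiv> \<lambda>y. indicator {0<..} y * h y"
    and "T \<equiv> \<lambda>y. indicator {0<..} y * tail_integral h y"
    and "k \<equiv> \<lambda>z. indicator {0<..} z * g_profile \<rho> z"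
  shows "is_primitive (\<lambda>y. - (y * \<eta> y) - T y + (LINT x|lborel. T x * k (y - x))) (coag_L \<rho> h)"
proof -
  let ?C = "\<lambda>y. LINT x|lborel. T x * k (y - x)"
  note tail = is_primitive_tail[OF h \<mu>, folded \<eta>_def T_def]
  have t2: "integrable lborel (\<lambda>y. y * \<eta> y)" unfolding \<eta>_def by (rule is_primitive_tail(2)[OF h \<mu>])
  have Ti: "integrable lborel T" using tail(4) by (simp add: is_primitive_def)
  have T0: "T y = 0" if "y \<le> 0" for y using that by (simp add: T_def)
  have ki: "integrable lborel k" unfolding k_def using \<rho> by (rule g_profile_integrable)
  have Ci: "integrable lborel ?C" using convolution_fubini(1)[OF Ti ki, of "\<lambda>_. 0" 0] by simp
  have C0: "?C y = 0" if "y \<le> 0" for y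
  proof -
    have "(\<lambda>x. T x * k (y - x)) = (\<lambda>x. 0)"
      using that by (auto simp: fun_eq_iff T_def k_def indicator_def)
    then show ?thesis by simp
  qed
  have C_eq: "indicator {0<..} y * convolution (tail_integral h) (g_profile \<rho>) y = ?C y" for y
  proof (cases "y > 0")
    case True
    have "(\<lambda>x. indicator {0<..<y} x *\<^sub>R (tail_integral h x * g_profile \<rho> (y - x))) = (\<lambda>x. T x * k (y - x))"
      using True by (auto simp: fun_eq_iff T_def k_def indicator_def)
    then show ?thesis using True by (simp add: convolution_def set_lebesgue_integral_def)
  qed (simp add: C0)
  let ?W = "\<lambda>y. - (y * \<eta> y) - T y + ?C y"
  have "(LINT y|lborel. ?W y * deriv \<phi> y) = coag_L \<rho> h \<phi>" if \<phi>: "\<phi> \<in> test_functions" for \<phi>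
  proof -
    have d: "deriv \<phi> \<in> test_functions" using \<phi> by (rule test_functions_deriv)
    have y\<phi>: "(\<lambda>y. y * \<phi> y) \<in> test_functions" using \<phi> by (rule test_functions_mult_ident)
    have dy\<phi>: "deriv (\<lambda>y. y * \<phi> y) y = \<phi> y + y * deriv \<phi> y" for y
      by (rule DERIV_imp_deriv) (auto intro!: derivative_eq_intros test_functions_DERIV[OF \<phi>])
    obtain a b where ab: "0 < a" "\<And>y. y \<notin> {a..b} \<Longrightarrow> \<phi> y = 0"
      using test_functionsE[OF \<phi>] by metis
    have bnd: "\<exists>B. \<forall>x. \<bar>\<psi> x\<bar> \<le> B" if "\<psi> \<in> test_functions" for \<psi>
      using test_functions_bounded[OF that] by metis
    obtain B1 where B1: "\<And>x. \<bar>\<phi> x\<bar> \<le> B1" using bnd[OF \<phi>] by blast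
    obtain B2 where B2: "\<And>x. \<bar>deriv \<phi> x\<bar> \<le> B2" using bnd[OF d] by blast
    note [measurable] = test_functions_measurable[OF \<phi>] test_functions_measurable[OF d] tail(1)
    \<comment> \<open>\<open>\<eta>\<close> need not be integrable at 0, but the support of \<phi>
      starts at a > 0, so |\<phi>(y)| \<le> (B1 / a) y and the weighted integrability
      suffices.\<close>
    have \<eta>\<phi>: "integrable lborel (\<lambda>y. \<eta> y * \<phi> y)"
    proof (rule Bochner_Integration.integrable_bound[OF integrable_mult_right[OF t2, of "B1 / a"]])
      show "AE y in lborel. norm (\<eta> y * \<phi> y) \<le> norm (B1 / a * (y * \<eta> y))"
      proof (rule AE_I2)
        fix y show "norm (\<eta> y * \<phi> y) \<le> norm (B1 / a * (y * \<eta> y))"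
        proof (cases "y \<ge> a")
          case True
          have "\<bar>\<phi> y\<bar> * 1 \<le> B1 * (y / a)"
            using True ab(1) B1[of y] B1[of 0] by (intro mult_mono) auto
          then have "\<bar>\<phi> y\<bar> \<le> \<bar>B1 * (y / a)\<bar>" by linarith
          then have "\<bar>\<eta> y\<bar> * \<bar>\<phi> y\<bar> \<le> \<bar>\<eta> y\<bar> * \<bar>B1 * (y / a)\<bar>" by (rule mult_left_mono) simp
          then show ?thesis by (simp add: abs_mult mult_ac)
        qed (use ab(2)[of y] in auto)
      qed
    qed measurable
    have \<eta>d: "integrable lborel (\<lambda>y. y * \<eta> y * deriv \<phi> y)"
      by (rule integrable_mult_bounded[OF t2 _ B2]) measurable
    have e1: "distr_mult (\<lambda>y. y) (distr_deriv (distr_of h)) \<phi> =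
        - (LINT y|lborel. \<eta> y * \<phi> y) - (LINT y|lborel. y * \<eta> y * deriv \<phi> y)"
    proof -
      have "distr_mult (\<lambda>y. y) (distr_deriv (distr_of h)) \<phi> = - distr_of h (deriv (\<lambda>y. y * \<phi> y))"
        using \<phi> y\<phi> by (simp add: distr_mult_def distr_deriv_def)
      also have "\<dots> = - (LINT y|lborel. \<eta> y * \<phi> y + y * \<eta> y * deriv \<phi> y)"
        using test_functions_deriv[OF y\<phi>]
        by (simp add: distr_of_def set_LINT_halfline \<eta>_def dy\<phi> algebra_simps)
      finally show ?thesis using \<eta>\<phi> \<eta>d by simp
    qed
    have e2: "distr_of (tail_integral h) \<phi> = (LINT y|lborel. T y * \<phi> y)"
      using \<phi> by (simp add: distr_of_def set_LINT_halfline T_def mult.assoc)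
    have e3: "distr_of (convolution (tail_integral h) (g_profile \<rho>)) \<phi> = (LINT y|lborel. ?C y * \<phi> y)"
      using \<phi> by (simp add: distr_of_def set_LINT_halfline C_eq flip: mult.assoc)
    have e4: "(LINT y|lborel. T y * deriv \<phi> y) = (LINT y|lborel. \<eta> y * \<phi> y)"
    proof -
      have "distr_of h \<phi> = (LINT y|lborel. T y * deriv \<phi> y)"
        using tail(4) \<phi> unfolding is_primitive_def by (metis (no_types, lifting))
      moreover have "distr_of h \<phi> = (LINT y|lborel. \<eta> y * \<phi> y)"
        using \<phi> by (simp add: distr_of_def set_LINT_halfline \<eta>_def mult.assoc)
      ultimately show ?thesis by simp
    qed
    have e5: "(LINT y|lborel. ?C y * deriv \<phi> y) = - 4 / \<rho> * (LINT y|lborel. T y * \<phi> y) + 2 / \<rho> * (LINT y|lborel. ?C y * \<phi> y)"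
    proof -
      have "(LINT y|lborel. ?C y * deriv \<phi> y) = (LINT x|lborel. T x * (LINT z|lborel. k z * deriv \<phi> (x + z)))"
        by (rule convolution_fubini(2)[OF Ti ki _ B2]) measurable
      also have "\<dots> = (LINT x|lborel. - 4 / \<rho> * (T x * \<phi> x) + 2 / \<rho> * (T x * (LINT z|lborel. k z * \<phi> (x + z))))"
        unfolding k_def g_profile_by_parts[OF \<phi> \<rho>] by (simp add: algebra_simps)
      also have "\<dots> = - 4 / \<rho> * (LINT x|lborel. T x * \<phi> x) + 2 / \<rho> * (LINT x|lborel. T x * (LINT z|lborel. k z * \<phi> (x + z)))"
      proof -
        have "(\<lambda>x. LINT z|lborel. k z * \<phi> (x + z)) \<in> borel_measurable borel"
          using borel_measurable_integrable[OF ki] by measurable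
        moreover have "\<bar>LINT z|lborel. k z * \<phi> (x + z)\<bar> \<le> (LINT z|lborel. \<bar>k z\<bar> * B1)" for x
        proof -
          have "integrable lborel (\<lambda>z. k z * \<phi> (x + z))"
            by (rule integrable_mult_bounded[OF ki _ B1]) measurable
          moreover have "integrable lborel (\<lambda>z. \<bar>k z\<bar> * B1)"
            using ki by (intro integrable_mult_left integrable_abs)
          ultimately have "(LINT z|lborel. norm (k z * \<phi> (x + z))) \<le> (LINT z|lborel. \<bar>k z\<bar> * B1)"
            using B1 by (intro integral_mono integrable_norm) (auto simp: abs_mult intro: mult_left_mono)
          from order_trans[OF integral_norm_bound this] show ?thesis by simp
        qed
        ultimately have "integrable lborel (\<lambda>x. T x * (LINT z|lborel. k z * \<phi> (x + z)))"
          by (rule integrable_mult_bounded[OF Ti])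
        then show ?thesis using integrable_mult_test[OF Ti \<phi>] by simp
      qed
      also have "(LINT x|lborel. T x * (LINT z|lborel. k z * \<phi> (x + z))) = (LINT y|lborel. ?C y * \<phi> y)"
        by (rule convolution_fubini(2)[OF Ti ki _ B1, symmetric]) measurable
      finally show ?thesis .
    qed
    have "(LINT y|lborel. ?W y * deriv \<phi> y) =
        (LINT y|lborel. - (y * \<eta> y * deriv \<phi> y) - T y * deriv \<phi> y + ?C y * deriv \<phi> y)"
      by (simp add: algebra_simps)
    also have "\<dots> = - (LINT y|lborel. y * \<eta> y * deriv \<phi> y) - (LINT y|lborel. T y * deriv \<phi> y) + (LINT y|lborel. ?C y * deriv \<phi> y)"
      using \<eta>d integrable_mult_test[OF Ti d] integrable_mult_test[OF Ci d] by simp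
    also have "\<dots> = coag_L \<rho> h \<phi>"
      unfolding coag_L_def Let_def e1 e2 e3 e4 e5 by simp
    finally show ?thesis .
  qed
  moreover have "coag_L \<rho> h \<phi> = 0" if "\<phi> \<notin> test_functions" for \<phi>
    using that by (simp add: coag_L_def Let_def distr_mult_def distr_of_def)
  ultimately show ?thesis unfolding is_primitive_def
    using t2 Ti Ci T0 C0 by (auto simp: fun_eq_iff \<eta>_def)
qed

section \<open>The Laplace transform of the generator\<close>

text \<open>The integrand is the derivative of y exp(-\<sigma> y). Used as \<open>\<psi>\<close> in
  Fubini for tails, it expresses the transform of y h(y) through the primitive alone.\<close>

lemma laplace_weight_integral:
  fixes \<sigma> x :: real
  assumes "x > 0"
  shows "(LINT y|lborel. indicator {0<..<x} y * (indicator {0<..} y * ((1 - \<sigma> * y) * exp (- \<sigma> * y)))) = x * exp (- \<sigma> * x)"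
proof -
  have "(LINT y|lborel. indicator {0..x} y *\<^sub>R ((1 - \<sigma> * y) * exp (- \<sigma> * y))) = x * exp (- \<sigma> * x) - 0 * exp (- \<sigma> * 0)"
  proof (rule integral_FTC_Icc)
    show "continuous_on {0..x} (\<lambda>y. (1 - \<sigma> * y) * exp (- \<sigma> * y))" by (intro continuous_intros)
    fix y
    have "((\<lambda>y. y * exp (- \<sigma> * y)) has_real_derivative (1 - \<sigma> * y) * exp (- \<sigma> * y)) (at y)"
      by (auto intro!: derivative_eq_intros simp: algebra_simps)
    then show "((\<lambda>y. y * exp (- \<sigma> * y)) has_vector_derivative (1 - \<sigma> * y) * exp (- \<sigma> * y)) (at y within {0..x})"
      by (auto simp: has_real_derivative_iff_has_vector_derivative[symmetric] intro: has_field_derivative_at_within)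
  qed (use assms in simp)
  also have "(LINT y|lborel. indicator {0..x} y *\<^sub>R ((1 - \<sigma> * y) * exp (- \<sigma> * y))) =
      (LINT y|lborel. indicator {0<..<x} y * (indicator {0<..} y * ((1 - \<sigma> * y) * exp (- \<sigma> * y))))"
  proof (rule integral_cong_AE)
    show "AE y in lborel. indicator {0..x} y *\<^sub>R ((1 - \<sigma> * y) * exp (- \<sigma> * y)) =
        indicator {0<..<x} y * (indicator {0<..} y * ((1 - \<sigma> * y) * exp (- \<sigma> * y)))"
      using AE_lborel_singleton[of 0] AE_lborel_singleton[of x]
      by eventually_elim (auto simp: indicator_def)
  qed auto
  finally show ?thesis by simp
qed

text \<open>The terms - y h, - H and H * g contribute - l + \<sigma> m, - l and 4/(\<rho> \<sigma> +
  2) l, where m is the transform of y H(y). Since m is minus the \<sigma>-derivative of l, the term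
  \<sigma> m is the transport term.\<close>

lemma laplace_coag_L:
  assumes h: "h \<in> X_0 \<mu>" and \<mu>: "\<mu> > 0" and \<rho>: "\<rho> > 0" and \<sigma>: "\<sigma> \<ge> 0"
    and H: "is_primitive H (distr_of h)" "sqint (wmeas \<mu>) H" and W: "is_primitive W (coag_L \<rho> h)"
  shows "laplace \<sigma> W = (4 / (\<rho> * \<sigma> + 2) - 2) * laplace \<sigma> H + \<sigma> * (LINT y|lborel. H y * y * exp (- \<sigma> * y))"
proof -
  define \<eta> where "\<eta> = (\<lambda>y. indicator {0<..} y * h y)"
  define T where "T = (\<lambda>y. indicator {0<..} y * tail_integral h y)"
  define k where "k = (\<lambda>z. indicator {0<..} z * g_profile \<rho> z)"
  let ?C = "\<lambda>y. LINT x|lborel. T x * k (y - x)"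
  note tail = is_primitive_tail[OF h \<mu>, folded \<eta>_def T_def]
  have t2: "integrable lborel (\<lambda>y. y * \<eta> y)" unfolding \<eta>_def by (rule is_primitive_tail(2)[OF h \<mu>])
  have [measurable]: "H \<in> borel_measurable borel" using H(2) by (auto dest: sqintD)
  have H0: "H y = 0" if "y \<le> 0" for y using H(1) that by (simp add: is_primitive_def)
  have Ti: "integrable lborel T" using tail(4) by (simp add: is_primitive_def)
  have [measurable]: "T \<in> borel_measurable borel" using borel_measurable_integrable[OF Ti] by simp
  have T0: "T y = 0" if "y \<le> 0" for y using that by (simp add: T_def)
  have k0: "k y = 0" if "y \<le> 0" for y using that by (simp add: k_def)
  have ki: "integrable lborel k" unfolding k_def using \<rho> by (rule g_profile_integrable)
  have Ci: "integrable lborel ?C" using convolution_fubini(1)[OF Ti ki, of "\<lambda>_. 0" 0] by simp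
  have C0: "?C y = 0" if "y \<le> 0" for y
  proof -
    have "(\<lambda>x. T x * k (y - x)) = (\<lambda>x. 0)"
      using that by (auto simp: fun_eq_iff T_def k_def indicator_def)
    then show ?thesis by simp
  qed
  have TH: "AE y in lborel. T y = H y" by (rule is_primitive_unique[OF tail(4) H(1)])
  let ?W = "\<lambda>y. - (y * \<eta> y) - T y + ?C y"
  have Wp: "is_primitive ?W (coag_L \<rho> h)"
    using coag_L_primitive[OF h \<mu> \<rho>] by (simp add: \<eta>_def T_def k_def)
  have "AE y in lborel. W y = ?W y" by (rule is_primitive_unique[OF W Wp])
  then have "laplace \<sigma> W = laplace \<sigma> ?W"
    using W Wp by (intro laplace_cong_AE) (auto simp: is_primitive_def dest!: borel_measurable_integrable)
  also have "\<dots> = - laplace \<sigma> (\<lambda>y. y * \<eta> y) - laplace \<sigma> T + laplace \<sigma> ?C"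
  proof -
    have "integrable lborel (\<lambda>y. y * \<eta> y * exp (- \<sigma> * y))"
      using integrable_laplace[of "\<lambda>y. y * \<eta> y" \<sigma>] t2 \<sigma> by (simp add: \<eta>_def)
    moreover note integrable_laplace[OF Ti T0 \<sigma>] integrable_laplace[OF Ci C0 \<sigma>]
    moreover have "(\<lambda>y. ?W y * exp (- \<sigma> * y)) =
        (\<lambda>y. - (y * \<eta> y * exp (- \<sigma> * y)) - T y * exp (- \<sigma> * y) + ?C y * exp (- \<sigma> * y))"
      by (simp add: fun_eq_iff algebra_simps)
    ultimately show ?thesis unfolding laplace_def by simp
  qed
  also have "laplace \<sigma> ?C = laplace \<sigma> T * (4 / (\<rho> * \<sigma> + 2))"
    using laplace_convolution[OF Ti T0 ki k0 \<sigma>] g_profile_integrable(2)[OF \<rho> \<sigma>]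
    by (simp add: k_def)
  also have "laplace \<sigma> T = laplace \<sigma> H" using TH by (rule laplace_cong_AE) auto
  also have "laplace \<sigma> (\<lambda>y. y * \<eta> y) = laplace \<sigma> H - \<sigma> * (LINT y|lborel. H y * y * exp (- \<sigma> * y))"
  proof -
    let ?\<psi> = "\<lambda>y. indicator {0<..} y * ((1 - \<sigma> * y) * exp (- \<sigma> * y))"
    have b: "\<bar>?\<psi> y\<bar> \<le> 2" for y
    proof (cases "y > 0")
      case True
      have "\<sigma> * y * exp (- (\<sigma> * y)) \<le> 1"
      proof -
        have "\<sigma> * y \<le> exp (\<sigma> * y)" using exp_ge_add_one_self[of "\<sigma> * y"] by linarith
        then show ?thesis by (simp add: exp_minus field_simps)
      qed
      moreover have "exp (- (\<sigma> * y)) \<le> 1" "0 \<le> \<sigma> * y * exp (- (\<sigma> * y))" using True \<sigma> by auto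
      ultimately have "\<bar>(1 - \<sigma> * y) * exp (- (\<sigma> * y))\<bar> \<le> 2"
        using exp_gt_zero[of "- (\<sigma> * y)"] unfolding left_diff_distrib by linarith
      then show ?thesis using True by simp
    qed simp
    have "laplace \<sigma> (\<lambda>y. y * \<eta> y) = (LINT x|lborel. \<eta> x * (LINT y|lborel. indicator {0<..<x} y * ?\<psi> y))"
      unfolding laplace_def
    proof (rule Bochner_Integration.integral_cong[OF refl])
      fix x show "x * \<eta> x * exp (- \<sigma> * x) = \<eta> x * (LINT y|lborel. indicator {0<..<x} y * ?\<psi> y)"
        using laplace_weight_integral[of x \<sigma>] by (cases "x > 0") (auto simp: \<eta>_def)
    qed
    also have "\<dots> = (LINT y|lborel. T y * ?\<psi> y)" unfolding T_def \<eta>_def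
      by (rule is_primitive_tail(5)[OF h \<mu> _ b, symmetric]) measurable
    also have "\<dots> = (LINT y|lborel. H y * ?\<psi> y)"
      using TH by (intro integral_cong_AE) (auto elim: AE_mp)
    also have "\<dots> = (LINT y|lborel. H y * exp (- \<sigma> * y) - \<sigma> * (H y * y * exp (- \<sigma> * y)))"
    proof (rule Bochner_Integration.integral_cong[OF refl])
      fix y show "H y * ?\<psi> y = H y * exp (- \<sigma> * y) - \<sigma> * (H y * y * exp (- \<sigma> * y))"
        using H0[of y] by (cases "y > 0") (auto simp: algebra_simps)
    qed
    also have "\<dots> = laplace \<sigma> H - \<sigma> * (LINT y|lborel. H y * y * exp (- \<sigma> * y))"
    proof -
      have "integrable lborel (\<lambda>y. H y * exp (- \<sigma> * y))"
        using integrable_laplace[OF moment_integrable(1)[OF H(2) H0 \<mu>] H0 \<sigma>] .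
      moreover have "integrable lborel (\<lambda>y. H y * y * exp (- \<sigma> * y))"
        by (rule integrable_laplace[OF moment_integrable(2)[OF H(2) H0 \<mu>] _ \<sigma>]) (use H0 in auto)
      ultimately show ?thesis by (simp add: laplace_def)
    qed
    finally show ?thesis .
  qed
  finally show ?thesis by (simp add: algebra_simps)
qed

section \<open>Evolution of the Laplace transform\<close>

text \<open>In the variable x = exp(-y) in (0,1), the transforms at \<sigma> = k + 1 are the moments
  of order k of D = f exp(-y). All of them vanish, so by Weierstrass \<open>D\<close> annihilates
  continuous functions of x and, in the limit, indicators of intervals. The extra factor exp(-y)
  keeps the moment k = 0 at a positive argument.\<close>

lemma Lerch:
  fixes f :: "real \<Rightarrow> real"
  assumes f: "integrable lborel f" and f0: "\<And>y. y \<le> 0 \<Longrightarrow> f y = 0"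
    and L: "\<And>\<sigma>. \<sigma> > 0 \<Longrightarrow> laplace \<sigma> f = 0"
  shows "AE y in lborel. f y = 0"
proof -
  define D where "D y = f y * exp (- 1 * y)" for y
  have D: "integrable lborel D" unfolding D_def using integrable_laplace[OF f f0, of 1] by simp
  have D0: "D y = 0" if "y \<le> 0" for y using f0 that by (simp add: D_def)
  have [measurable]: "D \<in> borel_measurable borel" using borel_measurable_integrable[OF D] by simp
  have mono: "integrable lborel (\<lambda>y. D y * exp (- y) ^ k)" "(LINT y|lborel. D y * exp (- y) ^ k) = 0" for k
  proof -
    have eq: "D y * exp (- y) ^ k = f y * exp (- (real k + 1) * y)" for y
      by (simp add: D_def algebra_simps flip: exp_add exp_of_nat_mult)
    show "integrable lborel (\<lambda>y. D y * exp (- y) ^ k)"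
      unfolding eq by (rule integrable_laplace[OF f f0]) auto
    show "(LINT y|lborel. D y * exp (- y) ^ k) = 0"
      unfolding eq using L[of "real k + 1"] by (simp add: laplace_def)
  qed
  define M where "M = (LINT y|lborel. \<bar>D y\<bar>)"
  have cont: "(LINT y|lborel. D y * F (exp (- y))) = 0" if F: "continuous_on UNIV F" for F :: "real \<Rightarrow> real"
  proof -
    have FD: "integrable lborel (\<lambda>y. D y * F (exp (- y)))"
    proof -
      have "bounded (F ` {0..1})"
        using F by (intro compact_imp_bounded compact_continuous_image) (auto intro: continuous_on_subset)
      then obtain B where B: "\<And>x. x \<in> {0..1} \<Longrightarrow> \<bar>F x\<bar> \<le> B"
        unfolding bounded_iff by (metis imageI real_norm_def)
      have [measurable]: "F \<in> borel_measurable borel" using F by (rule borel_measurable_continuous_onI)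
      show ?thesis
      proof (rule Bochner_Integration.integrable_bound[OF integrable_mult_right[OF D, of B]])
        show "AE y in lborel. norm (D y * F (exp (- y))) \<le> norm (B * D y)"
        proof (rule AE_I2)
          fix y show "norm (D y * F (exp (- y))) \<le> norm (B * D y)"
          proof (cases "y \<le> 0")
            case False
            then have "\<bar>F (exp (- y))\<bar> \<le> \<bar>B\<bar>" using B[of "exp (- y)"] by auto
            then show ?thesis using mult_left_mono[of "\<bar>F (exp (- y))\<bar>" "\<bar>B\<bar>" "\<bar>D y\<bar>"]
              by (simp add: abs_mult mult.commute)
          qed (simp add: D0)
        qed
      qed measurable
    qed
    have le: "\<bar>LINT y|lborel. D y * F (exp (- y))\<bar> \<le> e * M" if e: "e > 0" for e
    proof -
      obtain g where g: "real_polynomial_function g" "\<And>x. x \<in> {0..1} \<Longrightarrow> \<bar>F x - g x\<bar> < e"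
        using Stone_Weierstrass_real_polynomial_function[of "{0..1}" F e] e F
        by (auto intro: continuous_on_subset)
      then obtain a n where gs: "g = (\<lambda>x. \<Sum>i\<le>n. a i * x ^ i)"
        unfolding real_polynomial_function_iff_sum by blast
      have gi: "integrable lborel (\<lambda>y. D y * g (exp (- y)))" and g0: "(LINT y|lborel. D y * g (exp (- y))) = 0"
      proof -
        have eq: "D y * g (exp (- y)) = (\<Sum>i\<le>n. a i * (D y * exp (- y) ^ i))" for y
          by (simp add: gs sum_distrib_left mult_ac)
        show "integrable lborel (\<lambda>y. D y * g (exp (- y)))"
          unfolding eq using mono(1) by (intro Bochner_Integration.integrable_sum integrable_mult_right)
        show "(LINT y|lborel. D y * g (exp (- y))) = 0"
          unfolding eq using mono by (subst Bochner_Integration.integral_sum) (auto simp del: exp_of_nat_mult)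
      qed
      have "(LINT y|lborel. D y * F (exp (- y))) = (LINT y|lborel. D y * F (exp (- y)) - D y * g (exp (- y)))"
        using FD gi g0 by simp
      also have "\<bar>\<dots>\<bar> \<le> (LINT y|lborel. norm (D y * F (exp (- y)) - D y * g (exp (- y))))"
        using integral_norm_bound[of lborel "\<lambda>y. D y * F (exp (- y)) - D y * g (exp (- y))"] by simp
      also have "\<dots> \<le> (LINT y|lborel. e * \<bar>D y\<bar>)"
      proof (rule integral_mono)
        fix y show "norm (D y * F (exp (- y)) - D y * g (exp (- y))) \<le> e * \<bar>D y\<bar>"
        proof (cases "y \<le> 0")
          case False
          then have "\<bar>F (exp (- y)) - g (exp (- y))\<bar> \<le> e" using g(2)[of "exp (- y)"] by auto
          then show ?thesis using mult_left_mono[of "\<bar>F (exp (- y)) - g (exp (- y))\<bar>" e "\<bar>D y\<bar>"]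
            by (simp add: abs_mult mult.commute flip: right_diff_distrib)
        qed (simp add: D0)
      qed (use FD gi D in auto)
      finally show ?thesis by (simp add: M_def)
    qed
    have "\<bar>LINT y|lborel. D y * F (exp (- y))\<bar> \<le> 0"
    proof (rule field_le_epsilon)
      fix e :: real assume "e > 0"
      have M: "M \<ge> 0" by (simp add: M_def)
      have "\<bar>LINT y|lborel. D y * F (exp (- y))\<bar> \<le> e / (M + 1) * M"
        using \<open>e > 0\<close> M by (intro le) auto
      also have "\<dots> \<le> e" using \<open>e > 0\<close> M by (simp add: field_simps)
      finally show "\<bar>LINT y|lborel. D y * F (exp (- y))\<bar> \<le> 0 + e" by simp
    qed
    then show ?thesis by simp
  qed
  have "AE y in lborel. D y = 0"
  proof (rule AE_zero_if_interval_integrals_zero[OF D D0])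
    fix a b :: real assume ab: "0 < a" "a < b"
    define c where "c n x = max 0 (min 1 (real n * x))" for n x
    have c1: "0 \<le> c n x" "c n x \<le> 1" for n x by (auto simp: c_def)
    have lim: "(\<lambda>n. c n x) \<longlonglongrightarrow> (if x > 0 then 1 else 0)" for x
    proof (rule tendsto_eventually)
      obtain m0 :: nat where m0: "x > 0 \<Longrightarrow> 1 / x \<le> real m0" using real_arch_simple by blast
      show "\<forall>\<^sub>F n in sequentially. c n x = (if x > 0 then 1 else 0)"
      proof (rule eventually_sequentiallyI[of m0])
        fix n assume n: "m0 \<le> n"
        show "c n x = (if x > 0 then 1 else 0)"
        proof (cases "x > 0")
          case True
          then have "1 / x \<le> real n" using m0 n by linarith
          then have "1 \<le> real n * x" using True by (simp add: field_simps)
          then show ?thesis using True by (simp add: c_def)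
        next
          case False
          then have "real n * x \<le> 0" by (simp add: mult_nonneg_nonpos)
          then show ?thesis using False by (simp add: c_def)
        qed
      qed
    qed
    \<comment> \<open>Tends to the indicator of exp(-b) < x \<le> exp(-a), that is of (a, b) in y up
      to endpoints. The order of a and b is reversed by x = exp(-y).\<close>
    define F where "F n x = c n (x - exp (- b)) - c n (x - exp (- a))" for n x
    have Fc: "continuous_on UNIV (F n)" for n unfolding F_def c_def by (intro continuous_intros)
    have F1: "\<bar>F n x\<bar> \<le> 1" for n x
      using c1[of n "x - exp (- b)"] c1[of n "x - exp (- a)"] by (auto simp: F_def)
    have [measurable]: "F n \<in> borel_measurable borel" for n
      using Fc by (rule borel_measurable_continuous_onI)
    have "(\<lambda>n. LINT y|lborel. D y * F n (exp (- y))) \<longlonglongrightarrow> (LINT y|lborel. D y * indicator {a<..b} y)"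
    proof (rule integral_dominated_convergence[where w="\<lambda>y. norm (D y)"])
      show "AE y in lborel. (\<lambda>n. D y * F n (exp (- y))) \<longlonglongrightarrow> D y * indicator {a<..b} y"
        using AE_lborel_singleton[of a] AE_lborel_singleton[of b]
      proof eventually_elim
        fix y assume y: "y \<noteq> a" "y \<noteq> b"
        have "(\<lambda>n. F n (exp (- y))) \<longlonglongrightarrow> indicator {a<..b} y"
          using tendsto_diff[OF lim[of "exp (- y) - exp (- b)"] lim[of "exp (- y) - exp (- a)"]] ab y
          by (auto simp: F_def indicator_def split: if_splits)
        then show "(\<lambda>n. D y * F n (exp (- y))) \<longlonglongrightarrow> D y * indicator {a<..b} y"
          by (intro tendsto_mult tendsto_const)
      qed
      show "AE y in lborel. norm (D y * F n (exp (- y))) \<le> norm (D y)" for n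
        using F1 by (intro AE_I2) (simp add: abs_mult mult_left_le)
    qed (use D in measurable, use D in auto)
    then have "(\<lambda>n::nat. 0) \<longlonglongrightarrow> (LINT y|lborel. D y * indicator {a<..b} y)"
      using cont[OF Fc] by simp
    then show "(LINT y|lborel. D y * indicator {a<..b} y) = 0"
      using LIMSEQ_const_iff by metis
  qed
  then show ?thesis by (simp add: D_def)
qed

section \<open>Differentiating the Laplace transform\<close>

text \<open>Taylor remainder of exp(-x), uniform on the half-line. Factoring out the exponential at
  the smaller of the two points, which is at most 1, leaves an inequality in the distance
  alone.\<close>

lemma exp_second_order:
  fixes a b :: real
  assumes "a \<ge> 0" "b \<ge> 0"
  shows "\<bar>exp (- b) - exp (- a) + (b - a) * exp (- a)\<bar> \<le> (b - a)\<^sup>2"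
proof (cases "a \<le> b")
  case True
  define d where "d = b - a"
  have d: "d \<ge> 0" using True by (simp add: d_def)
  have e: "exp (- b) - exp (- a) + (b - a) * exp (- a) = exp (- a) * (exp (- d) - 1 + d)"
    by (simp add: d_def algebra_simps flip: exp_add)
  have 1: "exp (- d) - 1 + d \<ge> 0" using exp_ge_add_one_self[of "- d"] by simp
  have "exp (- d) \<le> 1 / (1 + d)"
    using exp_ge_add_one_self[of d] d by (simp add: exp_minus field_simps)
  then have "exp (- d) - 1 + d \<le> d\<^sup>2 / (1 + d)" using d by (simp add: field_simps power2_eq_square)
  also have "\<dots> \<le> d\<^sup>2" using d by (simp add: field_simps)
  finally have 2: "exp (- d) - 1 + d \<le> d\<^sup>2" .
  have "exp (- a) * (exp (- d) - 1 + d) \<le> 1 * d\<^sup>2"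
    using assms 1 2 by (intro mult_mono) auto
  then show ?thesis unfolding e using 1 by (simp add: abs_mult d_def)
next
  case False
  define c where "c = a - b"
  have c: "c > 0" using False by (simp add: c_def)
  have e: "exp (- b) - exp (- a) + (b - a) * exp (- a) = exp (- b) * (1 - exp (- c) - c * exp (- c))"
    by (simp add: c_def algebra_simps flip: exp_add)
  have "(1 + c) * exp (- c) \<le> 1"
    using exp_ge_add_one_self[of c] by (simp add: exp_minus field_simps)
  then have 1: "1 - exp (- c) - c * exp (- c) \<ge> 0" by (simp add: algebra_simps)
  have 2: "1 - exp (- c) \<le> c" using exp_ge_add_one_self[of "- c"] by simp
  then have "c * (1 - exp (- c)) \<le> c * c" using c by (intro mult_left_mono) auto
  with 2 have 3: "1 - exp (- c) - c * exp (- c) \<le> c\<^sup>2" by (simp add: power2_eq_square algebra_simps)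
  have "exp (- b) * (1 - exp (- c) - c * exp (- c)) \<le> 1 * c\<^sup>2"
    using assms 1 3 by (intro mult_mono) auto
  then show ?thesis unfolding e using 1 by (simp add: abs_mult c_def power2_commute)
qed

text \<open>Differentiation under the integral with an explicit remainder (s - \<sigma>)^2 times the
  second absolute moment of f.\<close>

lemma laplace_DERIV:
  fixes f :: "real \<Rightarrow> real"
  assumes f: "sqint (wmeas \<mu>) f" and f0: "\<And>y. y \<le> 0 \<Longrightarrow> f y = 0" and \<mu>: "\<mu> > 0" and \<sigma>: "\<sigma> > 0"
  shows "((\<lambda>s. laplace s f) has_real_derivative - (LINT y|lborel. f y * y * exp (- \<sigma> * y))) (at \<sigma>)"
proof -
  note m = moment_integrable[OF f f0 \<mu>]
  define Q where "Q = (LINT y|lborel. \<bar>f y * y\<^sup>2\<bar>)"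
  define m1 where "m1 = (LINT y|lborel. f y * y * exp (- \<sigma> * y))"
  have bound: "\<bar>laplace s f - laplace \<sigma> f + (s - \<sigma>) * m1\<bar> \<le> (s - \<sigma>)\<^sup>2 * Q" if s: "s > 0" for s
  proof -
    have i: "integrable lborel (\<lambda>y. f y * exp (- s * y))" "integrable lborel (\<lambda>y. f y * exp (- \<sigma> * y))"
      by (rule integrable_laplace[OF m(1) f0]; use s \<sigma> in simp)+
    have i1: "integrable lborel (\<lambda>y. f y * y * exp (- \<sigma> * y))"
      using \<sigma> f0 by (intro integrable_laplace[OF m(2)]) auto
    let ?r = "\<lambda>y. f y * exp (- s * y) - f y * exp (- \<sigma> * y) + (s - \<sigma>) * (f y * y * exp (- \<sigma> * y))"
    have ir: "integrable lborel ?r" using i i1 by auto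
    have e: "laplace s f - laplace \<sigma> f + (s - \<sigma>) * m1 = (LINT y|lborel. ?r y)"
      using i i1 by (simp add: laplace_def m1_def)
    have "\<bar>laplace s f - laplace \<sigma> f + (s - \<sigma>) * m1\<bar> \<le> (LINT y|lborel. norm (?r y))"
      unfolding e using integral_norm_bound[of lborel ?r] by simp
    also have "\<dots> \<le> (LINT y|lborel. (s - \<sigma>)\<^sup>2 * \<bar>f y * y\<^sup>2\<bar>)"
    proof (rule integral_mono)
      fix y show "norm (?r y) \<le> (s - \<sigma>)\<^sup>2 * \<bar>f y * y\<^sup>2\<bar>"
      proof (cases "y \<le> 0")
        case False
        have "?r y = f y * (exp (- (s * y)) - exp (- (\<sigma> * y)) + (s * y - \<sigma> * y) * exp (- (\<sigma> * y)))"
          by (simp add: algebra_simps)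
        then have "norm (?r y) = \<bar>f y\<bar> * \<bar>exp (- (s * y)) - exp (- (\<sigma> * y)) + (s * y - \<sigma> * y) * exp (- (\<sigma> * y))\<bar>"
          by (simp only: real_norm_def abs_mult)
        also have "\<dots> \<le> \<bar>f y\<bar> * (s * y - \<sigma> * y)\<^sup>2"
          using s \<sigma> False by (intro mult_left_mono exp_second_order) auto
        also have "\<dots> = (s - \<sigma>)\<^sup>2 * \<bar>f y * y\<^sup>2\<bar>"
          by (simp add: abs_mult power_mult_distrib flip: left_diff_distrib)
        finally show ?thesis .
      qed (simp add: f0)
    qed (use ir m(3) in auto)
    finally show ?thesis by (simp add: Q_def)
  qed
  have "((\<lambda>s. (laplace s f - laplace \<sigma> f) / (s - \<sigma>) - (- m1)) \<longlongrightarrow> 0) (at \<sigma>)"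
  proof (rule Lim_null_comparison)
    show "((\<lambda>s. \<bar>s - \<sigma>\<bar> * Q) \<longlongrightarrow> 0) (at \<sigma>)" by (auto intro!: tendsto_eq_intros)
    have "eventually (\<lambda>s. s \<in> {0<..} \<and> s \<noteq> \<sigma>) (at \<sigma>)"
      using \<sigma> by (intro eventually_conj eventually_at_in_open') (auto simp: eventually_at_filter)
    then show "\<forall>\<^sub>F s in at \<sigma>. norm ((laplace s f - laplace \<sigma> f) / (s - \<sigma>) - (- m1)) \<le> \<bar>s - \<sigma>\<bar> * Q"
    proof eventually_elim
      fix s assume s: "s \<in> {0<..} \<and> s \<noteq> \<sigma>"
      then have "(laplace s f - laplace \<sigma> f) / (s - \<sigma>) - (- m1) = (laplace s f - laplace \<sigma> f + (s - \<sigma>) * m1) / (s - \<sigma>)"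
        by (simp add: field_simps)
      then have "norm ((laplace s f - laplace \<sigma> f) / (s - \<sigma>) - (- m1)) = \<bar>laplace s f - laplace \<sigma> f + (s - \<sigma>) * m1\<bar> / \<bar>s - \<sigma>\<bar>"
        by (simp only: real_norm_def abs_divide)
      also have "\<dots> \<le> (s - \<sigma>)\<^sup>2 * Q / \<bar>s - \<sigma>\<bar>" using bound[of s] s by (intro divide_right_mono) auto
      also have "(s - \<sigma>)\<^sup>2 * Q / \<bar>s - \<sigma>\<bar> = \<bar>s - \<sigma>\<bar> * Q"
      proof -
        have "A\<^sup>2 * Q / A = A * Q" if "A \<noteq> 0" for A :: real using that by (simp add: power2_eq_square)
        from this[of "\<bar>s - \<sigma>\<bar>"] show ?thesis using s by (simp only: power2_abs) simp
      qed
      finally show "norm ((laplace s f - laplace \<sigma> f) / (s - \<sigma>) - (- m1)) \<le> \<bar>s - \<sigma>\<bar> * Q" .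
    qed
  qed
  then have "((\<lambda>s. (laplace s f - laplace \<sigma> f) / (s - \<sigma>)) \<longlongrightarrow> - m1) (at \<sigma>)"
    by (simp only: Lim_null[symmetric])
  then show ?thesis by (simp add: has_field_derivative_iff m1_def)
qed

text \<open>Along the characteristics \<open>\<sigma>' = \<sigma>\<close> the generator acts on the Laplace transform by
  multiplication with \<open>4 / (\<rho> \<sigma> + 2) - 2\<close>, which is integrated explicitly.\<close>

lemma laplace_evolution:
  assumes \<rho>: "\<rho> > 0" and \<mu>: "\<mu> > 0" and S: "coag_semigroup \<rho> \<mu> S"
    and h: "h \<in> X_0 \<mu>" and t: "t \<ge> 0" and s: "s > 0"
    and G: "is_primitive G (distr_of h)" "sqint (wmeas \<mu>) G"
    and H: "is_primitive H (S t (distr_of h))" "sqint (wmeas \<mu>) H"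
  shows "(1 + \<rho> * (s * exp t) / 2)\<^sup>2 * laplace (s * exp t) H = (1 + \<rho> * s / 2)\<^sup>2 * laplace s G"
proof -
  let ?N = "norm_minus1 \<mu>" and ?X = "X_minus1 \<mu>"
  interpret complete_function_space ?X ?N by (rule complete_X_minus1[OF \<mu>])
  have C0: "C0_semigroup ?X ?N S"
    and gen: "generator_graph ?X ?N S = {(distr_of h, coag_L \<rho> h) | h. h \<in> X_0 \<mu>}"
    using S by (auto simp: coag_semigroup_def)
  define u where "u = distr_of h"
  define v where "v = coag_L \<rho> h"
  have uv: "(u, v) \<in> generator_graph ?X ?N S" using h gen by (auto simp: u_def v_def)
  then have uX: "u \<in> ?X" "v \<in> ?X" by (auto simp: generator_graph_def)
  have uX0: "S 0 u = u" by (rule semigroup_0[OF C0 uX(1)])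
  \<comment> \<open>An arbitrary primitive for each element. By uniqueness the transform
    \<open>l\<close> below does not depend on the choice, hence it is linear.\<close>
  define P where "P w = (SOME H. is_primitive H w \<and> sqint (wmeas \<mu>) H)" for w
  have P: "is_primitive (P w) w" "sqint (wmeas \<mu>) (P w)" if "w \<in> ?X" for w
  proof -
    have "\<exists>H. is_primitive H w \<and> sqint (wmeas \<mu>) H" using X_minus1_primitive[OF that \<mu>] by blast
    from someI_ex[OF this] show "is_primitive (P w) w" "sqint (wmeas \<mu>) (P w)" by (auto simp: P_def)
  qed
  define l where "l \<sigma> w = laplace \<sigma> (P w)" for \<sigma> w
  have l_eq: "l \<sigma> w = laplace \<sigma> K" if "w \<in> ?X" "is_primitive K w" for \<sigma> w K
    unfolding l_def
    using is_primitive_unique[OF P(1)[OF that(1)] that(2)] P(1)[OF that(1)] that(2)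
    by (intro laplace_cong_AE) (auto simp: is_primitive_def dest!: borel_measurable_integrable)
  have l_lincomb: "l \<sigma> (\<lambda>x. a * w x + b * z x) = a * l \<sigma> w + b * l \<sigma> z"
    if "w \<in> ?X" "z \<in> ?X" "\<sigma> \<ge> 0" for a b w z \<sigma>
  proof -
    have "l \<sigma> (\<lambda>x. a * w x + b * z x) = laplace \<sigma> (\<lambda>y. a * P w y + b * P z y)"
      using that by (intro l_eq lincomb_mem is_primitive_lincomb P)
    also have "\<dots> = a * l \<sigma> w + b * l \<sigma> z"
      unfolding l_def using P(1)[OF that(1)] P(1)[OF that(2)] that(3)
      by (intro laplace_lincomb) (auto simp: is_primitive_def)
    finally show ?thesis .
  qed
  \<comment> \<open>The bound is uniform in \<sigma> \<ge> 0, as required because the evaluation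
    point moves along the characteristic while the orbit moves in time.\<close>
  have l_bound: "\<bar>l \<sigma> w\<bar> \<le> ?N w / sqrt \<mu>" if "w \<in> ?X" "\<sigma> \<ge> 0" for w \<sigma>
  proof -
    have "\<bar>l \<sigma> w\<bar> \<le> l2norm (wmeas \<mu>) (P w) / sqrt (2 * \<sigma> + \<mu>)"
      unfolding l_def laplace_def
      using P(1)[OF that(1)] that(2) \<mu> by (intro exp_pairing(2) P(2)[OF that(1)]) (auto simp: is_primitive_def)
    also have "\<dots> \<le> l2norm (wmeas \<mu>) (P w) / sqrt \<mu>"
      using that(2) \<mu> by (intro divide_left_mono) auto
    finally show ?thesis using norm_minus1_primitive[OF P[OF that(1)] \<mu>] by simp
  qed
  define \<sigma> where "\<sigma> \<tau> = s * exp \<tau>" for \<tau> :: real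
  have \<sigma>pos: "\<sigma> \<tau> > 0" for \<tau> using s by (simp add: \<sigma>_def)
  have d\<sigma>: "(\<sigma> has_real_derivative \<sigma> \<tau>) (at \<tau> within A)" for \<tau> A
    unfolding \<sigma>_def by (auto intro!: derivative_eq_intros)
  \<comment> \<open>The square is the integrating factor: along \<sigma>' = \<sigma> its logarithmic
    derivative is 2 \<rho> \<sigma> / (\<rho> \<sigma> + 2) = 2 - 4 / (\<rho> \<sigma> + 2), the
    negative of the multiplier.\<close>
  define f where "f \<tau> = (1 + \<rho> * \<sigma> \<tau> / 2)\<^sup>2 * l (\<sigma> \<tau>) (S \<tau> u)" for \<tau>
  have "(f has_real_derivative 0) (at \<tau> within {0..})" if \<tau>: "\<tau> \<ge> 0" for \<tau>
  proof -
    define x where "x = S \<tau> u"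
    define z where "z = S \<tau> v"
    have "(x, z) \<in> generator_graph ?X ?N S"
      unfolding x_def z_def by (rule generator_invariant(1)[OF C0 uv \<tau>])
    then have "(x, z) \<in> {(distr_of h, coag_L \<rho> h) | h. h \<in> X_0 \<mu>}" and xz: "x \<in> ?X" "z \<in> ?X"
      using gen by (blast, auto simp: generator_graph_def)
    then obtain k where k: "k \<in> X_0 \<mu>" "x = distr_of k" "z = coag_L \<rho> k" by blast
    have q: "((\<lambda>\<tau>'. ?N (\<lambda>y. (S \<tau>' u y - x y) / (\<tau>' - \<tau>) - z y)) \<longlongrightarrow> 0) (at \<tau> within {0..})"
      unfolding x_def z_def by (rule generator_invariant(2)[OF C0 uv \<tau>])
    define m where "m = (LINT y|lborel. P x y * y * exp (- \<sigma> \<tau> * y))"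
    have Px0: "P x y = 0" if "y \<le> 0" for y using P(1)[OF xz(1)] that by (simp add: is_primitive_def)
    have d1: "((\<lambda>\<tau>'. l (\<sigma> \<tau>') x) has_real_derivative - m * \<sigma> \<tau>) (at \<tau> within {0..})"
      unfolding l_def m_def
      by (rule DERIV_chain2[OF laplace_DERIV[OF P(2)[OF xz(1)] Px0 \<mu> \<sigma>pos] d\<sigma>])
    have Pz0: "P z y = 0" if "y \<le> 0" for y using P(1)[OF xz(2)] that by (simp add: is_primitive_def)
    have lz: "((\<lambda>\<tau>'. l (\<sigma> \<tau>') z) \<longlongrightarrow> l (\<sigma> \<tau>) z) (at \<tau> within {0..})"
    proof -
      have "((\<lambda>\<tau>'. l (\<sigma> \<tau>') z) has_real_derivative
          - (LINT y|lborel. P z y * y * exp (- \<sigma> \<tau> * y)) * \<sigma> \<tau>) (at \<tau> within {0..})"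
        unfolding l_def
        by (rule DERIV_chain2[OF laplace_DERIV[OF P(2)[OF xz(2)] Pz0 \<mu> \<sigma>pos] d\<sigma>])
      from DERIV_continuous[OF this] show ?thesis by (simp add: continuous_within)
    qed
    \<comment> \<open>Splits the motion in two: l (\<sigma> \<tau>') x varies \<sigma> with the
      orbit frozen at \<tau>, and \<open>r\<close> carries the increment of the orbit, small enough
      that only its time derivative counts. No joint differentiability is needed.\<close>
    define r where "r \<tau>' = l (\<sigma> \<tau>') (\<lambda>y. S \<tau>' u y - x y)" for \<tau>'
    have mem: "S \<tau>' u \<in> ?X" if "\<tau>' \<ge> 0" for \<tau>' using semigroup_mem[OF C0 that uX(1)] .
    have r0: "r \<tau> = 0"
      using l_lincomb[OF xz(1) xz(1), of "\<sigma> \<tau>" 1 "-1"] \<sigma>pos[of \<tau>] by (simp add: r_def x_def)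
    have d2: "(r has_real_derivative l (\<sigma> \<tau>) z) (at \<tau> within {0..})"
    proof -
      have "((\<lambda>\<tau>'. (r \<tau>' - r \<tau>) / (\<tau>' - \<tau>) - l (\<sigma> \<tau>') z) \<longlongrightarrow> 0) (at \<tau> within {0..})"
      proof (rule Lim_null_comparison)
        show "((\<lambda>\<tau>'. ?N (\<lambda>y. (S \<tau>' u y - x y) / (\<tau>' - \<tau>) - z y) / sqrt \<mu>) \<longlongrightarrow> 0) (at \<tau> within {0..})"
          using tendsto_divide_zero[OF q] .
        have "eventually (\<lambda>\<tau>'. \<tau>' \<ge> 0 \<and> \<tau>' \<noteq> \<tau>) (at \<tau> within {0..})" by (auto simp: eventually_at_filter)
        then show "\<forall>\<^sub>F \<tau>' in at \<tau> within {0..}. norm ((r \<tau>' - r \<tau>) / (\<tau>' - \<tau>) - l (\<sigma> \<tau>') z) \<le>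
            ?N (\<lambda>y. (S \<tau>' u y - x y) / (\<tau>' - \<tau>) - z y) / sqrt \<mu>"
        proof eventually_elim
          fix \<tau>' assume \<tau>': "\<tau>' \<ge> 0 \<and> \<tau>' \<noteq> \<tau>"
          have m1: "(\<lambda>y. S \<tau>' u y - x y) \<in> ?X" using mem[of \<tau>'] \<tau>' xz by (intro diff_mem) auto
          have w: "(\<lambda>y. (1 / (\<tau>' - \<tau>)) * (S \<tau>' u y - x y) + (-1) * z y) \<in> ?X"
            using m1 xz by (intro lincomb_mem)
          have "l (\<sigma> \<tau>') (\<lambda>y. (1 / (\<tau>' - \<tau>)) * (S \<tau>' u y - x y) + (-1) * z y) =
              (1 / (\<tau>' - \<tau>)) * r \<tau>' + (-1) * l (\<sigma> \<tau>') z"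
            unfolding r_def using \<sigma>pos[of \<tau>'] by (intro l_lincomb m1 xz) auto
          then have e: "(r \<tau>' - r \<tau>) / (\<tau>' - \<tau>) - l (\<sigma> \<tau>') z = l (\<sigma> \<tau>') (\<lambda>y. (1 / (\<tau>' - \<tau>)) * (S \<tau>' u y - x y) + (-1) * z y)"
            by (simp add: r0)
          show "norm ((r \<tau>' - r \<tau>) / (\<tau>' - \<tau>) - l (\<sigma> \<tau>') z) \<le>
            ?N (\<lambda>y. (S \<tau>' u y - x y) / (\<tau>' - \<tau>) - z y) / sqrt \<mu>"
            unfolding e using l_bound[OF w, of "\<sigma> \<tau>'"] \<sigma>pos[of \<tau>'] by simp
        qed
      qed
      from tendsto_add[OF this lz] show ?thesis by (simp add: has_field_derivative_iff)
    qed
    have "((\<lambda>\<tau>'. l (\<sigma> \<tau>') x + r \<tau>') has_real_derivative - m * \<sigma> \<tau> + l (\<sigma> \<tau>) z) (at \<tau> within {0..})"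
      by (rule DERIV_add[OF d1 d2])
    moreover have "l (\<sigma> \<tau>') x + r \<tau>' = l (\<sigma> \<tau>') (S \<tau>' u)" if "\<tau>' \<ge> 0" for \<tau>'
      using l_lincomb[OF mem[OF that] xz(1), of "\<sigma> \<tau>'" 1 "-1"] \<sigma>pos[of \<tau>'] by (simp add: r_def)
    ultimately have d3: "((\<lambda>\<tau>'. l (\<sigma> \<tau>') (S \<tau>' u)) has_real_derivative - m * \<sigma> \<tau> + l (\<sigma> \<tau>) z) (at \<tau> within {0..})"
      using \<tau> by (auto intro: has_field_derivative_transform_within[of _ _ _ _ 1])
    \<comment> \<open>Invariance of the domain makes \<open>z\<close> the image of \<open>x\<close>
      under the operator. Its transport part \<sigma> m cancels the - m \<sigma> that comes from
      moving along the characteristic.\<close>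
    have "l (\<sigma> \<tau>) z = (4 / (\<rho> * \<sigma> \<tau> + 2) - 2) * l (\<sigma> \<tau>) x + \<sigma> \<tau> * m"
      unfolding l_def m_def
      using laplace_coag_L[OF k(1) \<mu> \<rho> less_imp_le[OF \<sigma>pos] P(1)[OF xz(1), unfolded k(2)]
          P(2)[OF xz(1), unfolded k(2)] P(1)[OF xz(2), unfolded k(3)]] by (simp add: k)
    with d3 have d4: "((\<lambda>\<tau>'. l (\<sigma> \<tau>') (S \<tau>' u)) has_real_derivative (4 / (\<rho> * \<sigma> \<tau> + 2) - 2) * l (\<sigma> \<tau>) x) (at \<tau> within {0..})"
      by simp
    have d5: "((\<lambda>\<tau>'. (1 + \<rho> * \<sigma> \<tau>' / 2)\<^sup>2) has_real_derivative 2 * (1 + \<rho> * \<sigma> \<tau> / 2) * (\<rho> * \<sigma> \<tau> / 2)) (at \<tau> within {0..})"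
      by (auto intro!: derivative_eq_intros d\<sigma>)
    have zero: "2 * (1 + \<rho> * \<sigma> \<tau> / 2) * (\<rho> * \<sigma> \<tau> / 2) * L + (4 / (\<rho> * \<sigma> \<tau> + 2) - 2) * L * (1 + \<rho> * \<sigma> \<tau> / 2)\<^sup>2 = 0" for L
    proof -
      have "\<rho> * \<sigma> \<tau> + 2 \<noteq> 0" using mult_pos_pos[OF \<rho> \<sigma>pos[of \<tau>]] by linarith
      then show ?thesis by (simp add: field_simps power2_eq_square)
    qed
    show ?thesis unfolding f_def
      by (rule DERIV_cong[OF DERIV_mult[OF d5 d4]]) (use zero[of "l (\<sigma> \<tau>) x"] in \<open>simp add: x_def\<close>)
  qed
  then obtain c where c: "\<And>\<tau>. \<tau> \<in> {0..} \<Longrightarrow> f \<tau> = c"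
    using has_field_derivative_zero_constant[of "{0..}" f] by auto
  have "f t = f 0" using c[of t] c[of 0] t by simp
  moreover have "S t u \<in> ?X" using semigroup_mem[OF C0 t uX(1)] .
  ultimately show ?thesis
    using l_eq[OF uX(1), of G s] l_eq[of "S t u" H "s * exp t"] G H
    by (simp add: f_def \<sigma>_def uX0[unfolded u_def] u_def)
qed

section \<open>Decay on the domain\<close>

lemma integral_scale:
  fixes f :: "real \<Rightarrow> real"
  assumes "c > 0"
  shows "(LINT y|lborel. f (c * y)) = (LINT x|lborel. f x) / c"
  using lborel_integral_real_affine[of c f 0] assms by simp

lemma integrable_scale:
  fixes f :: "real \<Rightarrow> real"
  assumes "integrable lborel f" "c > 0"
  shows "integrable lborel (\<lambda>y. f (c * y))"
  using lborel_integrable_real_affine[of f c 0] assms by simp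

lemma laplace_scale:
  fixes f :: "real \<Rightarrow> real"
  assumes "c > 0"
  shows "laplace \<sigma> (\<lambda>y. f (c * y)) = laplace (\<sigma> / c) f / c"
proof -
  have "laplace \<sigma> (\<lambda>y. f (c * y)) = (LINT y|lborel. f (c * y) * exp (- (\<sigma> / c) * (c * y)))"
    using assms by (simp add: laplace_def)
  also have "\<dots> = laplace (\<sigma> / c) f / c"
    unfolding laplace_def by (rule integral_scale[OF assms])
  finally show ?thesis .
qed

text \<open>The substitution x = E y gives the factor 1/E, and the weight becomes exp(\<mu> x / E),
  at most the original one.\<close>

lemma sqint_dilation:
  assumes G: "sqint (wmeas \<mu>) G" and \<mu>: "\<mu> > 0" and E: "E \<ge> 1"
  shows "sqint (wmeas \<mu>) (\<lambda>y. G (E * y))" "l2norm (wmeas \<mu>) (\<lambda>y. G (E * y)) \<le> l2norm (wmeas \<mu>) G / sqrt E"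
proof -
  have m[measurable]: "G \<in> borel_measurable borel" using G by (auto dest: sqintD)
  let ?p = "\<lambda>x. indicator {0<..} x * exp (\<mu> / E * x) * (G x)\<^sup>2"
  let ?q = "\<lambda>x. indicator {0<..} x * exp (\<mu> * x) * (G x)\<^sup>2"
  have q: "integrable lborel ?q" using G sqint_wmeas_iff[OF m] by simp
  have le: "?p x \<le> ?q x" "0 \<le> ?p x" for x
  proof -
    have "\<mu> / E * x \<le> \<mu> * x" if "x > 0"
    proof -
      have "\<mu> / E \<le> \<mu> / 1" using \<mu> E by (intro divide_left_mono) auto
      then show ?thesis using that by (intro mult_right_mono) auto
    qed
    then show "?p x \<le> ?q x" "0 \<le> ?p x" by (auto simp: indicator_def intro!: mult_right_mono)
  qed
  have p: "integrable lborel ?p"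
    by (rule Bochner_Integration.integrable_bound[OF q]) (measurable, use le in \<open>auto simp: abs_of_nonneg intro!: order_trans[OF le(1)]\<close>)
  have eq: "indicator {0<..} y * exp (\<mu> * y) * (G (E * y))\<^sup>2 = ?p (E * y)" for y
    using E by (auto simp: indicator_def zero_less_mult_iff)
  have m': "(\<lambda>y. G (E * y)) \<in> borel_measurable borel" by measurable
  show "sqint (wmeas \<mu>) (\<lambda>y. G (E * y))"
    unfolding sqint_wmeas_iff[OF m'] eq by (rule integrable_scale[OF p]) (use E in simp)
  have "(LINT y|lborel. ?p (E * y)) = (LINT y|lborel. ?p y) / E" using E by (intro integral_scale) auto
  also have "\<dots> \<le> (LINT y|lborel. ?q y) / E" using E p q le by (intro divide_right_mono integral_mono) auto
  finally have "sqrt (LINT y|lborel. ?p (E * y)) \<le> sqrt ((LINT y|lborel. ?q y) / E)" by (rule real_sqrt_le_mono)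
  then show "l2norm (wmeas \<mu>) (\<lambda>y. G (E * y)) \<le> l2norm (wmeas \<mu>) G / sqrt E"
    unfolding l2norm_wmeas[OF m'] l2norm_wmeas[OF m] eq by (simp only: real_sqrt_divide)
qed

lemma exp_tail_integral:
  fixes y :: real
  assumes "\<mu> > 0"
  shows "integrable lborel (\<lambda>x. indicator {y<..} x * exp (- \<mu> * x))"
    "(LINT x|lborel. indicator {y<..} x * exp (- \<mu> * x)) = exp (- \<mu> * y) / \<mu>"
proof -
  have eq: "indicator {y<..} (y + 1 * x) * exp (- \<mu> * (y + 1 * x)) = exp (- \<mu> * y) * (indicator {0<..} x * exp (- \<mu> * x))" for x
    by (auto simp: indicator_def algebra_simps simp flip: exp_add)
  have i: "integrable lborel (\<lambda>x. indicator {y<..} (y + 1 * x) * exp (- \<mu> * (y + 1 * x)))"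
    unfolding eq by (rule integrable_mult_right[OF exp_integral_halfline(1)[OF assms]])
  show "integrable lborel (\<lambda>x. indicator {y<..} x * exp (- \<mu> * x))"
    using lborel_integrable_real_affine_iff[of 1 "\<lambda>x. indicator {y<..} x * exp (- \<mu> * x)" y] i by simp
  have "(LINT x|lborel. indicator {y<..} x * exp (- \<mu> * x)) =
      (LINT x|lborel. indicator {y<..} (y + 1 * x) * exp (- \<mu> * (y + 1 * x)))"
    using lborel_integral_real_affine[of 1 "\<lambda>x. indicator {y<..} x * exp (- \<mu> * x)" y] by simp
  also have "\<dots> = exp (- \<mu> * y) / \<mu>"
    unfolding eq integral_mult_right_zero exp_integral_halfline(2)[OF assms] by simp
  finally show "(LINT x|lborel. indicator {y<..} x * exp (- \<mu> * x)) = exp (- \<mu> * y) / \<mu>" .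
qed

section \<open>Exponential bounds for tails and convolutions\<close>

text \<open>Cauchy-Schwarz against exp(-\<mu> x) cut off at y. The point of a pointwise bound is
  that dilation by E improves the rate \<mu>/2 to \<mu> E / 2.\<close>

lemma tail_bound:
  assumes G: "sqint (wmeas \<mu>) G" "\<And>y. y \<le> 0 \<Longrightarrow> G y = 0" and \<mu>: "\<mu> > 0" and y: "y \<ge> 0"
  shows "\<bar>LINT x|lborel. indicator {y<..} x * G x\<bar> \<le> l2norm (wmeas \<mu>) G / sqrt \<mu> * exp (- (\<mu> / 2) * y)"
proof -
  let ?v = "\<lambda>x. indicator {y<..} x * exp (- \<mu> * x) :: real"
  have eq: "indicator {0<..} x * exp (\<mu> * x) * (?v x)\<^sup>2 = indicator {y<..} x * exp (- \<mu> * x)" for x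
    using y by (auto simp: indicator_def power2_eq_square simp flip: exp_add)
  have m: "?v \<in> borel_measurable borel" by measurable
  have s: "sqint (wmeas \<mu>) ?v" unfolding sqint_wmeas_iff[OF m] eq by (rule exp_tail_integral(1)[OF \<mu>])
  have "exp (- \<mu> * y) = (exp (- (\<mu> / 2) * y))\<^sup>2" by (simp add: power2_eq_square flip: exp_add)
  then have n: "l2norm (wmeas \<mu>) ?v = exp (- (\<mu> / 2) * y) / sqrt \<mu>"
    unfolding l2norm_wmeas[OF m] eq exp_tail_integral(2)[OF \<mu>] by (simp add: real_sqrt_divide)
  have "\<bar>LINT x|lborel. G x * indicator {y<..} x\<bar> \<le> l2norm (wmeas \<mu>) G * l2norm (wmeas \<mu>) ?v"
    by (rule wmeas_pairing(2)[OF G]) (use s in auto)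
  then show ?thesis unfolding n by (simp add: mult.commute)
qed

text \<open>The shifts by \<mu>/2 absorb the weight: V exp(\<mu> y / 2) = p * q with pure rates
  \<delta> and \<gamma>. The square of the L2 norm of p * q is at most its supremum 1/\<delta> times
  its integral 1/(\<delta> \<gamma>).\<close>

lemma exp_convolution_l2:
  fixes \<delta> \<gamma> \<mu> :: real
  assumes \<delta>: "\<delta> > 0" and \<gamma>: "\<gamma> > 0" and \<mu>: "\<mu> > 0"
  defines "V \<equiv> \<lambda>y. LINT x|lborel. (indicator {0<..} x * exp (- (\<delta> + \<mu> / 2) * x)) *
      (indicator {0<..} (y - x) * exp (- (\<gamma> + \<mu> / 2) * (y - x)))"
  shows "sqint (wmeas \<mu>) V" "l2norm (wmeas \<mu>) V \<le> 1 / (\<delta> * sqrt \<gamma>)"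
    "\<And>y. V y \<ge> 0"
proof -
  define p where "p x = indicator {0<..} x * exp (- \<delta> * x)" for x :: real
  define q where "q x = indicator {0<..} x * exp (- \<gamma> * x)" for x :: real
  have pi: "integrable lborel p" "(LINT x|lborel. p x) = 1 / \<delta>" and qi: "integrable lborel q" "(LINT x|lborel. q x) = 1 / \<gamma>"
    unfolding p_def q_def using exp_integral_halfline \<delta> \<gamma> by auto
  have pq: "0 \<le> p x" "0 \<le> q x" "q x \<le> 1" for x using \<gamma> by (auto simp: p_def q_def indicator_def)
  have [measurable]: "p \<in> borel_measurable borel" "q \<in> borel_measurable borel" unfolding p_def q_def by measurable
  define w where "w y = (LINT x|lborel. p x * q (y - x))" for y
  have pqi: "integrable lborel (\<lambda>x. p x * q (y - x))" for y
    by (rule integrable_mult_bounded[OF pi(1), of _ 1]) (measurable, use pq in auto)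
  have wi: "integrable lborel w" unfolding w_def using convolution_fubini(1)[OF pi(1) qi(1), of "\<lambda>_. 0" 0] by simp
  have wI: "(LINT y|lborel. w y) = 1 / (\<delta> * \<gamma>)"
    using convolution_fubini(2)[OF pi(1) qi(1), of "\<lambda>_. 1" 1] pi qi by (simp add: w_def)
  have w0: "w y \<ge> 0" for y unfolding w_def using pq by (intro integral_nonneg_AE AE_I2) auto
  have w1: "w y \<le> 1 / \<delta>" for y
  proof -
    have "w y \<le> (LINT x|lborel. p x)" unfolding w_def
      using pqi pi(1) pq by (intro integral_mono) (auto intro: mult_left_le)
    then show ?thesis using pi(2) by simp
  qed
  have Vw: "V y = exp (- (\<mu> / 2) * y) * w y" for y
  proof -
    have "(indicator {0<..} x * exp (- (\<delta> + \<mu> / 2) * x)) * (indicator {0<..} (y - x) * exp (- (\<gamma> + \<mu> / 2) * (y - x)))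
        = exp (- (\<mu> / 2) * y) * (p x * q (y - x))" for x
      by (simp add: p_def q_def algebra_simps diff_divide_distrib flip: exp_add)
    then show ?thesis by (simp add: V_def w_def)
  qed
  show "V y \<ge> 0" for y unfolding Vw using w0 by simp
  have [measurable]: "w \<in> borel_measurable borel" using borel_measurable_integrable[OF wi] by simp
  have m: "V \<in> borel_measurable borel" unfolding Vw[abs_def] by measurable
  have eq: "indicator {0<..} y * exp (\<mu> * y) * (V y)\<^sup>2 = indicator {0<..} y * (w y)\<^sup>2" for y
    by (simp add: Vw power_mult_distrib power2_eq_square[of "exp _"] flip: exp_add)
  have le: "indicator {0<..} y * (w y)\<^sup>2 \<le> 1 / \<delta> * w y" for y
    using w0[of y] w1[of y] mult_right_mono[OF w1[of y] w0[of y]] \<delta> by (auto simp: indicator_def power2_eq_square)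
  have i: "integrable lborel (\<lambda>y. indicator {0<..} y * (w y)\<^sup>2)"
  proof (rule Bochner_Integration.integrable_bound[OF integrable_mult_right[OF wi, of "1 / \<delta>"]])
    show "AE y in lborel. norm (indicator {0<..} y * (w y)\<^sup>2) \<le> norm (1 / \<delta> * w y)"
      using le w0 \<delta> by (intro AE_I2) (simp add: abs_of_nonneg)
  qed measurable
  show "sqint (wmeas \<mu>) V" unfolding sqint_wmeas_iff[OF m] eq by (rule i)
  have "(LINT y|lborel. indicator {0<..} y * (w y)\<^sup>2) \<le> (LINT y|lborel. 1 / \<delta> * w y)"
    using i wi le by (intro integral_mono) auto
  also have "\<dots> = (1 / (\<delta> * sqrt \<gamma>))\<^sup>2"
    using wI \<delta> \<gamma> by (simp add: power_divide power_mult_distrib power2_eq_square)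
  finally have "sqrt (LINT y|lborel. indicator {0<..} y * (w y)\<^sup>2) \<le> sqrt ((1 / (\<delta> * sqrt \<gamma>))\<^sup>2)"
    by (rule real_sqrt_le_mono)
  then show "l2norm (wmeas \<mu>) V \<le> 1 / (\<delta> * sqrt \<gamma>)"
    unfolding l2norm_wmeas[OF m] eq using \<delta> \<gamma> by simp
qed

text \<open>The transform with the linear factor is minus the \<sigma>-derivative of 1/(\<sigma> +
  k).\<close>

lemma linear_exp_laplace:
  fixes k \<sigma> :: real
  assumes k: "k > 0" and \<sigma>: "\<sigma> > 0"
  shows "integrable lborel (\<lambda>z. indicator {0<..} z * exp (- k * z) * z)"
    "laplace \<sigma> (\<lambda>z. indicator {0<..} z * exp (- k * z)) = 1 / (\<sigma> + k)"
    "laplace \<sigma> (\<lambda>z. indicator {0<..} z * exp (- k * z) * z) = 1 / (\<sigma> + k)\<^sup>2"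
proof -
  let ?f = "\<lambda>z::real. indicator {0<..} z * exp (- k * z)"
  have f: "sqint (wmeas k) ?f"
    by (rule l2norm_mono(1)[OF sqint_exp(1)[of k k]]) (use k in \<open>auto simp: indicator_def\<close>)
  have f0: "?f z = 0" if "z \<le> 0" for z using that by simp
  show "integrable lborel (\<lambda>z. ?f z * z)" by (rule moment_integrable(2)[OF f f0 k])
  have L: "laplace s ?f = 1 / (s + k)" if "s > 0" for s
  proof -
    have e: "?f z * exp (- s * z) = indicator {0<..} z * exp (- (s + k) * z)" for z
      by (simp add: algebra_simps flip: exp_add)
    show ?thesis unfolding laplace_def e using exp_integral_halfline(2)[of "s + k"] that k by simp
  qed
  then show "laplace \<sigma> ?f = 1 / (\<sigma> + k)" using \<sigma> by simp
  have "((\<lambda>s. laplace s ?f) has_real_derivative - (1 / (\<sigma> + k)\<^sup>2)) (at \<sigma>)"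
  proof (rule has_field_derivative_transform_within_open[where S="{0<..}"])
    show "((\<lambda>s. 1 / (s + k)) has_real_derivative - (1 / (\<sigma> + k)\<^sup>2)) (at \<sigma>)"
      using k \<sigma> by (auto intro!: derivative_eq_intros simp: power2_eq_square)
  qed (use L \<sigma> in auto)
  with laplace_DERIV[OF f f0 k \<sigma>]
  have "- (LINT y|lborel. ?f y * y * exp (- \<sigma> * y)) = - (1 / (\<sigma> + k)\<^sup>2)" by (rule DERIV_unique)
  then show "laplace \<sigma> (\<lambda>z. ?f z * z) = 1 / (\<sigma> + k)\<^sup>2" by (simp add: laplace_def)
qed

text \<open>The summands bound, in this order, the dilated datum, the boundary term of the
  integration by parts and the remaining convolution in \<open>multiplier_bound\<close>. 3k/4 -
  \<mu>/2 is the rate left to the kernel after absorbing its linear factor and the square root of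
  the weight; 12 is 6 from the kernel bound times 2 from 1/\<delta>.\<close>

definition decay_const :: "real \<Rightarrow> real \<Rightarrow> real" where
  "decay_const k \<mu> = 1 + 2 * k / \<mu> + 12 * k\<^sup>2 / (\<mu> * sqrt \<mu> * sqrt (3 * k / 4 - \<mu> / 2))"

text \<open>With \<open>k = 2 / \<rho>\<close> the multiplier \<open>((1 + \<rho> \<sigma> a / 2) / (1 + \<rho> \<sigma> / 2))\<^sup>2\<close> equals
  \<open>(a + (1 - a) k / (\<sigma> + k))\<^sup>2\<close>. Its inverse transform is \<open>a\<^sup>2 \<delta> + M\<close> with
  \<open>M(y) = (c\<^sub>1 + c\<^sub>2 y) exp (- k y)\<close>. As \<open>G\<close> has integral 0, the convolution with \<open>M\<close> is
  integrated by parts: \<open>M * f = M(0) F + M' * F\<close>, where \<open>F' = f\<close>. The dilated primitive \<open>F\<close> is smaller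
  than \<open>f\<close> by a factor \<open>exp (- t)\<close>, which gives the decay.\<close>

lemma multiplier_bound:
  fixes k \<mu> t :: real
  assumes k: "k > 0" and \<mu>: "\<mu> > 0" and \<mu>k: "\<mu> \<le> k" and t: "t > 0"
    and G: "sqint (wmeas \<mu>) G" "\<And>y. y \<le> 0 \<Longrightarrow> G y = 0" "(LINT y|lborel. G y) = 0"
    and H: "sqint (wmeas \<mu>) H" "\<And>y. y \<le> 0 \<Longrightarrow> H y = 0"
    and L: "\<And>\<sigma>. \<sigma> > 0 \<Longrightarrow>
      laplace \<sigma> H = (exp (- t) + (1 - exp (- t)) * k / (\<sigma> + k))\<^sup>2 * laplace (\<sigma> * exp (- t)) G"
  shows "l2norm (wmeas \<mu>) H \<le> decay_const k \<mu> * l2norm (wmeas \<mu>) G * exp (- t)"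
proof -
  let ?W = "wmeas \<mu>"
  define a where "a = exp (- t)"
  define E where "E = exp t"
  have aE: "a * E = 1" by (simp add: a_def E_def flip: exp_add)
  have a: "0 < a" "a < 1" using t by (auto simp: a_def)
  have E: "E > 1" using t by (simp add: E_def)
  have a_eq: "a = 1 / E" using aE E by (simp add: field_simps)
  define n where "n = l2norm ?W G"
  have n0: "n \<ge> 0" by (simp add: n_def)
  have [measurable]: "G \<in> borel_measurable borel" "H \<in> borel_measurable borel" using G(1) H(1) by (auto dest: sqintD)
  have Gi: "integrable lborel G" "integrable lborel (\<lambda>x. x * G x)"
    using moment_integrable[OF G(1,2) \<mu>] by (auto simp: mult.commute)
  have Hi: "integrable lborel H" using moment_integrable(1)[OF H \<mu>] .
  define T where "T y = indicator {0<..} y * (LINT x|lborel. indicator {y<..} x * G x)" for y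
  have Gm: "G \<in> borel_measurable borel" by measurable
  have Ti: "integrable lborel T"
    unfolding T_def by (rule tail_fubini(1)[OF Gm _ Gi(2), of "\<lambda>_. 0" 0]) (use G(2) in auto)
  have T0: "T y = 0" if "y \<le> 0" for y using that by (simp add: T_def)
  have [measurable]: "T \<in> borel_measurable borel" using borel_measurable_integrable[OF Ti] by simp
  \<comment> \<open>The mean-zero condition enters here: in general the numerator is the integral of
    \<open>G\<close> minus its transform.\<close>
  have LT: "laplace s T = - laplace s G / s" if s: "s > 0" for s
  proof -
    let ?\<psi> = "\<lambda>y. indicator {0<..} y * exp (- s * y)"
    have "laplace s T = (LINT y|lborel. T y * ?\<psi> y)" by (rule laplace_halfline[OF T0])
    also have "\<dots> = (LINT x|lborel. G x * (LINT y|lborel. indicator {0<..<x} y * ?\<psi> y))"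
      unfolding T_def by (rule tail_fubini(2)[OF Gm _ Gi(2), of ?\<psi> 1]) (use G(2) s in \<open>auto simp: indicator_def\<close>)
    also have "\<dots> = (LINT x|lborel. (1 / s) * (G x - G x * exp (- s * x)))"
    proof (rule Bochner_Integration.integral_cong[OF refl])
      fix x show "G x * (LINT y|lborel. indicator {0<..<x} y * ?\<psi> y) = (1 / s) * (G x - G x * exp (- s * x))"
      proof (cases "x \<le> 0")
        case False
        have "(LINT y|lborel. indicator {0<..<x} y * ?\<psi> y) =
            (LINT y|lborel. ?\<psi> y - indicator {x<..} y * exp (- s * y))"
        proof (rule integral_cong_AE)
          show "AE y in lborel. indicator {0<..<x} y * ?\<psi> y = ?\<psi> y - indicator {x<..} y * exp (- s * y)"
            using AE_lborel_singleton[of x] by eventually_elim (use False in \<open>auto simp: indicator_def\<close>)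
        qed auto
        also have "\<dots> = 1 / s - exp (- s * x) / s"
          using exp_integral_halfline[OF s] exp_tail_integral[OF s, of x] by simp
        finally have e: "(LINT y|lborel. indicator {0<..<x} y * ?\<psi> y) = 1 / s - exp (- s * x) / s" .
        show ?thesis unfolding e by (simp add: diff_divide_distrib right_diff_distrib)
      qed (simp add: G(2))
    qed
    also have "\<dots> = (1 / s) * (0 - laplace s G)"
      using Gi(1) integrable_laplace[OF Gi(1) G(2), of s] s G(3) by (simp add: laplace_def)
    finally show ?thesis by simp
  qed
  define f where "f y = G (E * y)" for y
  \<comment> \<open>Since \<open>G\<close> has integral 0, F(y) is also the integral of G over (0, E
    y). With this normalisation F' = E f, where the factor E compensates the 1/E in the transform of
    the dilation.\<close>
  define F where "F y = - T (E * y)" for y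
  \<comment> \<open>\<open>c1\<close> and \<open>c2\<close> are the coefficients of 1/(\<sigma> + k)
    and 1/(\<sigma> + k)^2 in the expanded square.\<close>
  define c1 where "c1 = 2 * a * (1 - a) * k"
  define c2 where "c2 = (1 - a)\<^sup>2 * k\<^sup>2"
  \<comment> \<open>The derivative of the kernel M(z) = (c1 + c2 z) exp(-k z) for z > 0. Its jump at
    0 has height \<open>c1\<close> and is kept apart as the term c1 F.\<close>
  define K where "K z = (c2 - k * c1) * (indicator {0<..} z * exp (- k * z))
    + (- k * c2) * (indicator {0<..} z * exp (- k * z) * z)" for z :: real
  have c1: "c1 \<ge> 0" using a k by (simp add: c1_def)
  have f0: "f y = 0" and F0: "F y = 0" if "y \<le> 0" for y
    using that G(2) T0 E by (auto simp: f_def F_def mult_nonneg_nonpos)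
  have K0: "K z = 0" if "z \<le> 0" for z using that by (simp add: K_def)
  have fi: "integrable lborel f" and Fi: "integrable lborel F"
    unfolding f_def F_def using Gi(1) Ti E by (auto intro!: integrable_scale)
  have K1: "integrable lborel (\<lambda>z. indicator {0<..} z * exp (- k * z))"
    and K2: "integrable lborel (\<lambda>z. indicator {0<..} z * exp (- k * z) * z)"
    using exp_integral_halfline(1)[OF k] linear_exp_laplace(1)[OF k, of 1] by auto
  have Ki: "integrable lborel K" unfolding K_def using K1 K2 by auto
  have [measurable]: "f \<in> borel_measurable borel" "F \<in> borel_measurable borel" "K \<in> borel_measurable borel"
    unfolding f_def F_def K_def by measurable
  define C where "C y = (LINT x|lborel. F x * K (y - x))" for y
  have Ci: "integrable lborel C" unfolding C_def using convolution_fubini(1)[OF Fi Ki, of "\<lambda>_. 0" 0] by simp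
  have [measurable]: "C \<in> borel_measurable borel" using borel_measurable_integrable[OF Ci] by simp
  have C0: "C y = 0" if "y \<le> 0" for y
  proof -
    have "F x * K (y - x) = 0" for x using F0[of x] K0[of "y - x"] that by (cases "x \<le> 0") auto
    then have "(\<lambda>x. F x * K (y - x)) = (\<lambda>x. 0)" by blast
    then show ?thesis by (simp add: C_def)
  qed
  \<comment> \<open>\<open>R\<close> is the candidate for H: a^2 E f plus M * (E f), the latter
    integrated by parts into c1 F + K * F. Comparing transforms and applying \<open>Lerch\<close>
    identifies the two.\<close>
  define R1 where "R1 y = a\<^sup>2 * E * f y + c1 * F y" for y
  define R where "R y = 1 * R1 y + 1 * C y" for y
  have R1i: "integrable lborel R1" unfolding R1_def using fi Fi by auto
  have R10: "R1 y = 0" if "y \<le> 0" for y using that f0 F0 by (simp add: R1_def)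
  have Ri: "integrable lborel R" unfolding R_def using R1i Ci by auto
  have R0: "R y = 0" if "y \<le> 0" for y using that R10 C0 by (simp add: R_def)
  have [measurable]: "R1 \<in> borel_measurable borel" "R \<in> borel_measurable borel" unfolding R_def R1_def by measurable
  have LR: "laplace \<sigma> R = laplace \<sigma> H" if \<sigma>: "\<sigma> > 0" for \<sigma>
  proof -
    define g where "g = laplace (\<sigma> * a) G"
    have sa: "\<sigma> / E = \<sigma> * a" by (simp add: a_eq)
    have "laplace \<sigma> f = laplace (\<sigma> / E) G / E" unfolding f_def using E by (intro laplace_scale) auto
    then have lf: "laplace \<sigma> f = a * g" unfolding sa g_def by (simp add: a_eq)
    have "laplace \<sigma> F = - laplace \<sigma> (\<lambda>y. T (E * y))" by (simp add: F_def laplace_def)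
    also have "laplace \<sigma> (\<lambda>y. T (E * y)) = laplace (\<sigma> / E) T / E" using E by (intro laplace_scale) auto
    also have "\<dots> = - g / \<sigma>"
    proof -
      have "laplace (\<sigma> * a) T = - g / (\<sigma> * a)" unfolding g_def using \<sigma> a by (intro LT) auto
      moreover have "- g / (\<sigma> * a) / E = - g / \<sigma>" using E \<sigma> by (simp add: a_eq)
      ultimately show ?thesis unfolding sa by simp
    qed
    finally have lF: "laplace \<sigma> F = g / \<sigma>" by simp
    have lK: "laplace \<sigma> K = (c2 - k * c1) * (1 / (\<sigma> + k)) + (- k * c2) * (1 / (\<sigma> + k)\<^sup>2)"
      unfolding K_def using \<sigma> linear_exp_laplace(2,3)[OF k \<sigma>]
      by (subst laplace_lincomb[OF K1 _ K2]) auto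
    have lC: "laplace \<sigma> C = laplace \<sigma> F * laplace \<sigma> K"
      unfolding C_def using \<sigma> by (intro laplace_convolution Fi F0 Ki K0) auto
    have "laplace \<sigma> R = 1 * laplace \<sigma> R1 + 1 * laplace \<sigma> C"
      unfolding R_def using \<sigma> by (intro laplace_lincomb R1i R10 Ci C0) auto
    also have "laplace \<sigma> R1 = a\<^sup>2 * E * laplace \<sigma> f + c1 * laplace \<sigma> F"
      unfolding R1_def using \<sigma> by (intro laplace_lincomb fi f0 Fi F0) auto
    also have "a\<^sup>2 * E * laplace \<sigma> f = a\<^sup>2 * g" unfolding lf using aE by (simp add: power2_eq_square mult_ac)
    finally have "laplace \<sigma> R = g * (a\<^sup>2 + c1 / \<sigma> + ((c2 - k * c1) / (\<sigma> + k) - k * c2 / (\<sigma> + k)\<^sup>2) / \<sigma>)"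
      unfolding lC lF lK by (simp add: algebra_simps diff_divide_distrib add_divide_distrib)
    also have "a\<^sup>2 + c1 / \<sigma> + ((c2 - k * c1) / (\<sigma> + k) - k * c2 / (\<sigma> + k)\<^sup>2) / \<sigma> =
        a\<^sup>2 + c1 / (\<sigma> + k) + c2 / (\<sigma> + k)\<^sup>2"
    proof -
      have p: "\<sigma> + k \<noteq> 0" "\<sigma> \<noteq> 0" using \<sigma> k by auto
      define q where "q = \<sigma> + k"
      have kq: "k = q - \<sigma>" "q \<noteq> 0" using p by (auto simp: q_def)
      have "c1 / \<sigma> + ((c2 - k * c1) / q - k * c2 / q\<^sup>2) / \<sigma> = c1 / q + c2 / q\<^sup>2"
        unfolding kq(1) using kq(2) p(2) by (simp add: field_simps power2_eq_square)
      then show ?thesis by (simp add: q_def)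
    qed
    also have "\<dots> = (a + (1 - a) * k / (\<sigma> + k))\<^sup>2"
      by (simp add: c1_def c2_def power2_sum power_divide power_mult_distrib mult_ac)
    finally show ?thesis using L[OF \<sigma>] by (simp add: a_def g_def mult_ac)
  qed
  have "AE y in lborel. R y - H y = 0"
  proof (rule Lerch)
    show "integrable lborel (\<lambda>y. R y - H y)" using Ri Hi by simp
    show "laplace \<sigma> (\<lambda>y. R y - H y) = 0" if "\<sigma> > 0" for \<sigma>
      using laplace_lincomb[OF Ri R0 Hi H(2), of \<sigma> 1 "-1"] LR[OF that] that by simp
  qed (simp add: R0 H)
  then have "AE y in ?W. H y = R y" unfolding AE_wmeas_iff by eventually_elim auto
  then have HR: "l2norm ?W H = l2norm ?W R" by (intro l2norm_cong_AE) auto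
  have sf: "sqint ?W f" "l2norm ?W f \<le> n / sqrt E"
    unfolding f_def n_def using sqint_dilation[OF G(1) \<mu>, of E] E by auto
  have Fb: "\<bar>F y\<bar> \<le> n / sqrt \<mu> * exp (- (\<mu> * E / 2) * y)" if "y > 0" for y
    using tail_bound[OF G(1,2) \<mu>, of "E * y"] that E by (simp add: F_def T_def n_def mult_ac)
  have sF: "sqint ?W F" "l2norm ?W F \<le> n / (\<mu> * sqrt (E - 1))"
  proof -
    have d: "\<mu> < 2 * (\<mu> * E / 2)" using \<mu> E by simp
    let ?e = "\<lambda>y. n / sqrt \<mu> * exp (- (\<mu> * E / 2) * y)"
    have s: "sqint ?W ?e" by (rule sqint_cmult[OF sqint_exp(1)[OF d]])
    have le: "AE y in ?W. \<bar>F y\<bar> \<le> \<bar>?e y\<bar>"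
      unfolding AE_wmeas_iff using Fb n0 \<mu> by (auto simp: abs_of_nonneg)
    show "sqint ?W F" by (rule l2norm_mono(1)[OF s _ le]) auto
    have "l2norm ?W F \<le> l2norm ?W ?e" by (rule l2norm_mono(2)[OF s _ le]) auto
    also have "\<dots> = n / sqrt \<mu> * (1 / sqrt (2 * (\<mu> * E / 2) - \<mu>))"
      unfolding l2norm_cmult sqint_exp(2)[OF d] using n0 \<mu> by simp
    also have "2 * (\<mu> * E / 2) - \<mu> = \<mu> * (E - 1)" by (simp add: algebra_simps)
    also have "n / sqrt \<mu> * (1 / sqrt (\<mu> * (E - 1))) = n / (\<mu> * sqrt (E - 1))"
      using \<mu> by (simp add: real_sqrt_mult)
    finally show "l2norm ?W F \<le> n / (\<mu> * sqrt (E - 1))" .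
  qed
  \<comment> \<open>Chosen so that \<delta> + \<mu>/2 = \<mu> E / 2 is the rate of \<open>F\<close>
    and \<gamma> + \<mu>/2 = 3k/4 is the rate kept for \<open>K\<close>. Positivity of
    \<open>\<gamma>\<close> comes from \<mu> \<le> k.\<close>
  define \<delta> where "\<delta> = \<mu> * (E - 1) / 2"
  define \<gamma> where "\<gamma> = 3 * k / 4 - \<mu> / 2"
  have \<delta>: "\<delta> > 0" and \<gamma>: "\<gamma> > 0" using \<mu> E k \<mu>k by (auto simp: \<delta>_def \<gamma>_def)
  define V where "V y = (LINT x|lborel. (indicator {0<..} x * exp (- (\<delta> + \<mu> / 2) * x)) *
      (indicator {0<..} (y - x) * exp (- (\<gamma> + \<mu> / 2) * (y - x))))" for y :: real
  have V: "sqint ?W V" "l2norm ?W V \<le> 1 / (\<delta> * sqrt \<gamma>)" "\<And>y. V y \<ge> 0"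
    unfolding V_def[abs_def] by (rule exp_convolution_l2[OF \<delta> \<gamma> \<mu>])+
  have Kb: "\<bar>K z\<bar> \<le> 6 * k\<^sup>2 * (1 - a) * (indicator {0<..} z * exp (- (\<gamma> + \<mu> / 2) * z))" for z
  proof (cases "z > 0")
    case True
    have K_eq: "K z = k\<^sup>2 * (1 - a) * ((1 - 3 * a - k * (1 - a) * z) * exp (- k * z))"
      using True by (simp add: K_def c1_def c2_def power2_eq_square algebra_simps)
    \<comment> \<open>A quarter of the rate k pays for the linear factor: 2 + k z \<le> 6 exp(k z /
      4), leaving exp(-3 k z / 4).\<close>
    have x1: "k * z \<le> 4 * exp (k / 4 * z)" using exp_ge_add_one_self[of "k / 4 * z"] by linarith
    have x2: "1 \<le> exp (k / 4 * z)" using True k by simp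
    have "k * (1 - a) * z \<le> k * 1 * z" using a k True by (intro mult_right_mono mult_left_mono) auto
    moreover have "0 \<le> k * (1 - a) * z" using a k True by simp
    ultimately have "\<bar>1 - 3 * a - k * (1 - a) * z\<bar> \<le> 2 + k * z" using a by linarith
    also have "\<dots> \<le> 6 * exp (k / 4 * z)" using x1 x2 by linarith
    finally have "\<bar>1 - 3 * a - k * (1 - a) * z\<bar> * exp (- k * z) \<le> 6 * exp (k / 4 * z) * exp (- k * z)"
      by (intro mult_right_mono) auto
    also have "\<dots> = 6 * exp (- (\<gamma> + \<mu> / 2) * z)"
      by (simp add: \<gamma>_def algebra_simps flip: exp_add)
    finally have "k\<^sup>2 * (1 - a) * (\<bar>1 - 3 * a - k * (1 - a) * z\<bar> * exp (- k * z)) \<le>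
        k\<^sup>2 * (1 - a) * (6 * exp (- (\<gamma> + \<mu> / 2) * z))"
      using a by (intro mult_left_mono) auto
    moreover have "\<bar>K z\<bar> = k\<^sup>2 * (1 - a) * (\<bar>1 - 3 * a - k * (1 - a) * z\<bar> * exp (- k * z))"
      unfolding K_eq using a by (simp add: abs_mult)
    ultimately show ?thesis using True by (simp add: mult_ac)
  qed (simp add: K0)
  have Fb': "\<bar>F x\<bar> \<le> n / sqrt \<mu> * (indicator {0<..} x * exp (- (\<delta> + \<mu> / 2) * x))" for x
  proof (cases "x > 0")
    case True
    have d: "\<delta> + \<mu> / 2 = \<mu> * E / 2" by (simp add: \<delta>_def algebra_simps add_divide_distrib[symmetric])
    show ?thesis unfolding d using Fb[OF True] True by simp
  qed (simp add: F0)
  define B where "B = n / sqrt \<mu> * (6 * k\<^sup>2 * (1 - a))"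
  have B0: "B \<ge> 0" using n0 \<mu> a by (simp add: B_def)
  have Cb: "\<bar>C y\<bar> \<le> B * V y" for y
  proof -
    let ?p = "\<lambda>x. indicator {0<..} x * exp (- (\<delta> + \<mu> / 2) * x) :: real"
      and ?q = "\<lambda>z. indicator {0<..} z * exp (- (\<gamma> + \<mu> / 2) * z) :: real"
    have pw: "norm (F x * K (y - x)) \<le> B * (?p x * ?q (y - x))" for x
    proof -
      have "\<bar>F x\<bar> * \<bar>K (y - x)\<bar> \<le> (n / sqrt \<mu> * ?p x) * (6 * k\<^sup>2 * (1 - a) * ?q (y - x))"
        using n0 \<mu> by (intro mult_mono Fb' Kb) auto
      then show ?thesis by (simp add: B_def abs_mult mult_ac)
    qed
    have pqi: "integrable lborel (\<lambda>x. ?p x * ?q (y - x))"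
    proof (rule integrable_mult_bounded[of _ _ 1])
      show "integrable lborel ?p" using \<delta> \<mu> by (intro exp_integral_halfline(1)) auto
      show "\<bar>?q (y - x)\<bar> \<le> 1" for x
        using \<gamma> \<mu> by (auto simp: indicator_def intro!: mult_nonpos_nonneg)
    qed measurable
    have FKi: "integrable lborel (\<lambda>x. F x * K (y - x))"
      by (rule Bochner_Integration.integrable_bound[OF integrable_mult_right[OF pqi, of B]])
        (measurable, use order_trans[OF pw abs_ge_self] in auto)
    have "norm (C y) \<le> (LINT x|lborel. norm (F x * K (y - x)))"
      unfolding C_def by (rule integral_norm_bound)
    also have "\<dots> \<le> (LINT x|lborel. B * (?p x * ?q (y - x)))"
      using FKi pqi by (intro integral_mono pw integrable_norm integrable_mult_right)
    finally have "norm (C y) \<le> B * (LINT x|lborel. ?p x * ?q (y - x))" by simp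
    then show ?thesis by (simp add: V_def)
  qed
  have sC: "sqint ?W C" "l2norm ?W C \<le> B * (1 / (\<delta> * sqrt \<gamma>))"
  proof -
    have s: "sqint ?W (\<lambda>y. B * V y)" by (rule sqint_cmult[OF V(1)])
    have le: "AE y in ?W. \<bar>C y\<bar> \<le> \<bar>B * V y\<bar>" using order_trans[OF Cb abs_ge_self] by (intro AE_I2)
    show "sqint ?W C" by (rule l2norm_mono(1)[OF s _ le]) auto
    have "l2norm ?W C \<le> l2norm ?W (\<lambda>y. B * V y)" by (rule l2norm_mono(2)[OF s _ le]) auto
    also have "\<dots> = B * l2norm ?W V" unfolding l2norm_cmult using B0 by simp
    also have "\<dots> \<le> B * (1 / (\<delta> * sqrt \<gamma>))" using V(2) B0 by (intro mult_left_mono)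
    finally show "l2norm ?W C \<le> B * (1 / (\<delta> * sqrt \<gamma>))" .
  qed
  have b1: "a\<^sup>2 * E * l2norm ?W f \<le> n * a"
  proof -
    have "a\<^sup>2 * E * l2norm ?W f = a * l2norm ?W f" using aE by (simp add: power2_eq_square mult_ac)
    also have "\<dots> \<le> a * (n / sqrt E)" using sf(2) a by (intro mult_left_mono) auto
    also have "\<dots> \<le> a * n"
    proof -
      have "n / sqrt E \<le> n / 1" using n0 E by (intro divide_left_mono) auto
      then have "n / sqrt E \<le> n" by simp
      then show ?thesis using a by (intro mult_left_mono) auto
    qed
    finally show ?thesis by (simp add: mult.commute)
  qed
  \<comment> \<open>This identity gives the decay factor a together with E - 1, which cancels the
    blow-up of the bounds for \<open>F\<close> and 1/\<delta> as t tends to 0. It is the reason for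
    keeping 1 - a explicit in \<open>c1\<close> and in the bound for \<open>K\<close>.\<close>
  have aE1: "1 - a = a * (E - 1)" using aE by (simp add: algebra_simps)
  have b2: "c1 * l2norm ?W F \<le> 2 * k / \<mu> * n * a"
  proof -
    have "c1 * l2norm ?W F \<le> c1 * (n / (\<mu> * sqrt (E - 1)))" using c1 sF(2) by (intro mult_left_mono)
    also have "\<dots> = 2 * k / \<mu> * n * a * (a * ((E - 1) / sqrt (E - 1)))"
      unfolding c1_def aE1 by simp
    also have "(E - 1) / sqrt (E - 1) = sqrt (E - 1)" using E by (simp add: real_div_sqrt)
    also have "2 * k / \<mu> * n * a * (a * sqrt (E - 1)) \<le> 2 * k / \<mu> * n * a * 1"
    proof (rule mult_left_mono)
      have "E - 1 \<le> E * E" using E mult_left_mono[of 1 E E] by linarith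
      then have "sqrt (E - 1) \<le> E" using E by (simp add: real_sqrt_le_iff real_le_lsqrt power2_eq_square)
      then have "a * sqrt (E - 1) \<le> a * E" using a by (intro mult_left_mono) auto
      then show "a * sqrt (E - 1) \<le> 1" using aE by simp
    qed (use k \<mu> n0 a in auto)
    finally show ?thesis by simp
  qed
  have b3: "B * (1 / (\<delta> * sqrt \<gamma>)) = 12 * k\<^sup>2 / (\<mu> * sqrt \<mu> * sqrt \<gamma>) * n * a"
    unfolding B_def aE1 \<delta>_def using E \<mu> \<gamma> by (simp add: field_simps)
  have s1: "sqint ?W (\<lambda>y. a\<^sup>2 * E * f y)" "sqint ?W (\<lambda>y. c1 * F y)"
    using sf(1) sF(1) by (auto intro: sqint_cmult)
  have "sqint ?W R1" unfolding R1_def using s1 by (rule sqint_add)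
  then have "l2norm ?W R \<le> l2norm ?W R1 + l2norm ?W C"
    unfolding R_def using l2norm_triangle[OF _ sC(1), of R1] by simp
  also have "l2norm ?W R1 \<le> l2norm ?W (\<lambda>y. a\<^sup>2 * E * f y) + l2norm ?W (\<lambda>y. c1 * F y)"
    unfolding R1_def using s1 by (rule l2norm_triangle)
  also have "\<dots> = a\<^sup>2 * E * l2norm ?W f + c1 * l2norm ?W F"
    unfolding l2norm_cmult using c1 E by simp
  finally have "l2norm ?W R \<le> n * a + 2 * k / \<mu> * n * a + 12 * k\<^sup>2 / (\<mu> * sqrt \<mu> * sqrt \<gamma>) * n * a"
    using b1 b2 b3 sC(2) by linarith
  also have "\<dots> = decay_const k \<mu> * n * a" by (simp add: decay_const_def \<gamma>_def algebra_simps)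
  finally show ?thesis unfolding HR by (simp add: n_def a_def)
qed

section \<open>Density of the domain and the decay estimate\<close>

text \<open>For a primitive \<open>H\<close> and \<open>c = 1 + \<theta>\<close> the function \<open>(H(y) - H(c y)) / (\<theta> y)\<close> lies in the domain,
  and its tail integral is the mean of \<open>H(y z)\<close> over \<open>1 \<le> z \<le> c\<close> with respect to \<open>dz / (\<theta> z)\<close>.\<close>

definition smooth_datum :: "real \<Rightarrow> (real \<Rightarrow> real) \<Rightarrow> real \<Rightarrow> real" where
  "smooth_datum \<theta> H y = (H y - H ((1 + \<theta>) * y)) / (\<theta> * y)"

text \<open>Multiplying the datum by y leaves a multiple of \<open>H\<close> minus a dilate of
  \<open>H\<close>; both lie in the weighted space and have integral 0.\<close>

lemma smooth_datum_X_0: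
  assumes H: "sqint (wmeas \<mu>) H" "\<And>y. y \<le> 0 \<Longrightarrow> H y = 0" "(LINT y|lborel. H y) = 0"
    and \<mu>: "\<mu> > 0" and \<theta>: "\<theta> > 0"
  shows "smooth_datum \<theta> H \<in> X_0 \<mu>"
proof -
  let ?c = "1 + \<theta>"
  let ?K = "\<lambda>y. (1 / \<theta>) * (H y - H (?c * y))"
  have K: "sqint (wmeas \<mu>) ?K"
    using \<theta> by (intro sqint_cmult sqint_diff H(1) sqint_dilation(1)[OF H(1) \<mu>]) auto
  have eq: "y * smooth_datum \<theta> H y = ?K y" for y
    using \<theta> H(2)[of 0] by (cases "y = 0") (auto simp: smooth_datum_def)
  have i: "integrable lborel H" using moment_integrable(1)[OF H(1,2) \<mu>] .
  have "(LINT y|lborel. ?K y) = 0"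
    using i integrable_scale[OF i, of ?c] integral_scale[of ?c H] \<theta> H(3) by simp
  moreover have "indicator {0<..} y * ?K y = ?K y" for y
    using H(2)[of y] H(2)[of "?c * y"] \<theta> by (cases "y > 0") (auto simp: mult_nonneg_nonpos)
  ultimately show ?thesis
    using sqint_L2_exp[OF K] by (simp only: X_0_def eq set_LINT_halfline mem_Collect_eq simp_thms)
qed

text \<open>dx/x is invariant under dilation, so the tail from y of H((1 + \<theta>) x)/x is the
  tail from (1 + \<theta>) y of H(x)/x. The difference of the two tails is an integral over a
  bounded interval.\<close>

lemma smooth_datum_tail:
  assumes H: "integrable lborel H" and \<theta>: "\<theta> > 0" and y: "y > 0"
  shows "tail_integral (smooth_datum \<theta> H) y = (LINT x|lborel. indicator {y<..(1 + \<theta>) * y} x * (H x / x)) / \<theta>"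
proof -
  let ?c = "1 + \<theta>"
  have c: "?c > 1" using \<theta> by simp
  have [measurable]: "H \<in> borel_measurable borel" using borel_measurable_integrable[OF H] by simp
  have i: "integrable lborel (\<lambda>x. indicator {z<..} x * (H x / x))" if z: "z > 0" for z
  proof (rule Bochner_Integration.integrable_bound[OF integrable_mult_right[OF H, of "1 / z"]])
    show "AE x in lborel. norm (indicator {z<..} x * (H x / x)) \<le> norm (1 / z * H x)"
    proof (rule AE_I2)
      fix x show "norm (indicator {z<..} x * (H x / x)) \<le> norm (1 / z * H x)"
        using z by (cases "z < x") (auto simp: divide_left_mono)
    qed
  qed measurable
  have yc: "?c * y > 0" "y \<le> ?c * y" using y c by auto
  let ?g = "\<lambda>x. indicator {?c * y<..} x * (H x / x)"
  have sc: "?c * ?g (?c * x) = indicator {y<..} x * (H (?c * x) / x)" for x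
    using c by (auto simp: indicator_def)
  have i2: "integrable lborel (\<lambda>x. indicator {y<..} x * (H (?c * x) / x))"
    using integrable_mult_right[OF integrable_scale[OF i[OF yc(1)], of ?c], of ?c] c unfolding sc by simp
  have I2: "(LINT x|lborel. indicator {y<..} x * (H (?c * x) / x)) = (LINT x|lborel. ?g x)"
  proof -
    have "(LINT x|lborel. ?c * ?g (?c * x)) = ?c * ((LINT x|lborel. ?g x) / ?c)"
      unfolding integral_mult_right_zero using c integral_scale[of ?c ?g] by simp
    then show ?thesis unfolding sc using c by simp
  qed
  have "tail_integral (smooth_datum \<theta> H) y =
      (LINT x|lborel. (1 / \<theta>) * (indicator {y<..} x * (H x / x) - indicator {y<..} x * (H (?c * x) / x)))"
    unfolding tail_integral_def set_lebesgue_integral_def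
    by (rule Bochner_Integration.integral_cong) (use y in \<open>auto simp: smooth_datum_def indicator_def diff_divide_distrib mult.commute[of \<theta>]\<close>)
  also have "\<dots> = (1 / \<theta>) * ((LINT x|lborel. indicator {y<..} x * (H x / x)) - (LINT x|lborel. ?g x))"
    unfolding integral_mult_right_zero using i[OF y] i2 by (simp only: Bochner_Integration.integral_diff I2)
  also have "(LINT x|lborel. indicator {y<..} x * (H x / x)) - (LINT x|lborel. ?g x) =
      (LINT x|lborel. indicator {y<..} x * (H x / x) - ?g x)"
    using i[OF y] i[OF yc(1)] by simp
  also have "\<dots> = (LINT x|lborel. indicator {y<..?c * y} x * (H x / x))"
    by (rule Bochner_Integration.integral_cong) (use yc in \<open>auto simp: indicator_def\<close>)
  finally show ?thesis by simp
qed

text \<open>By Cauchy-Schwarz on \<open>(y, c y)\<close> and Tonelli, using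
  \<open>y exp (\<mu> y) \<le> x exp (\<mu> x)\<close> on \<open>x / c \<le> y < x\<close>.\<close>

lemma smooth_datum_contraction:
  assumes H: "sqint (wmeas \<mu>) H" "\<And>y. y \<le> 0 \<Longrightarrow> H y = 0"
    and \<mu>: "\<mu> > 0" and \<theta>: "\<theta> > 0"
    and Tm: "T \<in> borel_measurable borel"
    and T: "\<And>y. y > 0 \<Longrightarrow> T y = (LINT x|lborel. indicator {y<..(1 + \<theta>) * y} x * (H x / x)) / \<theta>"
  shows "sqint (wmeas \<mu>) T" "l2norm (wmeas \<mu>) T \<le> l2norm (wmeas \<mu>) H"
proof -
  let ?c = "1 + \<theta>"
  have Hm[measurable]: "H \<in> borel_measurable borel" using H(1) by (auto dest: sqintD)
  note [measurable] = Tm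
  have q: "integrable lborel (\<lambda>y. indicator {0<..} y * exp (\<mu> * y) * (H y)\<^sup>2)"
    using H(1) sqint_wmeas_iff[OF Hm] by simp
  define A where "A y x = (if 0 < y \<and> y < x \<and> x \<le> ?c * y then 1 else 0 :: real)" for y x
  define \<Phi> where "\<Phi> y x = A y x * (y * exp (\<mu> * y) / \<theta>) * (H x / x)\<^sup>2" for y x
  have pw: "indicator {0<..} y * exp (\<mu> * y) * (T y)\<^sup>2 \<le> (LINT x|lborel. \<Phi> y x) \<and>
      integrable lborel (\<Phi> y)" for y
  proof (cases "y > 0")
    case True
    have c: "?c * y - y = \<theta> * y" "y \<le> ?c * y" using \<theta> True by (auto simp: algebra_simps)
    let ?i = "\<lambda>x. indicator {y<..?c * y} x :: real" and ?j = "\<lambda>x. indicator {y<..?c * y} x * (H x / x)"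
    have si: "sqint lborel ?i"
    proof -
      have "(?i x)\<^sup>2 = ?i x" for x by (simp add: indicator_def)
      moreover have "integrable lborel ?i"
        by (rule integrable_real_indicator) (use emeasure_bounded_finite[of "{y<..?c * y}"] in auto)
      ultimately show ?thesis by (simp add: sqint_def)
    qed
    have sj: "sqint lborel ?j"
    proof -
      have "integrable lborel (\<lambda>x. (?j x)\<^sup>2)"
      proof (rule Bochner_Integration.integrable_bound[OF integrable_mult_right[OF q, of "1 / y\<^sup>2"]])
        show "AE x in lborel. norm ((?j x)\<^sup>2) \<le> norm (1 / y\<^sup>2 * (indicator {0<..} x * exp (\<mu> * x) * (H x)\<^sup>2))"
        proof (rule AE_I2)
          fix x show "norm ((?j x)\<^sup>2) \<le> norm (1 / y\<^sup>2 * (indicator {0<..} x * exp (\<mu> * x) * (H x)\<^sup>2))"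
          proof (cases "y < x \<and> x \<le> ?c * y")
            case 2: True
            have "1 / x\<^sup>2 \<le> 1 / y\<^sup>2" using 2 True by (intro divide_left_mono power_mono) auto
            moreover have "1 \<le> exp (\<mu> * x)" using 2 True \<mu> by simp
            ultimately have "1 / x\<^sup>2 * 1 \<le> 1 / y\<^sup>2 * exp (\<mu> * x)" by (intro mult_mono) auto
            then have "1 / x\<^sup>2 * 1 * (H x)\<^sup>2 \<le> 1 / y\<^sup>2 * exp (\<mu> * x) * (H x)\<^sup>2" by (intro mult_right_mono) auto
            then show ?thesis using 2 True by (simp add: power_divide abs_mult)
          qed auto
        qed
      qed measurable
      then show ?thesis by (simp add: sqint_def)
    qed
    have "\<bar>LINT x|lborel. ?i x * ?j x\<bar> \<le> l2norm lborel ?i * l2norm lborel ?j"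
      by (rule Cauchy_Schwarz_integral[OF si sj])
    moreover have "(\<lambda>x. ?i x * ?j x) = ?j" by (auto simp: fun_eq_iff indicator_def)
    ultimately have "\<bar>LINT x|lborel. ?j x\<bar>\<^sup>2 \<le> (l2norm lborel ?i * l2norm lborel ?j)\<^sup>2"
      by (intro power_mono) auto
    also have "\<dots> = \<theta> * y * (LINT x|lborel. (?j x)\<^sup>2)"
    proof -
      have "(?i x)\<^sup>2 = ?i x" for x by (simp add: indicator_def)
      then have "(l2norm lborel ?i)\<^sup>2 = \<theta> * y" unfolding l2norm_power2 using c by simp
      then show ?thesis by (simp add: power_mult_distrib l2norm_power2)
    qed
    finally have "exp (\<mu> * y) / \<theta>\<^sup>2 * (LINT x|lborel. ?j x)\<^sup>2 \<le> exp (\<mu> * y) / \<theta>\<^sup>2 * (\<theta> * y * (LINT x|lborel. (?j x)\<^sup>2))"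
      by (intro mult_left_mono) auto
    also have "\<dots> = (LINT x|lborel. y * exp (\<mu> * y) / \<theta> * (?j x)\<^sup>2)"
      using \<theta> by (simp add: power2_eq_square[of \<theta>])
    also have e: "(\<lambda>x. y * exp (\<mu> * y) / \<theta> * (?j x)\<^sup>2) = \<Phi> y"
      using True by (auto simp: \<Phi>_def A_def fun_eq_iff indicator_def)
    finally have "indicator {0<..} y * exp (\<mu> * y) * (T y)\<^sup>2 \<le> (LINT x|lborel. \<Phi> y x)"
      using True by (simp add: T[OF True] power_divide)
    moreover have "integrable lborel (\<Phi> y)"
      unfolding e[symmetric] using sj by (intro integrable_mult_right) auto
    ultimately show ?thesis by simp
  next
    case False
    then have "\<Phi> y = (\<lambda>x. 0)" by (auto simp: \<Phi>_def A_def)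
    then show ?thesis using False by simp
  qed
  have \<Phi>0: "0 \<le> \<Phi> y x" for y x using \<theta> by (auto simp: \<Phi>_def A_def)
  have \<Phi>m: "(\<lambda>(y, x). ennreal (\<Phi> y x)) \<in> borel_measurable (lborel \<Otimes>\<^sub>M lborel)"
    unfolding \<Phi>_def A_def by measurable
  \<comment> \<open>For fixed x the admissible y lie in [x/c, x], of length at most \<theta> x; this
    cancels the 1/\<theta> and one factor x, and the other x comes from y \<le> x. The contraction
    constant is therefore 1.\<close>
  have inner: "(\<integral>\<^sup>+y. ennreal (\<Phi> y x) \<partial>lborel) \<le> ennreal (indicator {0<..} x * exp (\<mu> * x) * (H x)\<^sup>2)" for x
  proof (cases "x > 0")
    case True
    let ?k = "x * exp (\<mu> * x) / \<theta> * (H x / x)\<^sup>2"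
    have k0: "?k \<ge> 0" using True \<theta> by simp
    have "ennreal (\<Phi> y x) \<le> ennreal ?k * indicator {x / ?c..x} y" for y
    proof (cases "0 < y \<and> y < x \<and> x \<le> ?c * y")
      case 2: True
      have "y * exp (\<mu> * y) \<le> x * exp (\<mu> * x)" using 2 \<mu> by (intro mult_mono) auto
      then have "\<Phi> y x \<le> ?k" using 2 \<theta> by (auto simp: \<Phi>_def A_def intro!: mult_right_mono divide_right_mono)
      moreover have "y \<in> {x / ?c..x}" using 2 \<theta> by (auto simp: field_simps)
      ultimately show ?thesis by (simp add: ennreal_leI)
    next
      case False
      then have "\<Phi> y x = 0" by (auto simp: \<Phi>_def A_def)
      then show ?thesis by simp
    qed
    then have "(\<integral>\<^sup>+y. ennreal (\<Phi> y x) \<partial>lborel) \<le> (\<integral>\<^sup>+y. ennreal ?k * indicator {x / ?c..x} y \<partial>lborel)"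
      by (intro nn_integral_mono)
    also have "\<dots> = ennreal ?k * emeasure lborel {x / ?c..x}" by (rule nn_integral_cmult_indicator) auto
    also have "emeasure lborel {x / ?c..x} = ennreal (x - x / ?c)"
      using True \<theta> by (intro emeasure_lborel_Icc) (simp add: field_simps)
    also have "ennreal ?k * ennreal (x - x / ?c) = ennreal (?k * (x - x / ?c))"
      using k0 True \<theta> by (intro ennreal_mult[symmetric]) (auto simp: field_simps)
    also have "\<dots> \<le> ennreal (?k * (\<theta> * x))"
    proof (rule ennreal_leI, rule mult_left_mono[OF _ k0])
      have "x - x / ?c = \<theta> * x / ?c" using \<theta> by (simp add: field_simps)
      also have "\<dots> \<le> \<theta> * x / 1" using \<theta> True by (intro divide_left_mono) auto
      finally show "x - x / ?c \<le> \<theta> * x" by simp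
    qed
    also have "?k * (\<theta> * x) = indicator {0<..} x * exp (\<mu> * x) * (H x)\<^sup>2"
      using True \<theta> by (simp add: power2_eq_square)
    finally show ?thesis .
  next
    case False
    then have "\<Phi> y x = 0" for y by (auto simp: \<Phi>_def A_def)
    then show ?thesis by simp
  qed
  have "(\<integral>\<^sup>+y. ennreal ((T y)\<^sup>2) \<partial>wmeas \<mu>) = (\<integral>\<^sup>+y. ennreal (indicator {0<..} y * exp (\<mu> * y) * (T y)\<^sup>2) \<partial>lborel)"
    unfolding wmeas_def by (subst nn_integral_density) (auto simp: ennreal_mult intro!: nn_integral_cong)
  also have "\<dots> \<le> (\<integral>\<^sup>+y. \<integral>\<^sup>+x. ennreal (\<Phi> y x) \<partial>lborel \<partial>lborel)"
  proof (rule nn_integral_mono)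
    fix y
    have "(\<integral>\<^sup>+x. ennreal (\<Phi> y x) \<partial>lborel) = ennreal (LINT x|lborel. \<Phi> y x)"
      using pw[of y] \<Phi>0 by (intro nn_integral_eq_integral) auto
    then show "ennreal (indicator {0<..} y * exp (\<mu> * y) * (T y)\<^sup>2) \<le> (\<integral>\<^sup>+x. ennreal (\<Phi> y x) \<partial>lborel)"
      using pw[of y] by (simp add: ennreal_leI)
  qed
  also have "\<dots> = (\<integral>\<^sup>+x. \<integral>\<^sup>+y. ennreal (\<Phi> y x) \<partial>lborel \<partial>lborel)"
    using lborel_pair.Fubini'[OF \<Phi>m] by simp
  also have "\<dots> \<le> (\<integral>\<^sup>+x. ennreal (indicator {0<..} x * exp (\<mu> * x) * (H x)\<^sup>2) \<partial>lborel)"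
    by (intro nn_integral_mono inner)
  also have "\<dots> = (\<integral>\<^sup>+y. ennreal ((H y)\<^sup>2) \<partial>wmeas \<mu>)"
    unfolding wmeas_def by (subst nn_integral_density) (auto simp: ennreal_mult intro!: nn_integral_cong)
  also have "\<dots> = ennreal ((l2norm (wmeas \<mu>) H)\<^sup>2)" by (rule nn_integral_sqint[OF H(1)])
  finally have "(\<integral>\<^sup>+y. ennreal ((T y)\<^sup>2) \<partial>wmeas \<mu>) \<le> ennreal ((l2norm (wmeas \<mu>) H)\<^sup>2)" .
  from sqint_if_nn_integral_le[OF _ this l2norm_nonneg]
  show "sqint (wmeas \<mu>) T" "l2norm (wmeas \<mu>) T \<le> l2norm (wmeas \<mu>) H" by auto
qed

text \<open>Lebesgue differentiation of H(x)/x with step \<theta> y. This function may be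
  non-integrable at 0, so it is truncated at 1/(k+1) for countably many k, and near a given y > 0
  some truncation is invisible.\<close>

lemma smooth_datum_converges:
  fixes H :: "real \<Rightarrow> real"
  assumes H: "integrable lborel H" and z: "\<And>y. y \<le> 0 \<Longrightarrow> H y = 0"
  shows "AE y in lborel. 0 < y \<longrightarrow>
    ((\<lambda>\<theta>. (LINT x|lborel. indicator {y<..(1 + \<theta>) * y} x * (H x / x)) / \<theta>) \<longlongrightarrow> H y) (at_right 0)"
proof -
  have [measurable]: "H \<in> borel_measurable borel" using borel_measurable_integrable[OF H] by simp
  define f where "f k x = indicator {1 / real (Suc k)<..} x * (H x / x)" for k x
  have i: "integrable lborel (f k)" for k
  proof (rule Bochner_Integration.integrable_bound[OF integrable_mult_right[OF H, of "real (Suc k)"]])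
    show "AE x in lborel. norm (f k x) \<le> norm (real (Suc k) * H x)"
    proof (rule AE_I2)
      fix x show "norm (f k x) \<le> norm (real (Suc k) * H x)"
      proof (cases "1 / real (Suc k) < x")
        case True
        have "x > 0" by (rule less_trans[OF _ True]) simp
        have "1 / x \<le> real (Suc k)" using True \<open>x > 0\<close> by (simp add: field_simps)
        then have "1 / x * \<bar>H x\<bar> \<le> real (Suc k) * \<bar>H x\<bar>" by (intro mult_right_mono) auto
        then show ?thesis using True \<open>x > 0\<close> by (simp add: f_def abs_mult)
      qed (simp add: f_def)
    qed
  qed (unfold f_def, measurable)
  have "AE y in lborel. \<forall>k. ((\<lambda>h. (LINT x|lborel. f k x * indicator {y<..y+h} x) / h) \<longlongrightarrow> f k y) (at_right 0)"
    unfolding AE_all_countable using right_average_tendsto[OF i] by blast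
  then show ?thesis
  proof (rule AE_mp, intro AE_I2 impI)
    fix y :: real assume y: "0 < y"
      and lim: "\<forall>k. ((\<lambda>h. (LINT x|lborel. f k x * indicator {y<..y+h} x) / h) \<longlongrightarrow> f k y) (at_right 0)"
    obtain k where k: "1 / real (Suc k) < y" using nat_approx_posE[OF y] by metis
    have fl: "filterlim (\<lambda>\<theta>. \<theta> * y) (at_right 0) (at_right 0)"
    proof (rule filterlim_at_withinI)
      show "((\<lambda>\<theta>. \<theta> * y) \<longlongrightarrow> 0) (at_right 0)" by (auto intro!: tendsto_eq_intros)
      show "\<forall>\<^sub>F \<theta> in at_right 0. \<theta> * y \<in> {0<..} - {0}" using y by (auto simp: eventually_at_filter)
    qed
    have "((\<lambda>\<theta>. y * ((LINT x|lborel. f k x * indicator {y<..y + \<theta> * y} x) / (\<theta> * y))) \<longlongrightarrow> y * f k y) (at_right 0)"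
      by (intro tendsto_mult_left filterlim_compose[OF lim[rule_format, of k] fl])
    moreover have "y * f k y = H y" using k y by (simp add: f_def)
    moreover have "y * ((LINT x|lborel. f k x * indicator {y<..y + \<theta> * y} x) / (\<theta> * y)) =
        (LINT x|lborel. indicator {y<..(1 + \<theta>) * y} x * (H x / x)) / \<theta>" for \<theta>
    proof -
      have "(\<lambda>x. f k x * indicator {y<..y + \<theta> * y} x) = (\<lambda>x. indicator {y<..(1 + \<theta>) * y} x * (H x / x))"
        using k by (auto simp: fun_eq_iff f_def indicator_def algebra_simps)
      then show ?thesis using y by simp
    qed
    ultimately show "((\<lambda>\<theta>. (LINT x|lborel. indicator {y<..(1 + \<theta>) * y} x * (H x / x)) / \<theta>) \<longlongrightarrow> H y) (at_right 0)"
      by simp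
  qed
qed

text \<open>The tail integrals of the smoothed data converge pointwise to \<open>H\<close> and do
  not exceed it in norm, so \<open>l2_convergence\<close> gives approximation in norm.\<close>

lemma X_0_dense:
  assumes \<mu>: "\<mu> > 0" and u: "u \<in> X_minus1 \<mu>" and e: "e > 0"
  obtains h where "h \<in> X_0 \<mu>" "distr_of h \<in> X_minus1 \<mu>" "norm_minus1 \<mu> (\<lambda>\<phi>. distr_of h \<phi> - u \<phi>) < e"
proof -
  obtain H where H: "is_primitive H u" "sqint (wmeas \<mu>) H" "(LINT y|lborel. H y) = 0"
    using X_minus1_primitive[OF u \<mu>] .
  have H0: "H y = 0" if "y \<le> 0" for y using H(1) that by (simp add: is_primitive_def)
  have Hi: "integrable lborel H" using H(1) by (simp add: is_primitive_def)
  define \<theta> where "\<theta> n = 1 / real (Suc n)" for n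
  have \<theta>: "\<theta> n > 0" for n by (simp add: \<theta>_def)
  define h where "h n = smooth_datum (\<theta> n) H" for n
  define T where "T n y = indicator {0<..} y * tail_integral (h n) y" for n y
  have hX: "h n \<in> X_0 \<mu>" for n unfolding h_def by (rule smooth_datum_X_0[OF H(2) H0 H(3) \<mu> \<theta>])
  have Tp: "is_primitive (T n) (distr_of (h n))" for n
    unfolding T_def by (rule is_primitive_tail(4)[OF hX \<mu>])
  have Ti: "integrable lborel (T n)" for n using Tp[of n] by (simp add: is_primitive_def)
  have T_eq: "T n y = (LINT x|lborel. indicator {y<..(1 + \<theta> n) * y} x * (H x / x)) / \<theta> n" if "y > 0" for n y
    using smooth_datum_tail[OF Hi \<theta> that] that by (simp add: T_def h_def)
  have Ts: "sqint (wmeas \<mu>) (T n)" "l2norm (wmeas \<mu>) (T n) \<le> l2norm (wmeas \<mu>) H" for n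
    using smooth_datum_contraction[OF H(2) H0 \<mu> \<theta> _ T_eq] borel_measurable_integrable[OF Ti[of n]] by auto
  \<comment> \<open>By Fubini the integral of the tail is the integral of x h(x), which vanishes in
    the space with index 0.\<close>
  have TI: "(LINT y|lborel. T n y) = 0" for n
  proof -
    have "(LINT y|lborel. T n y * 1) = (LINT x|lborel. indicator {0<..} x * h n x * (LINT y|lborel. indicator {0<..<x} y * 1))"
      unfolding T_def by (rule is_primitive_tail(5)[OF hX \<mu>, of "\<lambda>_. 1" 1]) auto
    also have "\<dots> = (LINT x|lborel. indicator {0<..} x * (x * h n x))"
    proof (rule Bochner_Integration.integral_cong[OF refl])
      fix x show "indicator {0<..} x * h n x * (LINT y|lborel. indicator {0<..<x} y * 1) = indicator {0<..} x * (x * h n x)"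
        by (cases "x > 0") auto
    qed
    also have "\<dots> = 0" using hX[of n] by (simp add: X_0_def set_LINT_halfline)
    finally show ?thesis by simp
  qed
  have conv: "AE y in lborel. 0 < y \<longrightarrow>
      ((\<lambda>\<theta>. (LINT x|lborel. indicator {y<..(1 + \<theta>) * y} x * (H x / x)) / \<theta>) \<longlongrightarrow> H y) (at_right 0)"
    by (rule smooth_datum_converges[OF Hi]) (rule H0)
  have "AE y in wmeas \<mu>. (\<lambda>n. T n y) \<longlonglongrightarrow> H y"
    unfolding AE_wmeas_iff using conv
  proof eventually_elim
    fix y assume *: "0 < y \<longrightarrow>
      ((\<lambda>\<theta>. (LINT x|lborel. indicator {y<..(1 + \<theta>) * y} x * (H x / x)) / \<theta>) \<longlongrightarrow> H y) (at_right 0)"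
    have "filterlim \<theta> (at_right 0) sequentially"
      unfolding \<theta>_def
    proof (rule filterlim_at_withinI)
      show "(\<lambda>n. 1 / real (Suc n)) \<longlonglongrightarrow> 0" by (rule LIMSEQ_Suc[OF lim_1_over_n])
    qed simp
    then show "0 < y \<longrightarrow> (\<lambda>n. T n y) \<longlonglongrightarrow> H y"
      using * filterlim_compose[of _ _ "at_right 0" \<theta> sequentially] T_eq by auto
  qed
  from l2_convergence[OF Ts(1) H(2) Ts(2) this e]
  obtain n where n: "l2norm (wmeas \<mu>) (\<lambda>y. T n y - H y) < e" by blast
  show ?thesis
  proof (rule that[OF hX])
    show "distr_of (h n) \<in> X_minus1 \<mu>" by (rule X_minus1I[OF Tp Ts(1) TI \<mu>])
    show "norm_minus1 \<mu> (\<lambda>\<phi>. distr_of (h n) \<phi> - u \<phi>) < e"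
      using norm_minus1_primitive[OF is_primitive_diff[OF Tp H(1)] sqint_diff[OF Ts(1) H(2)] \<mu>, of n] n by simp
  qed
qed

section \<open>The decay estimate\<close>

text \<open>The characteristic that reaches \<sigma> at time t starts at \<sigma> exp(-t). Inserting
  this in the evolution formula and setting k = 2/\<rho> gives exactly the multiplier treated in
  \<open>multiplier_bound\<close>.\<close>

lemma domain_decay:
  assumes \<rho>: "\<rho> > 0" and \<mu>: "\<mu> > 0" "\<mu> \<le> 2 / \<rho>" and S: "coag_semigroup \<rho> \<mu> S"
    and h: "h \<in> X_0 \<mu>" "distr_of h \<in> X_minus1 \<mu>" and t: "t > 0"
  shows "norm_minus1 \<mu> (S t (distr_of h)) \<le> decay_const (2 / \<rho>) \<mu> * norm_minus1 \<mu> (distr_of h) * exp (- t)"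
proof -
  interpret complete_function_space "X_minus1 \<mu>" "norm_minus1 \<mu>" by (rule complete_X_minus1[OF \<mu>(1)])
  have C0: "C0_semigroup (X_minus1 \<mu>) (norm_minus1 \<mu>) S" using S by (simp add: coag_semigroup_def)
  obtain G where G: "is_primitive G (distr_of h)" "sqint (wmeas \<mu>) G" "(LINT y|lborel. G y) = 0"
    using X_minus1_primitive[OF h(2) \<mu>(1)] .
  have SX: "S t (distr_of h) \<in> X_minus1 \<mu>" using semigroup_mem[OF C0 _ h(2)] t by simp
  obtain H where H: "is_primitive H (S t (distr_of h))" "sqint (wmeas \<mu>) H" "(LINT y|lborel. H y) = 0"
    using X_minus1_primitive[OF SX \<mu>(1)] .
  have "l2norm (wmeas \<mu>) H \<le> decay_const (2 / \<rho>) \<mu> * l2norm (wmeas \<mu>) G * exp (- t)"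
  proof (rule multiplier_bound)
    show "laplace \<sigma> H = (exp (- t) + (1 - exp (- t)) * (2 / \<rho>) / (\<sigma> + 2 / \<rho>))\<^sup>2 * laplace (\<sigma> * exp (- t)) G"
      if \<sigma>: "\<sigma> > 0" for \<sigma>
    proof -
      define a where "a = exp (- t)"
      have a: "a > 0" "\<sigma> * a * exp t = \<sigma>" by (auto simp: a_def mult.assoc simp flip: exp_add)
      have pos: "1 + \<rho> * \<sigma> / 2 > 0" using \<rho> \<sigma> by (simp add: add_pos_pos)
      have "(1 + \<rho> * \<sigma> / 2)\<^sup>2 * laplace \<sigma> H = (1 + \<rho> * (\<sigma> * a) / 2)\<^sup>2 * laplace (\<sigma> * a) G"
        using laplace_evolution[OF \<rho> \<mu>(1) S h(1) less_imp_le[OF t] mult_pos_pos[OF \<sigma> a(1)] G(1,2) H(1,2)]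
        unfolding a(2) .
      moreover have "l = (A / B)\<^sup>2 * g" if "B\<^sup>2 * l = A\<^sup>2 * g" "B > 0" for A B l g :: real
        using that by (simp add: power_divide eq_divide_eq mult.commute)
      ultimately have "laplace \<sigma> H = ((1 + \<rho> * (\<sigma> * a) / 2) / (1 + \<rho> * \<sigma> / 2))\<^sup>2 * laplace (\<sigma> * a) G"
        using pos by blast
      also have "(1 + \<rho> * (\<sigma> * a) / 2) / (1 + \<rho> * \<sigma> / 2) = a + (1 - a) * (2 / \<rho>) / (\<sigma> + 2 / \<rho>)"
      proof -
        have "\<rho> * \<sigma> + 2 > 0" using \<rho> \<sigma> by (simp add: add_pos_pos)
        then have ne: "\<rho> * \<sigma> + 2 \<noteq> 0" by simp
        have e1: "(1 + \<rho> * (\<sigma> * a) / 2) / (1 + \<rho> * \<sigma> / 2) = (\<rho> * \<sigma> * a + 2) / (\<rho> * \<sigma> + 2)"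
          using ne by (simp add: field_simps)
        have "(2 / \<rho>) / (\<sigma> + 2 / \<rho>) = 2 / (\<rho> * \<sigma> + 2)" using \<rho> ne by (simp add: field_simps)
        then have e2: "a + (1 - a) * (2 / \<rho>) / (\<sigma> + 2 / \<rho>) = a + (1 - a) * (2 / (\<rho> * \<sigma> + 2))"
          by (metis times_divide_eq_right)
        show ?thesis unfolding e1 e2 using ne by (simp add: field_simps)
      qed
      finally show ?thesis by (simp add: a_def)
    qed
  qed (use \<rho> \<mu> t G H in \<open>auto simp: is_primitive_def\<close>)
  then show ?thesis
    using norm_minus1_primitive[OF G(1,2) \<mu>(1)] norm_minus1_primitive[OF H(1,2) \<mu>(1)] by simp
qed

theorem corollary3p15:
  fixes \<rho> \<mu> :: real
  assumes "\<rho> > 0" and "0 < \<mu>" and "\<mu> \<le> 2 / \<rho>"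
  shows "\<exists>K\<ge>1. \<forall>S. coag_semigroup \<rho> \<mu> S \<longrightarrow>
           (\<forall>h\<in>X_minus1 \<mu>. \<forall>t\<ge>0.
              norm_minus1 \<mu> (S t h) \<le> K * norm_minus1 \<mu> h * exp (- t))"
proof (intro exI[of _ "decay_const (2 / \<rho>) \<mu>"] conjI allI impI ballI)
  let ?K = "decay_const (2 / \<rho>) \<mu>" and ?N = "norm_minus1 \<mu>"
  have "0 \<le> 2 * (2 / \<rho>) / \<mu>" using assms by simp
  moreover have "0 \<le> 3 * (2 / \<rho>) / 4 - \<mu> / 2" using assms by (simp add: field_simps)
  then have "0 \<le> 12 * (2 / \<rho>)\<^sup>2 / (\<mu> * sqrt \<mu> * sqrt (3 * (2 / \<rho>) / 4 - \<mu> / 2))" using assms by simp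
  ultimately show K: "1 \<le> ?K" unfolding decay_const_def by linarith
  fix S u t assume S: "coag_semigroup \<rho> \<mu> S" and u: "u \<in> X_minus1 \<mu>" and t: "(0::real) \<le> t"
  interpret complete_function_space "X_minus1 \<mu>" ?N by (rule complete_X_minus1[OF assms(2)])
  have C0: "C0_semigroup (X_minus1 \<mu>) ?N S" using S by (simp add: coag_semigroup_def)
  show "?N (S t u) \<le> ?K * ?N u * exp (- t)"
  \<comment> \<open>Time 0 is separate because the estimate on the domain divides by exp t -
    1.\<close>
  proof (cases "t = 0")
    case True
    then show ?thesis using mult_right_mono[OF K N_nonneg[OF u]] semigroup_0[OF C0 u] by simp
  next
    case False
    obtain M where M: "M \<ge> 1" "\<And>s v. 0 \<le> s \<Longrightarrow> s \<le> t \<Longrightarrow> v \<in> X_minus1 \<mu> \<Longrightarrow> ?N (S s v) \<le> M * ?N v"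
      by (rule semigroup_locally_bounded[OF C0, of t]) blast
    show ?thesis
    proof (rule field_le_epsilon)
      fix e :: real assume e: "e > 0"
      \<comment> \<open>\<open>M\<close> may depend on \<open>S\<close> and \<open>t\<close>, but it
        multiplies only the approximation error and disappears as e tends to 0, so the final
        constant stays independent of both.\<close>
      define d where "d = e / (?K + M)"
      have d: "d > 0" using e K M(1) by (simp add: d_def)
      obtain h where h: "h \<in> X_0 \<mu>" "distr_of h \<in> X_minus1 \<mu>" "?N (\<lambda>\<phi>. distr_of h \<phi> - u \<phi>) < d"
        using X_0_dense[OF assms(2) u d] by metis
      let ?v = "distr_of h" and ?w = "\<lambda>\<phi>. distr_of h \<phi> - u \<phi>"
      have w: "?w \<in> X_minus1 \<mu>" by (rule diff_mem[OF h(2) u])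
      have Sw: "S t ?w \<in> X_minus1 \<mu>" "S t ?v \<in> X_minus1 \<mu>" using semigroup_mem[OF C0 t] w h(2) by auto
      have "S t u = (\<lambda>x. S t ?v x - S t ?w x)"
        using bounded_op_diff[OF semigroup_bounded_op[OF C0 t] h(2) w] by simp
      then have "?N (S t u) \<le> ?N (S t ?v) + ?N (S t ?w)" using N_diff[OF Sw(2) Sw(1)] by simp
      also have "?N (S t ?v) \<le> ?K * ?N ?v * exp (- t)"
        using domain_decay[OF assms S h(1,2)] t False by simp
      also have "?N (S t ?w) \<le> M * d"
        using M(2)[OF t order_refl w] mult_left_mono[of "?N ?w" d M] h(3) M(1) by linarith
      also have "?K * ?N ?v * exp (- t) \<le> ?K * ?N u * exp (- t) + ?K * d"
      proof -
        have "?N ?v \<le> ?N u + ?N ?w" using N_add[OF u w] by simp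
        then have "?N ?v \<le> ?N u + d" using h(3) by linarith
        then have "?K * ?N ?v * exp (- t) \<le> ?K * (?N u + d) * exp (- t)"
          using K by (intro mult_right_mono mult_left_mono) auto
        also have "\<dots> = ?K * ?N u * exp (- t) + ?K * d * exp (- t)" by (simp add: algebra_simps)
        also have "?K * d * exp (- t) \<le> ?K * d" using K d t by (intro mult_left_le) auto
        finally show ?thesis by simp
      qed
      finally have "?N (S t u) \<le> ?K * ?N u * exp (- t) + (?K + M) * d" by (simp add: algebra_simps)
      moreover have "(?K + M) * d = e" using K M(1) by (simp add: d_def)
      ultimately show "?N (S t u) \<le> ?K * ?N u * exp (- t) + e" by simp
    qed
  qed
qed

end
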